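(* Let $n\ge1$ and $\alpha\in(0,1)$. There exists a constant $c_{n,\alpha}>0$, depending on $n$ and $\alpha$ only, such that for every $p\in\left[1,\frac{n}{1-\alpha}\right)$ and every $f\in BV^{\alpha,p}(\mathbb{R}^n)$, with the additional requirement $f\ge0$ if $n=1$, one has $$c_{n,\alpha}\int_{\mathbb{R}^n}\frac{|f(x)|}{|x-x_0|^{\alpha}}\,dx\le|D^\alpha f|(\mathbb{R}^n)\quad\text{for all }x_0\in\mathbb{R}^n.$$ In particular, if $n=1$, the optimal (i.e. largest possible) constant is $c_{1,\alpha}=\frac{2\mu_{1,\alpha}}{\alpha}$.
   Context: Let $\mu_{n,\alpha}=2^{\alpha}\pi^{-n/2}\,\Gamma\left(\frac{n+\alpha+1}{2}\right)/\Gamma\left(\frac{1-\alpha}{2}\right)$. For $\varphi\in \mathrm{Lip}_c(\mathbb{R}^n;\mathbb{R}^n)$ (compactly supported Lipschitz), the fractional $\alpha$-divergence is $$\mathrm{div}^\alpha\varphi(x)=\mu_{n,\alpha}\int_{\mathbb{R}^n}\frac{(y-x)\cdot(\varphi(y)-\varphi(x))}{|y-x|^{n+\alpha+1}}\,dy,\quad x\in\mathbb{R}^n.$$ For $p\in[1,+\infty]$ and $f\in L^p(\mathbb{R}^n)$ let $$|D^\alpha f|(\mathbb{R}^n)=\sup\left\{\int_{\mathbb{R}^n} f\,\mathrm{div}^\alpha\varphi\,dx:\varphi\in C^\infty_c(\mathbb{R}^n;\mathbb{R}^n),\ \|\varphi\|_{L^\infty(\mathbb{R}^n;\mathbb{R}^n)}\le1\right\},$$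 and $BV^{\alpha,p}(\mathbb{R}^n)=\{f\in L^p(\mathbb{R}^n):|D^\alpha f|(\mathbb{R}^n)<+\infty\}$. *)

theory Defs
  imports "HOL-Analysis.Analysis" "HOL-Probability.Essential_Supremum"
begin

(* On a finite-dimensional domain this is the usual class of k times continuously
   differentiable maps: f has a total derivative everywhere, and every directional
   derivative (in particular every partial derivative) is again of class C^(k-1). *)
fun class_C :: "nat \<Rightarrow> ('a::euclidean_space \<Rightarrow> 'b::real_normed_vector) \<Rightarrow> bool" where
  "class_C 0 f \<longleftrightarrow> continuous_on UNIV f"
| "class_C (Suc k) f \<longleftrightarrow>
     (\<forall>x. f differentiable (at x)) \<and> (\<forall>v. class_C k (\<lambda>x. frechet_derivative f (at x) v))"

definition Cc_infinity :: "('a::euclidean_space \<Rightarrow> 'b::real_normed_vector) set" where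
  "Cc_infinity = {\<phi>. (\<forall>k. class_C k \<phi>) \<and> compact (closure (support_on UNIV \<phi>))}"

definition Linfinity_norm :: "('a::euclidean_space \<Rightarrow> 'b::real_normed_vector) \<Rightarrow> ereal" where
  "Linfinity_norm \<phi> = esssup lebesgue (\<lambda>x. ereal (norm (\<phi> x)))"

definition mu :: "nat \<Rightarrow> real \<Rightarrow> real" where
  "mu n \<alpha> = 2 powr \<alpha> * pi powr (- real n / 2)
              * Gamma ((real n + \<alpha> + 1) / 2) / Gamma ((1 - \<alpha>) / 2)"

(* The integrand takes the value 0 / 0 = 0 on the null set y = x. *)
definition frac_div :: "real \<Rightarrow> (real^'n \<Rightarrow> real^'n) \<Rightarrow> real^'n \<Rightarrow> real" where
  "frac_div \<alpha> \<phi> x =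
     mu CARD('n) \<alpha> *
       (\<integral>y. ((y - x) \<bullet> (\<phi> y - \<phi> x)) / norm (y - x) powr (real CARD('n) + \<alpha> + 1) \<partial>lebesgue)"

definition frac_variation :: "real \<Rightarrow> (real^'n \<Rightarrow> real) \<Rightarrow> ereal" where
  "frac_variation \<alpha> f =
     (SUP \<phi> \<in> {\<phi> \<in> Cc_infinity. Linfinity_norm \<phi> \<le> 1}.
        ereal (\<integral>x. f x * frac_div \<alpha> \<phi> x \<partial>lebesgue))"

(* Finite exponents only; members are functions rather than classes modulo null sets. *)
definition Lp :: "real \<Rightarrow> (real^'n \<Rightarrow> real) set" where
  "Lp p = {f \<in> borel_measurable lebesgue. integrable lebesgue (\<lambda>x. \<bar>f x\<bar> powr p)}"

definition BV_frac :: "real \<Rightarrow> real \<Rightarrow> (real^'n \<Rightarrow> real) set" where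
  "BV_frac \<alpha> p = {f \<in> Lp p. frac_variation \<alpha> f < \<infinity>}"

(* c is an admissible constant in the fractional Hardy inequality on real^'n. The left-hand
   side is an extended nonnegative integral, so the inequality includes its finiteness
   when c > 0. For CARD('n) = 1 only (almost everywhere) nonnegative f are considered. *)
definition frac_Hardy_const :: "'n::finite itself \<Rightarrow> real \<Rightarrow> real \<Rightarrow> bool" where
  "frac_Hardy_const (_ :: 'n itself) \<alpha> c \<longleftrightarrow>
     (\<forall>p. 1 \<le> p \<and> p < real CARD('n) / (1 - \<alpha>) \<longrightarrow>
       (\<forall>f \<in> BV_frac \<alpha> p :: (real^'n \<Rightarrow> real) set.
         (CARD('n) = 1 \<longrightarrow> (AE x in lebesgue. 0 \<le> f x)) \<longrightarrow>
         (\<forall>x0. ereal c * enn2ereal (\<integral>\<^sup>+x. ennreal (\<bar>f x\<bar> / norm (x - x0) powr \<alpha>) \<partial>lebesgue)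
                \<le> frac_variation \<alpha> f)))"

end

theory Submission
  imports Defs
begin

text \<open>For \<open>n = 1\<close> the test field is a smooth approximation of \<open>sgn (x - x\<^sub>0)\<close>, whose fractional divergence
  is \<open>2\<mu>/\<alpha> \<bar>x - x\<^sub>0\<bar>\<^sup>-\<^sup>\<alpha>\<close>; the indicator of an interval, whose fractional derivative has the
  opposite sign of \<open>x - x\<^sub>0\<close> everywhere, gives equality.

  For \<open>n \<ge> 2\<close> let \<open>K\<close> be a smooth version of the field \<open>z/\<bar>z\<bar>\<^sup>n\<^sup>+\<^sup>1\<^sup>-\<^sup>\<alpha>\<close> and \<open>M = div\<^sup>\<alpha> K\<close>. Then \<open>M\<close> is integrable
  with positive integral, so its dilates are an approximate identity up to a factor, and for
  \<open>\<bar>g\<bar> \<le> \<bar>x\<bar>\<^sup>-\<^sup>\<alpha>\<close> the field \<open>K * g\<close> has fractional divergence close to a multiple of \<open>g\<close>. It is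
  unbounded only by a logarithm: each dyadic scale \<open>t\<close> of \<open>K\<close> contributes a bounded field, which is
  summable over \<open>t \<le> \<bar>y\<bar>\<close>. For \<open>t \<ge> \<bar>y\<bar>\<close> one subtracts a divergence-free field with the same
  value at the origin, supported in a ball of radius \<open>2t\<close>, which gains a factor \<open>\<bar>y\<bar>/t\<close> and does not change
  the fractional divergence. Such fields exist because \<open>n \<ge> 2\<close>, and no sign of \<open>f\<close> is needed.\<close>

subsection \<open>Smooth functions of compact support\<close>

text \<open>The Fourier symbol of the fractional divergence is a multiple of i xi |xi|^(\<alpha>-1),
  so a field inverting it has degree \<alpha> - n; this is the origin of z/|z|^(n+1-\<alpha>). The
  proof is by duality: the weighted integral of |f| is recovered from integrals of f g with g
  continuous, of compact support and below the weight. Hence everything rests on a single bound for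
  test fields, uniform in g and in both truncation scales. As f only ever meets admissible fields,
  it is neither differentiated nor approximated by smooth functions, and one constant serves all p.

  Smoothing the modulus, rather than cutting off the kernel, has two advantages: a difference of
  dilates of equal homogeneity has compact support by itself, and its fractional divergence
  telescopes over dyadic scales.

  For n = 1 no compactly supported divergence-free field is at hand to remove the logarithm. A
  single monotone field of sup norm one replaces the whole family; it sees f and not |f|, hence the
  sign condition, but it loses nothing in the constant.\<close>

declare class_C.simps(2) [simp del]

text \<open>Derivatives are unique, so any witness \<open>D\<close> may stand for
  \<open>frechet_derivative\<close>. With the matching elimination rule, all closure properties
  become inductions on \<open>k\<close>.\<close>

lemma class_C_SucI:
  assumes "\<And>x. (f has_derivative D x) (at x)" "\<And>v. class_C k (\<lambda>x. D x v)"
  shows "class_C (Suc k) f"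
proof -
  have "frechet_derivative f (at x) = D x" for x
    using assms(1) frechet_derivative_at by metis
  then show ?thesis using assms by (auto simp: differentiable_def class_C.simps(2))
qed

lemma class_C_SucE:
  assumes "class_C (Suc k) f"
  obtains D where "\<And>x. (f has_derivative D x) (at x)" "\<And>v. class_C k (\<lambda>x. D x v)"
  using assms frechet_derivative_works[of f] that[of "\<lambda>x. frechet_derivative f (at x)"]
  by (auto simp: class_C.simps(2))

lemma class_C_lower: "class_C (Suc k) f \<Longrightarrow> class_C k f"
proof (induction k arbitrary: f)
  case 0
  then show ?case
    by (auto simp: class_C.simps(2) continuous_on_eq_continuous_at differentiable_imp_continuous_within)
next
  case (Suc k)
  then show ?case by (metis class_C.simps(2))
qed

lemma class_C_continuous: "class_C k f \<Longrightarrow> continuous_on UNIV f"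
  by (induction k) (auto intro: class_C_lower)

lemma class_C_const: "class_C k (\<lambda>x. c)"
  by (induction k arbitrary: c) (auto intro!: class_C_SucI[where D="\<lambda>_ _. 0"])

lemma class_C_bounded_linear: "bounded_linear T \<Longrightarrow> class_C k T"
  by (cases k) (auto intro!: class_C_SucI bounded_linear_imp_has_derivative class_C_const
      linear_continuous_on)

lemma class_C_add: "class_C k f \<Longrightarrow> class_C k g \<Longrightarrow> class_C k (\<lambda>x. f x + g x)"
proof (induction k arbitrary: f g)
  case (Suc k)
  then show ?case
    by (elim class_C_SucE) (rule class_C_SucI, rule has_derivative_add, blast+)
qed (auto intro: continuous_intros)

lemma class_C_compose_linear:
  "bounded_linear T \<Longrightarrow> class_C k f \<Longrightarrow> class_C k (\<lambda>x. T (f x))"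
proof (induction k arbitrary: f)
  case 0
  then show ?case by (auto intro: bounded_linear.continuous_on)
next
  case (Suc k)
  then show ?case
    by (elim class_C_SucE) (rule class_C_SucI, rule bounded_linear.has_derivative, auto)
qed

lemma class_C_bilinear:
  assumes "bounded_bilinear p"
  shows "class_C k f \<Longrightarrow> class_C k g \<Longrightarrow> class_C k (\<lambda>x. p (f x) (g x))"
proof (induction k arbitrary: f g)
  case 0
  then show ?case using bounded_bilinear.continuous_on[OF assms] by auto
next
  case (Suc k)
  note fg = Suc.prems[THEN class_C_lower]
  from Suc.prems obtain D E where D: "\<And>x. (f has_derivative D x) (at x)" "\<And>v. class_C k (\<lambda>x. D x v)"
    and E: "\<And>x. (g has_derivative E x) (at x)" "\<And>v. class_C k (\<lambda>x. E x v)"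
    by (metis class_C_SucE)
  show ?case
  proof (rule class_C_SucI)
    show "((\<lambda>x. p (f x) (g x)) has_derivative (\<lambda>v. p (f x) (E x v) + p (D x v) (g x))) (at x)" for x
      by (rule bounded_bilinear.FDERIV[OF assms D(1) E(1)])
    show "class_C k (\<lambda>x. p (f x) (E x v) + p (D x v) (g x))" for v
      by (intro class_C_add Suc.IH fg D E)
  qed
qed

lemmas class_C_scaleR = class_C_bilinear[OF bounded_bilinear_scaleR]
lemmas class_C_mult = class_C_bilinear[OF bounded_bilinear_mult]
lemmas class_C_inner = class_C_bilinear[OF bounded_bilinear_inner]
lemmas class_C_ident = class_C_bounded_linear[OF bounded_linear_ident]

lemma class_C_diff: "class_C k f \<Longrightarrow> class_C k g \<Longrightarrow> class_C k (\<lambda>x. f x - g x)"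
  using class_C_add[of k f "\<lambda>x. - g x"] class_C_compose_linear[of uminus k g]
  by (simp add: bounded_linear_minus[OF bounded_linear_ident])

lemma class_C_affine: "class_C k f \<Longrightarrow> class_C k (\<lambda>x. f (c *\<^sub>R x + a))"
proof (induction k arbitrary: f)
  case 0
  then show ?case by (auto intro!: continuous_intros intro: continuous_on_compose2)
next
  case (Suc k)
  then obtain D where D: "\<And>x. (f has_derivative D x) (at x)" "\<And>v. class_C k (\<lambda>x. D x v)"
    by (metis class_C_SucE)
  show ?case
  proof (rule class_C_SucI)
    have "((\<lambda>x. c *\<^sub>R x + a) has_derivative (\<lambda>v. c *\<^sub>R v)) (at x)" for x :: 'a
      by (auto intro!: derivative_eq_intros)
    from has_derivative_compose[OF this D(1)]
    show "((\<lambda>x. f (c *\<^sub>R x + a)) has_derivative (\<lambda>v. D (c *\<^sub>R x + a) (c *\<^sub>R v))) (at x)" for x .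
    show "class_C k (\<lambda>x. D (c *\<^sub>R x + a) (c *\<^sub>R v))" for v
      using Suc.IH[OF D(2)] .
  qed
qed

text \<open>Differentiation lowers the exponent by one, so the induction keeps \<open>r\<close>
  arbitrary.\<close>

lemma class_C_powr:
  fixes P :: "'a::euclidean_space \<Rightarrow> real"
  assumes "\<And>x. 0 < P x" "\<And>k. class_C k P"
  shows "class_C k (\<lambda>x. P x powr r)"
proof (induction k arbitrary: r)
  case 0
  have "continuous_on UNIV P" using assms(2)[of 0] by simp
  moreover have "P x \<noteq> 0" for x using assms(1)[of x] by simp
  ultimately show ?case by (auto intro!: continuous_intros)
next
  case (Suc k)
  obtain D where D: "\<And>x. (P has_derivative D x) (at x)" "\<And>v. class_C k (\<lambda>x. D x v)"
    using assms(2) by (metis class_C_SucE)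
  show ?case
  proof (rule class_C_SucI)
    show "((\<lambda>x. P x powr r) has_derivative (\<lambda>v. D x v * (r * P x powr (r - 1)))) (at x)" for x
      using DERIV_compose_FDERIV[OF has_real_derivative_powr D(1)] assms(1) by blast
    show "class_C k (\<lambda>x. D x v * (r * P x powr (r - 1)))" for v
      by (intro class_C_mult class_C_const D Suc.IH)
  qed
qed

text \<open>\<open>flat 0\<close> is the classical smooth function exp(-1/u) extended by zero. The
  powers of 1/u make the family, up to linear combinations, closed under differentiation.\<close>

definition flat :: "nat \<Rightarrow> real \<Rightarrow> real" where
  "flat j u = (if 0 < u then inverse u ^ j * exp (- inverse u) else 0)"

text \<open>With y = 1/u, one term of the exponential series gives y^(j+2) \<le> (j+2)! exp y. The
  square on the right yields differentiability at 0, and the explicit factorial later gives a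
  numerical bound for \<open>flat 2\<close>.\<close>

lemma flat_le: "\<bar>flat j u\<bar> \<le> fact (j + 2) * u\<^sup>2"
proof (cases "u > 0")
  case True
  define y where "y = inverse u"
  define c :: real where "c = fact (j + 2)"
  have c: "c > 0" by (simp add: c_def)
  have y: "y > 0" using True by (simp add: y_def)
  have "y ^ (j + 2) / c \<le> exp y"
  proof -
    have "(\<Sum>n\<in>{j+2}. inverse (fact n) * y ^ n) \<le> (\<Sum>n. inverse (fact n) * y ^ n)"
      using y summable_exp[of y] by (intro sum_le_suminf) auto
    then show ?thesis by (simp add: exp_def divide_inverse mult.commute c_def)
  qed
  then have "y ^ j * y\<^sup>2 \<le> c * exp y"
    using c by (simp add: pos_divide_le_eq power_add power2_eq_square ac_simps)
  then have "y ^ j * exp (- y) \<le> c / y\<^sup>2"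
    using y by (simp add: field_simps exp_minus)
  also have "c / y\<^sup>2 = c * u\<^sup>2" by (simp add: y_def divide_inverse power_inverse)
  finally show ?thesis using True y unfolding c_def by (simp add: flat_def y_def abs_mult)
qed (simp add: flat_def)

text \<open>Only u = 0 needs an argument: there the quadratic bound makes the difference quotient
  O(|u|).\<close>

lemma flat_has_derivative:
  "(flat j has_real_derivative flat (j + 2) u - j * flat (j + 1) u) (at u)"
proof -
  consider "u > 0" | "u < 0" | "u = 0" by linarith
  then show ?thesis
  proof cases
    case 1
    have "((\<lambda>u. inverse u ^ j * exp (- inverse u)) has_real_derivative flat (j + 2) u - j * flat (j + 1) u) (at u)"
      using 1 by (auto intro!: derivative_eq_intros simp: flat_def field_simps power2_eq_square)
        (cases j; simp add: field_simps power2_eq_square)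
    then show ?thesis
      by (rule has_field_derivative_transform_within_open[where S="{0<..}"]) (use 1 in \<open>auto simp: flat_def\<close>)
  next
    case 2
    have "((\<lambda>u. 0) has_real_derivative flat (j + 2) u - j * flat (j + 1) u) (at u)"
      using 2 by (simp add: flat_def)
    then show ?thesis
      by (rule has_field_derivative_transform_within_open[where S="{..<0}"]) (use 2 in \<open>auto simp: flat_def\<close>)
  next
    case 3
    have "((\<lambda>x. flat j x / x) \<longlongrightarrow> 0) (at 0)"
    proof (rule Lim_null_comparison)
      show "\<forall>\<^sub>F x in at 0. norm (flat j x / x) \<le> fact (j + 2) * \<bar>x\<bar>"
        unfolding eventually_at
      proof (intro exI[of _ 1] conjI ballI impI)
        fix x :: real assume "x \<noteq> 0 \<and> dist x 0 < 1"
        then have x: "\<bar>x\<bar> > 0" by simp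
        have "\<bar>flat j x\<bar> \<le> (fact (j + 2) * \<bar>x\<bar>) * \<bar>x\<bar>"
          using flat_le[of j x] by (simp only: power2_eq_square mult.assoc abs_mult_self_eq)
        then show "norm (flat j x / x) \<le> fact (j + 2) * \<bar>x\<bar>"
          using x by (simp only: real_norm_def abs_divide pos_divide_le_eq)
      qed simp
      show "((\<lambda>x::real. fact (j + 2) * \<bar>x\<bar>) \<longlongrightarrow> 0) (at 0)"
        by (auto intro!: tendsto_eq_intros)
    qed
    then show ?thesis using 3 by (simp add: has_field_derivative_iff flat_def)
  qed
qed

lemma class_C_flat:
  fixes P :: "'a::euclidean_space \<Rightarrow> real"
  assumes "\<And>k. class_C k P"
  shows "class_C k (\<lambda>x. flat j (P x))"
proof (induction k arbitrary: j)
  case 0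
  have "continuous_on UNIV (flat j)"
    using flat_has_derivative by (meson DERIV_isCont continuous_at_imp_continuous_on)
  then show ?case using assms[of 0] by (auto intro: continuous_on_compose2)
next
  case (Suc k)
  obtain D where D: "\<And>x. (P has_derivative D x) (at x)" "\<And>v. class_C k (\<lambda>x. D x v)"
    using assms by (metis class_C_SucE)
  show ?case
  proof (rule class_C_SucI)
    show "((\<lambda>x. flat j (P x)) has_derivative
        (\<lambda>v. D x v * (flat (j + 2) (P x) - j * flat (j + 1) (P x)))) (at x)" for x
      by (rule DERIV_compose_FDERIV[OF flat_has_derivative D(1)])
    show "class_C k (\<lambda>x. D x v * (flat (j + 2) (P x) - j * flat (j + 1) (P x)))" for v
      by (intro class_C_mult class_C_diff class_C_const D Suc.IH)
  qed
qed

lemma flat0_mono: "u \<le> v \<Longrightarrow> flat 0 u \<le> flat 0 v"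
  by (auto simp: flat_def le_imp_inverse_le)

lemma flat_nonneg: "0 \<le> flat j u" and flat_pos: "0 < u \<Longrightarrow> 0 < flat j u"
  and flat_eq_0: "u \<le> 0 \<Longrightarrow> flat j u = 0" and flat0_le_1: "flat 0 u \<le> 1"
  by (auto simp: flat_def)

section \<open>Test functions: closure properties, Lipschitz and second-order bounds\<close>

lemma Cc_infinity_iff:
  "\<phi> \<in> Cc_infinity \<longleftrightarrow> (\<forall>k. class_C k \<phi>) \<and> (\<exists>r>0. \<forall>x. r < norm x \<longrightarrow> \<phi> x = 0)"
proof -
  have "compact (closure (support_on UNIV \<phi>)) \<longleftrightarrow> (\<exists>r>0. \<forall>x. r < norm x \<longrightarrow> \<phi> x = 0)"
    by (simp add: compact_closure bounded_pos support_on_def) (meson linorder_not_less)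
  then show ?thesis by (simp add: Cc_infinity_def)
qed

lemma Cc_infinityI:
  assumes "\<And>k. class_C k \<phi>" "\<And>x. r < norm x \<Longrightarrow> \<phi> x = 0"
  shows "\<phi> \<in> Cc_infinity"
  unfolding Cc_infinity_iff
proof (intro conjI allI exI[of _ "max r 1"] impI)
  show "class_C k \<phi>" for k by fact
  show "\<phi> x = 0" if "max r 1 < norm x" for x using that assms(2) by simp
qed simp

lemma Cc_infinity_class_C: "\<phi> \<in> Cc_infinity \<Longrightarrow> class_C k \<phi>"
  by (simp add: Cc_infinity_iff)

lemma Cc_infinity_add: "\<phi> \<in> Cc_infinity \<Longrightarrow> \<psi> \<in> Cc_infinity \<Longrightarrow> (\<lambda>x. \<phi> x + \<psi> x) \<in> Cc_infinity"
  unfolding Cc_infinity_iff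
  by (auto intro: class_C_add) (metis add.left_neutral less_max_iff_disj max_less_iff_conj)

lemma Cc_infinity_linear:
  assumes "bounded_linear T" "\<phi> \<in> Cc_infinity"
  shows "(\<lambda>x. T (\<phi> x)) \<in> Cc_infinity"
  using assms class_C_compose_linear[OF assms(1)] linear_0[OF bounded_linear.linear[OF assms(1)]]
  unfolding Cc_infinity_iff by metis

lemma Cc_infinity_sum:
  "(\<And>i. i \<in> I \<Longrightarrow> \<phi> i \<in> Cc_infinity) \<Longrightarrow> (\<lambda>x. \<Sum>i\<in>I. \<phi> i x) \<in> Cc_infinity"
proof (induction I rule: infinite_finite_induct)
  case (insert i I)
  then show ?case using Cc_infinity_add[of "\<phi> i"] by simp
qed (auto intro!: Cc_infinityI[where r=0] class_C_const)

lemma Cc_infinity_diff: "\<phi> \<in> Cc_infinity \<Longrightarrow> \<psi> \<in> Cc_infinity \<Longrightarrow> (\<lambda>x. \<phi> x - \<psi> x) \<in> Cc_infinity"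
  using Cc_infinity_add[of \<phi> "\<lambda>x. - \<psi> x"] Cc_infinity_linear[of uminus \<psi>]
  by (simp add: bounded_linear_minus[OF bounded_linear_ident])

lemma Cc_infinity_affine:
  fixes a :: "'a::euclidean_space"
  assumes "\<phi> \<in> Cc_infinity" "c \<noteq> 0"
  shows "(\<lambda>x. \<phi> (c *\<^sub>R x + a)) \<in> Cc_infinity"
proof -
  obtain r where r: "\<And>x. r < norm x \<Longrightarrow> \<phi> x = 0" using assms(1) by (auto simp: Cc_infinity_iff)
  show ?thesis
  proof (rule Cc_infinityI)
    show "class_C k (\<lambda>x. \<phi> (c *\<^sub>R x + a))" for k
      by (intro class_C_affine Cc_infinity_class_C assms)
    fix x :: 'a assume "(r + norm a) / \<bar>c\<bar> < norm x"
    then have "r + norm a < norm (c *\<^sub>R x)" using assms(2) by (simp add: field_simps)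
    also have "\<dots> \<le> norm (c *\<^sub>R x + a) + norm a" using norm_triangle_ineq4[of "c *\<^sub>R x + a" a] by simp
    finally show "\<phi> (c *\<^sub>R x + a) = 0" by (intro r) simp
  qed
qed

text \<open>Outside a closed ball containing the support the function vanishes on an open set, so
  the derivative vanishes there too. The last clause keeps the same radius, which fixes the support
  of the divergence-free fields below.\<close>

lemma Cc_infinity_derivative:
  assumes "\<phi> \<in> Cc_infinity"
  obtains D where "\<And>x. (\<phi> has_derivative D x) (at x)" "\<And>v. (\<lambda>x. D x v) \<in> Cc_infinity"
    "\<And>x r. (\<And>y. r < norm y \<Longrightarrow> \<phi> y = 0) \<Longrightarrow> r < norm x \<Longrightarrow> D x = (\<lambda>v. 0)"
proof -
  define D where "D = (\<lambda>x. frechet_derivative \<phi> (at x))"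
  have C: "class_C k \<phi>" for k using assms by (rule Cc_infinity_class_C)
  have D: "(\<phi> has_derivative D x) (at x)" for x
    using C[of "Suc 0"] by (simp add: D_def frechet_derivative_works class_C.simps(2))
  have 3: "D x = (\<lambda>v. 0)" if r: "\<And>y. r < norm y \<Longrightarrow> \<phi> y = 0" and x: "r < norm x" for x r
  proof -
    have "open {y. r < norm y}" by (intro open_Collect_less continuous_intros)
    then have "(\<phi> has_derivative (\<lambda>v. 0)) (at x)"
      using x r by (intro has_derivative_transform_within_open[OF has_derivative_const]) auto
    then show ?thesis by (rule has_derivative_unique[OF D])
  qed
  show ?thesis
  proof (rule that[OF D _ 3])
    obtain r where r: "\<And>x. r < norm x \<Longrightarrow> \<phi> x = 0" using assms by (auto simp: Cc_infinity_iff)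
    show "(\<lambda>x. D x v) \<in> Cc_infinity" for v
    proof (rule Cc_infinityI[where r=r])
      show "class_C k (\<lambda>x. D x v)" for k using C[of "Suc k"] by (simp add: D_def class_C.simps(2))
      show "D x v = 0" if "r < norm x" for x using 3[OF r that] by simp
    qed
  qed auto
qed

lemma compact_support_bounded:
  fixes f :: "'a::euclidean_space \<Rightarrow> 'b::real_normed_vector"
  assumes "continuous_on UNIV f" "\<And>x. r < norm x \<Longrightarrow> f x = 0"
  obtains B where "0 < B" "\<And>x. norm (f x) \<le> B"
proof -
  have "bounded (f ` cball 0 r)"
    by (intro compact_imp_bounded compact_continuous_image continuous_on_subset[OF assms(1)]) auto
  then obtain B where B: "B > 0" "\<And>x. norm x \<le> r \<Longrightarrow> norm (f x) \<le> B"
    by (auto simp: bounded_pos)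
  show ?thesis
  proof (rule that[OF B(1)])
    show "norm (f x) \<le> B" for x using B assms(2)[of x] by (cases "norm x \<le> r") auto
  qed
qed

lemma Cc_infinity_bounded:
  assumes "\<phi> \<in> Cc_infinity"
  obtains B where "0 < B" "\<And>x. norm (\<phi> x) \<le> B"
proof -
  obtain r where "\<And>x. r < norm x \<Longrightarrow> \<phi> x = 0" using assms by (auto simp: Cc_infinity_iff)
  moreover have "continuous_on UNIV \<phi>"
    using assms by (meson Cc_infinity_class_C class_C_continuous)
  ultimately show ?thesis by (metis compact_support_bounded that)
qed

text \<open>Each partial derivative is a test function, hence bounded; the sum of these bounds over
  the basis controls the operator norm.\<close>

lemma Cc_infinity_lipschitz:
  assumes "\<phi> \<in> Cc_infinity"
  obtains L where "0 < L" "\<And>x y. norm (\<phi> x - \<phi> y) \<le> L * norm (x - y)"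
proof -
  obtain D where D: "\<And>x. (\<phi> has_derivative D x) (at x)" "\<And>v. (\<lambda>x. D x v) \<in> Cc_infinity"
    using Cc_infinity_derivative[OF assms] by metis
  have "\<forall>v. \<exists>B. 0 < B \<and> (\<forall>x. norm (D x v) \<le> B)"
    using Cc_infinity_bounded[OF D(2)] by metis
  then obtain B where B: "\<And>v. 0 < B v" "\<And>x v. norm (D x v) \<le> B v" by metis
  define L where "L = (\<Sum>b\<in>Basis. B b)"
  have L: "0 < L" unfolding L_def by (intro sum_pos B) auto
  have on: "onorm (D x) \<le> L" for x
  proof (rule onorm_bound)
    show "norm (D x v) \<le> L * norm v" for v
    proof -
      interpret bounded_linear "D x" using D(1) has_derivative_bounded_linear by blast
      have "D x v = (\<Sum>b\<in>Basis. (v \<bullet> b) *\<^sub>R D x b)"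
        using arg_cong[OF euclidean_representation[of v], of "D x"] by (simp add: sum scaleR)
      also have "norm \<dots> \<le> (\<Sum>b\<in>Basis. B b * norm v)"
      proof (intro sum_norm_le)
        fix b :: 'a assume "b \<in> Basis"
        then show "norm ((v \<bullet> b) *\<^sub>R D x b) \<le> B b * norm v"
          using mult_mono[OF Basis_le_norm B(2), of b v x b] by (simp add: mult.commute)
      qed
      finally show ?thesis by (simp add: L_def sum_distrib_right)
    qed
  qed (use L in simp)
  show ?thesis
  proof (rule that[OF L])
    show "norm (\<phi> x - \<phi> y) \<le> L * norm (x - y)" for x y
      using differentiable_bound[of UNIV \<phi> D L x y] D on by auto
  qed
qed

text \<open>The Taylor bound is the mean value inequality for \<phi> minus its linearization, on the
  ball of radius |h|. It serves below in place of limit theorems when a derivative meets an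
  integral: the error is explicitly quadratic in h.\<close>

lemma Cc_infinity_derivative_lipschitz:
  assumes D: "\<And>x. (\<phi> has_derivative D x) (at x)" "\<And>v. (\<lambda>x. D x v) \<in> Cc_infinity"
  obtains L where "0 < L" "\<And>x y v. norm (D x v - D y v) \<le> L * norm (x - y) * norm v"
    "\<And>x h. norm (\<phi> (x + h) - \<phi> x - D x h) \<le> L * (norm h)\<^sup>2"
proof -
  have "\<forall>v. \<exists>L. 0 < L \<and> (\<forall>x y. norm (D x v - D y v) \<le> L * norm (x - y))"
    using Cc_infinity_lipschitz[OF D(2)] by metis
  then obtain B where B: "\<And>v. 0 < B v" "\<And>x y v. norm (D x v - D y v) \<le> B v * norm (x - y)" by metis
  define L where "L = (\<Sum>b\<in>Basis. B b)"
  have L: "0 < L" unfolding L_def by (intro sum_pos B) auto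
  have bl: "bounded_linear (D x)" for x using D(1) has_derivative_bounded_linear by blast
  have on: "norm (D x v - D y v) \<le> L * norm (x - y) * norm v" for x y v
  proof -
    interpret bounded_linear "\<lambda>v. D x v - D y v" by (intro bounded_linear_sub bl)
    have "D x v - D y v = (\<Sum>b\<in>Basis. (v \<bullet> b) *\<^sub>R (D x b - D y b))"
      using arg_cong[OF euclidean_representation[of v], of "\<lambda>v. D x v - D y v"]
      unfolding sum scaleR by simp
    also have "norm \<dots> \<le> (\<Sum>b\<in>Basis. B b * norm (x - y) * norm v)"
    proof (intro sum_norm_le)
      fix b :: 'a assume "b \<in> Basis"
      then show "norm ((v \<bullet> b) *\<^sub>R (D x b - D y b)) \<le> B b * norm (x - y) * norm v"
        using mult_mono[OF Basis_le_norm B(2), of b v x b y] by (simp add: mult.commute)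
    qed
    finally show ?thesis by (simp add: L_def sum_distrib_right)
  qed
  show ?thesis
  proof (rule that[OF L on])
    fix x h
    let ?F = "\<lambda>y. \<phi> y - D x y"
    have "norm (?F (x + h) - ?F x) \<le> (L * norm h) * norm ((x + h) - x)"
    proof (rule differentiable_bound[where S="cball x (norm h)" and f'="\<lambda>y v. D y v - D x v"])
      show "(?F has_derivative (\<lambda>v. D y v - D x v)) (at y within cball x (norm h))" for y
        by (intro derivative_intros has_derivative_at_withinI[OF D(1)] bounded_linear_imp_has_derivative bl)
      show "onorm (\<lambda>v. D y v - D x v) \<le> L * norm h" if "y \<in> cball x (norm h)" for y
      proof (rule onorm_bound)
        show "norm (D y v - D x v) \<le> L * norm h * norm v" for v
          using that L by (intro order_trans[OF on] mult_right_mono mult_left_mono)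
            (auto simp: dist_norm norm_minus_commute)
      qed (use L in simp)
    qed (auto simp: dist_norm)
    moreover have "?F (x + h) - ?F x = \<phi> (x + h) - \<phi> x - D x h"
      using linear_add[OF bounded_linear.linear[OF bl]] by simp
    ultimately show "norm (\<phi> (x + h) - \<phi> x - D x h) \<le> L * (norm h)\<^sup>2"
      by (simp add: power2_eq_square)
  qed
qed

subsection \<open>Powers of the norm and the fractional divergence of Lipschitz fields\<close>

lemma cball_sets_borel [measurable]: "cball c r \<in> sets borel"
  by (simp add: borel_closed)

lemma lborel_integral_affine:
  fixes f :: "'a::euclidean_space \<Rightarrow> 'b::{banach, second_countable_topology}"
  assumes [measurable]: "f \<in> borel_measurable borel" and "c \<noteq> 0"
  shows "(\<integral>x. f x \<partial>lborel) = \<bar>c\<bar> ^ DIM('a) *\<^sub>R (\<integral>x. f (t + c *\<^sub>R x) \<partial>lborel)"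
    and "integrable lborel (\<lambda>x. f (t + c *\<^sub>R x)) \<longleftrightarrow> integrable lborel f"
proof -
  show "(\<integral>x. f x \<partial>lborel) = \<bar>c\<bar> ^ DIM('a) *\<^sub>R (\<integral>x. f (t + c *\<^sub>R x) \<partial>lborel)"
    by (subst lborel_affine[OF assms(2), of t], subst integral_density, simp, simp, simp,
        subst integral_distr) auto
  show "integrable lborel (\<lambda>x. f (t + c *\<^sub>R x)) \<longleftrightarrow> integrable lborel f"
  proof -
    have iff: "integrable lborel (\<lambda>x. c' *\<^sub>R g x) \<longleftrightarrow> integrable lborel g"
      if "c' \<noteq> 0" for c' and g :: "'a \<Rightarrow> 'b"
      using integrable_scaleR_right[of c' lborel g] integrable_scaleR_right[of "inverse c'" lborel "\<lambda>x. c' *\<^sub>R g x"] that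
      by auto
    show ?thesis
      using assms(2) by (subst (2) lborel_affine[OF assms(2), of t], subst integrable_density)
        (auto simp: integrable_distr_eq iff)
  qed
qed

text \<open>|f| lies below a series of multiples of ball indicators, and Tonelli turns this into a
  geometric series of ratio a b^n. It plays the role of polar coordinates, with b = 1/2 at a
  singularity and b = 2 at infinity.\<close>

lemma integrable_dyadic:
  fixes f :: "'a::euclidean_space \<Rightarrow> real"
  assumes [measurable]: "f \<in> borel_measurable borel"
    and f: "\<And>z. f z \<noteq> 0 \<Longrightarrow> \<exists>k. \<bar>f z\<bar> \<le> C * a ^ k \<and> norm z \<le> d * b ^ k"
    and pos: "0 \<le> C" "0 < a" "0 < b" "0 \<le> d" and small: "a * b ^ DIM('a) < 1"
  shows "integrable lborel f"
proof (rule integrableI_bounded)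
  let ?n = "DIM('a)"
  define V where "V = unit_ball_vol (real DIM('a))"
  have V: "V \<ge> 0" by (simp add: V_def)
  have "(\<integral>\<^sup>+z. ennreal (norm (f z)) \<partial>lborel)
      \<le> (\<integral>\<^sup>+(z::'a). (\<Sum>k. ennreal (C * a ^ k) * indicator (cball 0 (d * b ^ k)) z) \<partial>lborel)"
  proof (rule nn_integral_mono)
    fix z :: 'a
    show "ennreal (norm (f z)) \<le> (\<Sum>k. ennreal (C * a ^ k) * indicator (cball 0 (d * b ^ k)) z)"
    proof (cases "f z = 0")
      case False
      then obtain k where k: "\<bar>f z\<bar> \<le> C * a ^ k" "norm z \<le> d * b ^ k" using f by blast
      have "ennreal (norm (f z)) \<le> (\<Sum>k\<in>{k}. ennreal (C * a ^ k) * indicator (cball 0 (d * b ^ k)) z)"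
        using k by (auto intro: ennreal_leI)
      also have "\<dots> \<le> (\<Sum>k. ennreal (C * a ^ k) * indicator (cball 0 (d * b ^ k)) z)"
        by (intro sum_le_suminf) auto
      finally show ?thesis .
    qed simp
  qed
  also have "\<dots> = (\<Sum>k. \<integral>\<^sup>+z. ennreal (C * a ^ k) * indicator (cball (0::'a) (d * b ^ k)) z \<partial>lborel)"
    by (rule nn_integral_suminf) measurable
  also have "\<dots> = (\<Sum>k. ennreal (C * V * d ^ ?n * (a * b ^ ?n) ^ k))"
  proof (intro suminf_cong)
    fix k
    have "(\<integral>\<^sup>+z. ennreal (C * a ^ k) * indicator (cball (0::'a) (d * b ^ k)) z \<partial>lborel)
        = ennreal (C * a ^ k) * emeasure lborel (cball (0::'a) (d * b ^ k))"
      by (simp add: nn_integral_cmult_indicator)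
    also have "\<dots> = ennreal (C * a ^ k) * ennreal (V * (d * b ^ k) ^ ?n)"
      using pos by (subst emeasure_cball) (auto simp: V_def)
    also have "\<dots> = ennreal (C * V * d ^ ?n * (a * b ^ ?n) ^ k)"
      using pos V by (subst ennreal_mult[symmetric])
        (auto simp: power_mult_distrib power_mult[symmetric] ac_simps)
    finally show "(\<integral>\<^sup>+z. ennreal (C * a ^ k) * indicator (cball (0::'a) (d * b ^ k)) z \<partial>lborel)
        = ennreal (C * V * d ^ ?n * (a * b ^ ?n) ^ k)" .
  qed
  also have "\<dots> < \<infinity>"
  proof (subst suminf_ennreal2)
    show "summable (\<lambda>k. C * V * d ^ ?n * (a * b ^ ?n) ^ k)"
      using pos small by (intro summable_mult summable_geometric) simp
    show "0 \<le> C * V * d ^ ?n * (a * b ^ ?n) ^ k" for k using pos V by simp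
  qed simp
  finally show "(\<integral>\<^sup>+z. ennreal (norm (f z)) \<partial>lborel) < \<infinity>" .
qed simp

lemma dyadic_bracket:
  fixes x :: real
  assumes "1 \<le> x"
  obtains k where "2 ^ k \<le> x" "x \<le> 2 * 2 ^ k"
proof -
  define m where "m = (LEAST m. x < 2 ^ m)"
  have m: "x < 2 ^ m" unfolding m_def by (rule LeastI_ex) (rule real_arch_pow, simp)
  with assms have "m \<noteq> 0" by (auto intro!: gr0I)
  then obtain k where k: "m = Suc k" by (auto simp: gr0_conv_Suc)
  have "\<not> x < 2 ^ k" using not_less_Least[of k "\<lambda>m. x < 2 ^ m"] k m_def by auto
  with m k show ?thesis by (intro that[of k]) auto
qed

lemma power_powr: "0 < b \<Longrightarrow> (b powr s) ^ k = (b ^ k) powr s" for b :: real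
  by (simp add: powr_realpow[symmetric] powr_powr mult.commute)

lemma integrable_norm_powr_inside:
  assumes "0 \<le> s" "s < real DIM('a)"
  shows "integrable lborel (\<lambda>z::'a::euclidean_space. indicator (cball 0 1) z * norm z powr (- s))"
\<comment> \<open>On the shell where 1/|z| is between 2^k and 2^(k+1) the power is at most 2^s
  (2^s)^k, so the ratio is 2^(s-n) < 1.\<close>
proof (rule integrable_dyadic[where C="2 powr s" and a="2 powr s" and b="1/2" and d=1])
  fix z :: 'a
  assume "indicator (cball 0 1) z * norm z powr (- s) \<noteq> 0"
  then have z: "0 < norm z" "norm z \<le> 1" by (auto simp: indicator_def split: if_splits)
  then obtain k where k: "2 ^ k \<le> 1 / norm z" "1 / norm z \<le> 2 * 2 ^ k"
    using dyadic_bracket[of "1 / norm z"] by auto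
  have "norm z powr (- s) = (1 / norm z) powr s"
    using z by (simp add: powr_minus powr_divide divide_inverse inverse_powr)
  also have "\<dots> \<le> (2 * 2 ^ k) powr s" using k z assms by (intro powr_mono2) auto
  also have "\<dots> = 2 powr s * (2 powr s) ^ k" by (simp add: powr_mult power_powr)
  finally show "\<exists>k. \<bar>indicator (cball 0 1) z * norm z powr (- s)\<bar> \<le> 2 powr s * (2 powr s) ^ k \<and>
      norm z \<le> 1 * (1 / 2) ^ k"
    using k z by (intro exI[of _ k]) (auto simp: power_divide field_simps)
next
  have "2 powr s * (1 / 2) ^ DIM('a) = 2 powr (s - real DIM('a))"
    by (simp add: powr_diff powr_realpow power_divide)
  also have "\<dots> < 1" using assms powr_less_mono[of "s - real DIM('a)" 0 2] by simp
  finally show "2 powr s * (1 / 2) ^ DIM('a) < 1" .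
qed auto

lemma integrable_norm_powr_outside:
  assumes "real DIM('a) < s"
  shows "integrable lborel (\<lambda>z::'a::euclidean_space. indicator (- cball 0 1) z * norm z powr (- s))"
    and "integrable lborel (\<lambda>z::'a. (1 + norm z) powr (- s))"
proof -
  have s: "0 \<le> s" using assms of_nat_0_le_iff order_trans less_imp_le by blast
  have le: "norm z powr (- s) \<le> 1 * (2 powr - s) ^ k" if "2 ^ k \<le> norm z" for k and z :: 'a
  proof -
    have "norm z powr (- s) \<le> (2 ^ k) powr (- s)" using that s by (intro powr_mono2') auto
    then show ?thesis by (simp add: power_powr)
  qed
  have "2 powr - s * 2 ^ DIM('a) = 2 powr (real DIM('a) - s)"
    by (simp add: powr_diff powr_realpow powr_minus divide_inverse)
  also have "\<dots> < 1" using assms powr_less_mono[of "real DIM('a) - s" 0 2] by simp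
  finally have small: "2 powr - s * 2 ^ DIM('a) < 1" .
  show "integrable lborel (\<lambda>z::'a. indicator (- cball 0 1) z * norm z powr (- s))"
  proof (rule integrable_dyadic[where C=1 and a="2 powr - s" and b=2 and d=2])
    fix z :: 'a
    assume "indicator (- cball 0 1) z * norm z powr (- s) \<noteq> 0"
    then have z: "1 \<le> norm z" by (auto simp: indicator_def split: if_splits)
    then obtain k where k: "2 ^ k \<le> norm z" "norm z \<le> 2 * 2 ^ k" using dyadic_bracket by blast
    show "\<exists>k. \<bar>indicator (- cball 0 1) z * norm z powr (- s)\<bar> \<le> 1 * (2 powr - s) ^ k \<and> norm z \<le> 2 * 2 ^ k"
      using k le[of k z] by (intro exI[of _ k]) (auto simp: indicator_def)
  qed (use small in auto)
  show "integrable lborel (\<lambda>z::'a. (1 + norm z) powr (- s))"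
  proof (rule integrable_dyadic[where C=1 and a="2 powr - s" and b=2 and d=2])
    fix z :: 'a
    show "\<exists>k. \<bar>(1 + norm z) powr (- s)\<bar> \<le> 1 * (2 powr - s) ^ k \<and> norm z \<le> 2 * 2 ^ k"
    proof (cases "1 \<le> norm z")
      case True
      then obtain k where k: "2 ^ k \<le> norm z" "norm z \<le> 2 * 2 ^ k" using dyadic_bracket by blast
      moreover have "(1 + norm z) powr (- s) \<le> norm z powr (- s)"
        using s True by (intro powr_mono2') auto
      ultimately show ?thesis using le[of k z] by (intro exI[of _ k]) auto
    next
      case False
      have "(1 + norm z) powr (- s) \<le> 1 powr (- s)" using s by (intro powr_mono2') auto
      then show ?thesis using False by (intro exI[of _ 0]) auto
    qed
  qed (use small in auto)
qed

text \<open>Since \<open>0 powr a = 0\<close>, the kernel vanishes at the origin, in agreement with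
  the convention 0 / 0 = 0 in \<open>frac_div\<close>.\<close>

definition fker :: "real \<Rightarrow> 'a::euclidean_space \<Rightarrow> real" where
  "fker \<alpha> z = norm z powr (- (real DIM('a) + \<alpha> + 1))"

text \<open>The common majorant of all divergence integrands: the first factor bounds the increment
  of a bounded Lipschitz field, the factor |z| comes from the inner product.\<close>

definition fmaj :: "real \<Rightarrow> 'a::euclidean_space \<Rightarrow> real" where
  "fmaj \<alpha> z = min 1 (norm z) * (norm z * fker \<alpha> z)"

text \<open>The fractional divergence without its constant \<open>mu\<close>, written in the
  increment z = y - x and over Borel Lebesgue measure, where Fubini and affine substitutions apply
  directly.\<close>

definition fdiv :: "real \<Rightarrow> ('a::euclidean_space \<Rightarrow> 'a) \<Rightarrow> 'a \<Rightarrow> real" where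
  "fdiv \<alpha> \<phi> x = (\<integral>z. fker \<alpha> z * (z \<bullet> (\<phi> (x + z) - \<phi> x)) \<partial>lborel)"

lemma fker_measurable [measurable]: "fker \<alpha> \<in> borel_measurable borel"
  and fmaj_measurable [measurable]: "fmaj \<alpha> \<in> borel_measurable borel"
  unfolding fker_def[abs_def] fmaj_def[abs_def] by measurable

lemma fker_nonneg [simp]: "0 \<le> fker \<alpha> z" and fmaj_nonneg [simp]: "0 \<le> fmaj \<alpha> z"
  by (auto simp: fker_def fmaj_def)

lemma fker_minus [simp]: "fker \<alpha> (- z) = fker \<alpha> z"
  by (simp add: fker_def)

lemma norm_mult_fker: "norm z * fker \<alpha> z = norm z powr (- (real DIM('a) + \<alpha>))" for z :: "'a::euclidean_space"
proof (cases "z = 0")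
  case False
  then show ?thesis using powr_mult_base[of "norm z" "- (real DIM('a) + \<alpha> + 1)"] by (simp add: fker_def)
qed (simp add: fker_def)

lemma norm_sq_mult_fker: "(norm z)\<^sup>2 * fker \<alpha> z = norm z powr (- (real DIM('a) + \<alpha> - 1))" for z :: "'a::euclidean_space"
proof (cases "z = 0")
  case False
  then show ?thesis using powr_mult_base[of "norm z" "- (real DIM('a) + \<alpha>)"] norm_mult_fker[of z \<alpha>]
    by (simp add: power2_eq_square mult.assoc algebra_simps)
qed (simp add: fker_def)

text \<open>Inside the unit ball the power is -(n + \<alpha> - 1), integrable because \<alpha> < 1;
  outside it is -(n + \<alpha>), integrable because \<alpha> > 0.\<close>

lemma fmaj_integrable:
  assumes "0 < \<alpha>" "\<alpha> < 1"
  shows "integrable lborel (fmaj \<alpha> :: 'a::euclidean_space \<Rightarrow> real)"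
proof -
  have "fmaj \<alpha> z = indicator (cball 0 1) z * norm z powr (- (real DIM('a) + \<alpha> - 1)) +
      indicator (- cball 0 1) z * norm z powr (- (real DIM('a) + \<alpha>))" for z :: 'a
    using norm_mult_fker[of z \<alpha>] norm_sq_mult_fker[of z \<alpha>]
    by (cases "norm z \<le> 1") (simp_all add: fmaj_def power2_eq_square mult.assoc)
  then have "fmaj \<alpha> = (\<lambda>z::'a. indicator (cball 0 1) z * norm z powr (- (real DIM('a) + \<alpha> - 1)) +
      indicator (- cball 0 1) z * norm z powr (- (real DIM('a) + \<alpha>)))" by blast
  moreover have "0 \<le> real DIM('a) + \<alpha> - 1"
    using assms DIM_ge_Suc0[where 'a='a] by linarith
  ultimately show ?thesis
    using assms integrable_norm_powr_inside[of "real DIM('a) + \<alpha> - 1", where 'a='a]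
      integrable_norm_powr_outside(1)[of "real DIM('a) + \<alpha>", where 'a='a]
    by simp
qed

text \<open>Bounded Lipschitz, with one constant for both. The class must be larger than
  \<open>Cc_infinity\<close>, because the smoothed homogeneous kernel has unbounded support.\<close>

definition blip :: "real \<Rightarrow> ('a::real_normed_vector \<Rightarrow> 'b::real_normed_vector) \<Rightarrow> bool" where
  "blip B \<phi> \<longleftrightarrow> 0 < B \<and> (\<forall>x. norm (\<phi> x) \<le> B) \<and> (\<forall>x y. norm (\<phi> x - \<phi> y) \<le> B * norm (x - y))"

lemma blip_pos: "blip B \<phi> \<Longrightarrow> 0 < B" and blip_norm: "blip B \<phi> \<Longrightarrow> norm (\<phi> x) \<le> B"
  and blip_diff: "blip B \<phi> \<Longrightarrow> norm (\<phi> x - \<phi> y) \<le> B * norm (x - y)"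
  by (auto simp: blip_def)

lemma blip_continuous: "blip B \<phi> \<Longrightarrow> continuous_on UNIV \<phi>"
  unfolding continuous_on_iff
proof (intro ballI allI impI)
  fix x and e :: real assume b: "blip B \<phi>" and e: "0 < e"
  show "\<exists>d>0. \<forall>x'\<in>UNIV. dist x' x < d \<longrightarrow> dist (\<phi> x') (\<phi> x) < e"
  proof (intro exI[of _ "e / B"] conjI ballI impI)
    show "0 < e / B" using blip_pos[OF b] e by simp
    fix x' assume "dist x' x < e / B"
    then have "B * norm (x' - x) < e" using blip_pos[OF b] by (simp add: dist_norm field_simps)
    then show "dist (\<phi> x') (\<phi> x) < e" using blip_diff[OF b, of x' x] by (simp add: dist_norm)
  qed
qed

lemma blip_measurable: "blip B \<phi> \<Longrightarrow> \<phi> \<in> borel_measurable borel"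
  by (intro borel_measurable_continuous_onI blip_continuous)

lemma Cc_infinity_blip:
  assumes "\<phi> \<in> Cc_infinity"
  obtains B where "blip B \<phi>"
proof -
  obtain B where B: "0 < B" "\<And>x. norm (\<phi> x) \<le> B" using Cc_infinity_bounded[OF assms] by metis
  obtain L where L: "0 < L" "\<And>x y. norm (\<phi> x - \<phi> y) \<le> L * norm (x - y)"
    using Cc_infinity_lipschitz[OF assms] by metis
  have "norm (\<phi> x) \<le> B + L" for x using B(2)[of x] L(1) by simp
  moreover have "norm (\<phi> x - \<phi> y) \<le> (B + L) * norm (x - y)" for x y
    using L(2)[of x y] mult_right_mono[of L "B + L" "norm (x - y)"] B(1) by simp
  ultimately show ?thesis using B L by (intro that[of "B + L"]) (simp add: blip_def)
qed

lemma fdiv_integrand_bound: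
  assumes "blip B \<phi>"
  shows "norm (fker \<alpha> z * (z \<bullet> (\<phi> (x + z) - \<phi> x))) \<le> 2 * B * fmaj \<alpha> z"
proof -
  have "norm (\<phi> (x + z) - \<phi> x) \<le> 2 * B * min 1 (norm z)"
    using blip_diff[OF assms, of "x + z" x] blip_norm[OF assms, of x] blip_norm[OF assms, of "x + z"]
      norm_triangle_ineq4[of "\<phi> (x + z)" "\<phi> x"] blip_pos[OF assms]
      mult_nonneg_nonneg[OF less_imp_le[OF blip_pos[OF assms]] norm_ge_zero[of z]]
    by (cases "1 \<le> norm z"; simp only: min_def if_True if_False add_diff_cancel_left'; linarith)
  then have "\<bar>z \<bullet> (\<phi> (x + z) - \<phi> x)\<bar> \<le> norm z * (2 * B * min 1 (norm z))"
    by (meson Cauchy_Schwarz_ineq2 mult_left_mono norm_ge_zero order_trans)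
  then have "fker \<alpha> z * \<bar>z \<bullet> (\<phi> (x + z) - \<phi> x)\<bar> \<le> fker \<alpha> z * (norm z * (2 * B * min 1 (norm z)))"
    by (rule mult_left_mono) simp
  then show ?thesis by (simp add: abs_mult fmaj_def ac_simps)
qed

context
  fixes \<alpha> :: real
  assumes \<alpha>: "0 < \<alpha>" "\<alpha> < 1"
begin

lemma fdiv_integrable:
  fixes \<phi> :: "'a::euclidean_space \<Rightarrow> 'a"
  assumes "blip B \<phi>"
  shows "integrable lborel (\<lambda>z. fker \<alpha> z * (z \<bullet> (\<phi> (x + z) - \<phi> x)))"
proof (rule Bochner_Integration.integrable_bound)
  have [measurable]: "\<phi> \<in> borel_measurable borel" using assms by (rule blip_measurable)
  show "(\<lambda>z. fker \<alpha> z * (z \<bullet> (\<phi> (x + z) - \<phi> x))) \<in> borel_measurable lborel" by measurable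
  show "integrable lborel (\<lambda>z::'a. 2 * B * fmaj \<alpha> z)"
    by (intro integrable_mult_right fmaj_integrable \<alpha>)
  show "AE z in lborel. norm (fker \<alpha> z * (z \<bullet> (\<phi> (x + z) - \<phi> x))) \<le> norm (2 * B * fmaj \<alpha> z)"
    by (rule AE_I2, rule order_trans[OF fdiv_integrand_bound[OF assms]]) simp
qed

lemma fdiv_bounded:
  fixes \<phi> :: "'a::euclidean_space \<Rightarrow> 'a"
  assumes "blip B \<phi>"
  shows "\<bar>fdiv \<alpha> \<phi> x\<bar> \<le> 2 * B * (\<integral>z. fmaj \<alpha> (z::'a) \<partial>lborel)"
proof -
  have "norm (fdiv \<alpha> \<phi> x) \<le> (\<integral>z. 2 * B * fmaj \<alpha> (z::'a) \<partial>lborel)"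
    unfolding fdiv_def
    by (rule Bochner_Integration.integral_norm_bound_integral[OF fdiv_integrable[OF assms]])
      (auto intro!: integrable_mult_right fmaj_integrable \<alpha> fdiv_integrand_bound assms
        simp del: real_norm_def)
  then show ?thesis by simp
qed

lemma fdiv_measurable:
  fixes \<phi> :: "'a::euclidean_space \<Rightarrow> 'a"
  assumes "blip B \<phi>"
  shows "fdiv \<alpha> \<phi> \<in> borel_measurable borel"
proof -
  have [measurable]: "\<phi> \<in> borel_measurable borel" using assms by (rule blip_measurable)
  have "(\<lambda>x. \<integral>z. fker \<alpha> z * (z \<bullet> (\<phi> (x + z) - \<phi> x)) \<partial>lborel) \<in> borel_measurable lborel"
    by (rule lborel.borel_measurable_lebesgue_integral) measurable
  then show ?thesis unfolding fdiv_def[abs_def] by simp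
qed

lemma fdiv_scaleR: "fdiv \<alpha> (\<lambda>x. c *\<^sub>R \<phi> x) x = c * fdiv \<alpha> \<phi> x"
  unfolding fdiv_def
  by (subst integral_mult_right_zero[symmetric], intro Bochner_Integration.integral_cong)
    (auto simp: algebra_simps)

lemma fdiv_diff:
  fixes \<phi> :: "'a::euclidean_space \<Rightarrow> 'a"
  assumes "blip B \<phi>" "blip C \<psi>"
  shows "fdiv \<alpha> (\<lambda>x. \<phi> x - \<psi> x) x = fdiv \<alpha> \<phi> x - fdiv \<alpha> \<psi> x"
  unfolding fdiv_def
  by (subst Bochner_Integration.integral_diff[symmetric, OF fdiv_integrable[OF assms(1)] fdiv_integrable[OF assms(2)]])
    (rule Bochner_Integration.integral_cong, auto simp: algebra_simps)

lemma fdiv_sum: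
  fixes \<phi> :: "'i \<Rightarrow> 'a::euclidean_space \<Rightarrow> 'a"
  assumes "\<And>i. i \<in> I \<Longrightarrow> blip (B i) (\<phi> i)"
  shows "fdiv \<alpha> (\<lambda>x. \<Sum>i\<in>I. \<phi> i x) x = (\<Sum>i\<in>I. fdiv \<alpha> (\<phi> i) x)"
  unfolding fdiv_def
  by (subst Bochner_Integration.integral_sum[symmetric])
    (auto intro!: fdiv_integrable assms Bochner_Integration.integral_cong
      simp: sum_distrib_left inner_sum_right sum_subtractf[symmetric])

lemma fdiv_translate: "fdiv \<alpha> (\<lambda>x. \<phi> (x - a)) x = fdiv \<alpha> \<phi> (x - a)"
  unfolding fdiv_def by (simp add: algebra_simps)

text \<open>The powers of t are n from the Jacobian, 1 from the factor z and -(n + \<alpha> + 1)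
  from the kernel, in total -\<alpha>.\<close>

lemma fdiv_dilate:
  fixes \<phi> :: "'a::euclidean_space \<Rightarrow> 'a"
  assumes "blip B \<phi>" "0 < t"
  shows "fdiv \<alpha> (\<lambda>x. \<phi> (x /\<^sub>R t)) x = t powr (- \<alpha>) * fdiv \<alpha> \<phi> (x /\<^sub>R t)"
proof -
  have [measurable]: "\<phi> \<in> borel_measurable borel" using assms(1) by (rule blip_measurable)
  have "fdiv \<alpha> (\<lambda>x. \<phi> (x /\<^sub>R t)) x =
      t ^ DIM('a) * (\<integral>z. fker \<alpha> (t *\<^sub>R z) * (t *\<^sub>R z \<bullet> (\<phi> (x /\<^sub>R t + z) - \<phi> (x /\<^sub>R t))) \<partial>lborel)"
    unfolding fdiv_def using assms(2)
    by (subst lborel_integral_affine(1)[of _ t 0]) (auto simp: algebra_simps)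
  also have "\<dots> = t ^ DIM('a) * (\<integral>z. t powr (- (real DIM('a) + \<alpha> + 1)) * t * (fker \<alpha> z *
      (z \<bullet> (\<phi> (x /\<^sub>R t + z) - \<phi> (x /\<^sub>R t)))) \<partial>lborel)"
  proof -
    have "fker \<alpha> (t *\<^sub>R z) = t powr (- (real DIM('a) + \<alpha> + 1)) * fker \<alpha> z" for z :: 'a
      using assms(2) by (simp add: fker_def powr_mult)
    then show ?thesis by (simp only: inner_scaleR_left ac_simps)
  qed
  also have "\<dots> = (t ^ DIM('a) * (t powr (- (real DIM('a) + \<alpha> + 1)) * t)) * fdiv \<alpha> \<phi> (x /\<^sub>R t)"
    by (simp add: fdiv_def)
  also have "t ^ DIM('a) * (t powr (- (real DIM('a) + \<alpha> + 1)) * t) = t powr (- \<alpha>)"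
  proof -
    have "t ^ DIM('a) * (t powr (- (real DIM('a) + \<alpha> + 1)) * t) =
        t powr real DIM('a) * (t powr (- (real DIM('a) + \<alpha> + 1)) * t powr 1)"
      using assms(2) by (simp add: powr_realpow)
    also have "\<dots> = t powr (- \<alpha>)" by (simp only: powr_add[symmetric]) (simp add: algebra_simps)
    finally show ?thesis .
  qed
  finally show ?thesis .
qed

end

subsection \<open>Convolution and exchange of integrals\<close>

definition conv :: "('a::euclidean_space \<Rightarrow> real) \<Rightarrow> ('a \<Rightarrow> 'b::euclidean_space) \<Rightarrow> 'a \<Rightarrow> 'b" where
  "conv g \<Theta> y = (\<integral>w. g w *\<^sub>R \<Theta> (y - w) \<partial>lborel)"

lemma conv_integrable:
  fixes \<Theta> :: "'a::euclidean_space \<Rightarrow> 'b::euclidean_space"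
  assumes g: "integrable lborel g" and [measurable]: "\<Theta> \<in> borel_measurable borel"
    and B: "\<And>x. norm (\<Theta> x) \<le> B"
  shows "integrable lborel (\<lambda>w. g w *\<^sub>R \<Theta> (y - w))"
proof (rule Bochner_Integration.integrable_bound)
  have [measurable]: "g \<in> borel_measurable borel" using g by (auto dest: borel_measurable_integrable)
  show "(\<lambda>w. g w *\<^sub>R \<Theta> (y - w)) \<in> borel_measurable lborel" by measurable
  show "integrable lborel (\<lambda>w. B * g w)" using g by simp
  have "0 \<le> B" using B[of 0] norm_ge_zero order_trans by blast
  then show "AE w in lborel. norm (g w *\<^sub>R \<Theta> (y - w)) \<le> norm (B * g w)"
    using mult_left_mono[OF B abs_ge_zero] by (auto simp: abs_mult mult.commute)
qed

lemma conv_blip: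
  fixes \<Theta> :: "'a::euclidean_space \<Rightarrow> 'b::euclidean_space"
  assumes g: "integrable lborel g" and \<Theta>: "blip B \<Theta>"
  shows "blip (B * (1 + (\<integral>w. \<bar>g w\<bar> \<partial>lborel))) (conv g \<Theta>)"
  unfolding blip_def
proof (intro conjI allI)
  let ?G = "\<integral>w. \<bar>g w\<bar> \<partial>lborel"
  have G: "0 \<le> ?G" by simp
  have B: "0 < B" using \<Theta> by (rule blip_pos)
  note meas = blip_measurable[OF \<Theta>]
  note int = conv_integrable[OF g meas blip_norm[OF \<Theta>]]
  show "0 < B * (1 + ?G)" by (intro mult_pos_pos add_pos_nonneg B G zero_less_one)
  have bnd: "norm (\<integral>w. g w *\<^sub>R f w \<partial>lborel) \<le> C * ?G"
    if "integrable lborel (\<lambda>w. g w *\<^sub>R f w)" "\<And>w. norm (f w) \<le> C" for f :: "'a \<Rightarrow> 'b" and C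
  proof -
    have "norm (\<integral>w. g w *\<^sub>R f w \<partial>lborel) \<le> (\<integral>w. C * \<bar>g w\<bar> \<partial>lborel)"
      using g that mult_left_mono[OF that(2) abs_ge_zero]
      by (intro Bochner_Integration.integral_norm_bound_integral) (auto simp: mult.commute)
    then show ?thesis by simp
  qed
  show "norm (conv g \<Theta> x) \<le> B * (1 + ?G)" for x
    using bnd[OF int blip_norm[OF \<Theta>], of x] B by (simp add: conv_def algebra_simps)
  show "norm (conv g \<Theta> x - conv g \<Theta> y) \<le> B * (1 + ?G) * norm (x - y)" for x y
  proof -
    have eq: "conv g \<Theta> x - conv g \<Theta> y = (\<integral>w. g w *\<^sub>R (\<Theta> (x - w) - \<Theta> (y - w)) \<partial>lborel)"
      unfolding conv_def by (subst Bochner_Integration.integral_diff[symmetric, OF int int])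
        (simp add: scaleR_diff_right)
    have "norm (\<integral>w. g w *\<^sub>R (\<Theta> (x - w) - \<Theta> (y - w)) \<partial>lborel) \<le> (B * norm (x - y)) * ?G"
    proof (rule bnd)
      show "integrable lborel (\<lambda>w. g w *\<^sub>R (\<Theta> (x - w) - \<Theta> (y - w)))"
        using Bochner_Integration.integrable_diff[OF int int, of x y] by (simp add: scaleR_diff_right)
      show "norm (\<Theta> (x - w) - \<Theta> (y - w)) \<le> B * norm (x - y)" for w
        using blip_diff[OF \<Theta>, of "x - w" "y - w"] by simp
    qed
    moreover have "0 \<le> B * norm (x - y)" using B by simp
    ultimately show ?thesis using eq by (simp only: distrib_left distrib_right mult_1_right ac_simps)
  qed
qed

lemma conv_zero:
  assumes "\<And>x. \<rho> < norm x \<Longrightarrow> g x = 0" "\<And>x. r < norm x \<Longrightarrow> \<Theta> x = 0" "\<rho> + r < norm y"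
  shows "conv g \<Theta> y = 0"
proof -
  have "g w *\<^sub>R \<Theta> (y - w) = 0" for w
    using assms(1)[of w] assms(2)[of "y - w"] assms(3) norm_triangle_ineq[of w "y - w"]
    by (cases "\<rho> < norm w") auto
  then have "(\<lambda>w. g w *\<^sub>R \<Theta> (y - w)) = (\<lambda>w. 0)" by blast
  then show ?thesis by (simp only: conv_def Bochner_Integration.integral_zero)
qed

text \<open>The derivative falls on the smooth factor. Integrating the Taylor bound against |g|
  leaves an error of L times the L^1 norm of g times |h|^2, which proves differentiability directly,
  and the induction proceeds with the directional derivatives.\<close>

lemma conv_class_C:
  fixes \<Theta> :: "'a::euclidean_space \<Rightarrow> 'b::euclidean_space"
  assumes g: "integrable lborel g"
  shows "\<Theta> \<in> Cc_infinity \<Longrightarrow> class_C k (conv g \<Theta>)"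
proof (induction k arbitrary: \<Theta>)
  case 0
  then obtain B where "blip B \<Theta>" using Cc_infinity_blip by blast
  then show ?case using blip_continuous[OF conv_blip[OF g]] by simp
next
  case (Suc k)
  obtain D where D: "\<And>x. (\<Theta> has_derivative D x) (at x)" "\<And>v. (\<lambda>x. D x v) \<in> Cc_infinity"
    using Cc_infinity_derivative[OF Suc.prems] by metis
  obtain L where L: "0 < L" "\<And>x h. norm (\<Theta> (x + h) - \<Theta> x - D x h) \<le> L * (norm h)\<^sup>2"
    using Cc_infinity_derivative_lipschitz[OF D] by metis
  have lin: "linear (D x)" for x
    using D(1) has_derivative_bounded_linear bounded_linear.linear by blast
  have int: "integrable lborel (\<lambda>w. g w *\<^sub>R \<Psi> (y - w))" if \<Psi>: "\<Psi> \<in> Cc_infinity" for \<Psi> :: "'a \<Rightarrow> 'b" and y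
  proof -
    obtain B where "blip B \<Psi>" using Cc_infinity_blip[OF \<Psi>] by blast
    then show ?thesis using conv_integrable[OF g, of \<Psi> B y] blip_measurable[of B \<Psi>] blip_norm[of B \<Psi>] by blast
  qed
  show ?case
  proof (rule class_C_SucI)
    show "class_C k (\<lambda>y. conv g (\<lambda>x. D x v) y)" for v
      using Suc.IH[OF D(2)] .
    fix y
    let ?G = "\<integral>w. \<bar>g w\<bar> \<partial>lborel"
    show "(conv g \<Theta> has_derivative (\<lambda>v. conv g (\<lambda>x. D x v) y)) (at y)"
    proof (rule has_derivativeI_sandwich[where e=1 and H="\<lambda>y'. L * ?G * norm (y' - y)"])
      have "linear (\<lambda>v. conv g (\<lambda>x. D x v) y)"
        by (rule linearI) (simp_all add: conv_def linear_add[OF lin] linear_scale[OF lin]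
            scaleR_add_right int[OF D(2)] scaleR_left_commute[of "g _"] del: scaleR_scaleR)
      then show "bounded_linear (\<lambda>v. conv g (\<lambda>x. D x v) y)"
        by (simp add: linear_conv_bounded_linear)
      fix y' assume "y' \<noteq> y"
      define h where "h = y' - y"
      have h: "norm h > 0" using \<open>y' \<noteq> y\<close> by (simp add: h_def)
      have i: "integrable lborel (\<lambda>w. g w *\<^sub>R (\<Theta> (y - w + h) - \<Theta> (y - w) - D (y - w) h))"
        using Bochner_Integration.integrable_diff[OF Bochner_Integration.integrable_diff[OF
          int[OF Suc.prems, of y'] int[OF Suc.prems, of y]] int[OF D(2), of y h]]
        by (simp add: h_def scaleR_diff_right)
      have "conv g \<Theta> y' - conv g \<Theta> y - conv g (\<lambda>x. D x h) y =
          (\<integral>w. g w *\<^sub>R (\<Theta> (y - w + h) - \<Theta> (y - w) - D (y - w) h) \<partial>lborel)"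
        unfolding conv_def
        by (simp add: h_def scaleR_diff_right int[OF Suc.prems] int[OF D(2)])
      also have "norm \<dots> \<le> (\<integral>w. L * (norm h)\<^sup>2 * \<bar>g w\<bar> \<partial>lborel)"
        using g mult_left_mono[OF L(2) abs_ge_zero]
        by (intro Bochner_Integration.integral_norm_bound_integral i) (auto simp: mult.commute)
      also have "\<dots> = L * ?G * norm h * norm h" by (simp add: power2_eq_square)
      finally show "norm (conv g \<Theta> y' - conv g \<Theta> y - conv g (\<lambda>x. D x (y' - y)) y) / norm (y' - y)
          \<le> L * ?G * norm (y' - y)"
        using h by (simp add: h_def pos_divide_le_eq)
    next
      show "((\<lambda>y'. L * ?G * norm (y' - y)) \<longlongrightarrow> 0) (at y)"
        by (auto intro!: tendsto_eq_intros)
    qed simp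
  qed
qed

lemma conv_Cc_infinity:
  fixes \<Theta> :: "'a::euclidean_space \<Rightarrow> 'b::euclidean_space"
  assumes "integrable lborel g" "\<And>x. \<rho> < norm x \<Longrightarrow> g x = 0" "\<Theta> \<in> Cc_infinity"
  shows "conv g \<Theta> \<in> Cc_infinity"
proof -
  obtain r where "\<And>x. r < norm x \<Longrightarrow> \<Theta> x = 0" using assms(3) by (auto simp: Cc_infinity_iff)
  then show ?thesis
    by (intro Cc_infinityI[where r="\<rho> + r"] conv_class_C conv_zero assms)
qed

lemma indicator_cball_integrable [simp]:
  "integrable lborel (indicator (cball (a::'a::euclidean_space) r) :: 'a \<Rightarrow> real)"
  by (rule integrable_real_indicator) (use emeasure_lborel_cball_finite[of a r] in auto)

lemma continuous_compact_support_integrable: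
  fixes g :: "'a::euclidean_space \<Rightarrow> real"
  assumes g: "continuous_on UNIV g" "\<And>x. \<rho> < norm x \<Longrightarrow> g x = 0"
  shows "integrable lborel g"
proof -
  obtain G where G: "0 < G" "\<And>x. norm (g x) \<le> G"
    using compact_support_bounded[OF g] by metis
  show ?thesis
  proof (rule Bochner_Integration.integrable_bound)
    show "integrable lborel (\<lambda>x. G * indicator (cball (0::'a) \<rho>) x)" by simp
    show "AE x in lborel. norm (g x) \<le> norm (G * indicator (cball 0 \<rho>) x)"
      using G g(2) by (auto simp: indicator_def)
    show "g \<in> borel_measurable lborel" using borel_measurable_continuous_onI[OF g(1)] by simp
  qed
qed

text \<open>By translation invariance the integral of F(z + h v) - F(z) vanishes, so h times the
  integral of the derivative is minus an integrated Taylor error. That error is O(h^2) on a fixed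
  ball; divide by h and let h tend to 0.\<close>

lemma integral_derivative_zero:
  fixes F :: "'a::euclidean_space \<Rightarrow> real"
  assumes F: "F \<in> Cc_infinity" and D: "\<And>x. (F has_derivative D x) (at x)" "\<And>v. (\<lambda>x. D x v) \<in> Cc_infinity"
  shows "(\<integral>z. D z v \<partial>lborel) = 0" and "integrable lborel (\<lambda>z. D z v)"
proof -
  obtain L where L: "0 < L" "\<And>x h. norm (F (x + h) - F x - D x h) \<le> L * (norm h)\<^sup>2"
    using Cc_infinity_derivative_lipschitz[OF D] by metis
  have int: "integrable lborel G" if G: "G \<in> Cc_infinity" for G :: "'a \<Rightarrow> real"
  proof -
    obtain r where "\<And>x. r < norm x \<Longrightarrow> G x = 0" using G by (auto simp: Cc_infinity_iff)
    with class_C_continuous[OF Cc_infinity_class_C[OF G]] show ?thesis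
      by (rule continuous_compact_support_integrable)
  qed
  show iD: "integrable lborel (\<lambda>z. D z v)" using int[OF D(2)] .
  have lin: "linear (D x)" for x
    using D(1) has_derivative_bounded_linear bounded_linear.linear by blast
  obtain r1 where r1: "\<And>x. r1 < norm x \<Longrightarrow> F x = 0" using F by (auto simp: Cc_infinity_iff)
  obtain r2 where r2: "\<And>x. r2 < norm x \<Longrightarrow> D x v = 0" using D(2)[of v] by (auto simp: Cc_infinity_iff)
  \<comment> \<open>For 0 < h \<le> 1 a point outside radius R has both itself and its translate by
    h v outside the supports.\<close>
  define R where "R = max r1 r2 + norm v"
  define V where "V = measure lborel (cball (0::'a) R)"
  have bound: "\<bar>\<integral>z. D z v \<partial>lborel\<bar> \<le> h * (L * (norm v)\<^sup>2 * V)" if h: "0 < h" "h \<le> 1" for h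
  proof -
    have iF: "integrable lborel (\<lambda>z. F (z + h *\<^sub>R v))"
      using lborel_integral_affine(2)[of F 1 "h *\<^sub>R v"] int[OF F] by (simp add: add.commute borel_measurable_integrable)
    have "(\<integral>z. F (z + h *\<^sub>R v) \<partial>lborel) = (\<integral>z. F z \<partial>lborel)"
      using lborel_integral_affine(1)[of F 1 "h *\<^sub>R v"] int[OF F] by (simp add: add.commute borel_measurable_integrable)
    then have "h * (\<integral>z. D z v \<partial>lborel) = - (\<integral>z. F (z + h *\<^sub>R v) - F z - D z (h *\<^sub>R v) \<partial>lborel)"
      by (simp add: iF int[OF F] iD linear_scale[OF lin])
    moreover have "norm (\<integral>z. F (z + h *\<^sub>R v) - F z - D z (h *\<^sub>R v) \<partial>lborel)
        \<le> (\<integral>z. L * (norm (h *\<^sub>R v))\<^sup>2 * indicator (cball (0::'a) R) z \<partial>lborel)"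
    proof (intro Bochner_Integration.integral_norm_bound_integral)
      show "integrable lborel (\<lambda>z. F (z + h *\<^sub>R v) - F z - D z (h *\<^sub>R v))"
        by (simp add: iF int[OF F] iD linear_scale[OF lin])
      fix z :: 'a
      show "norm (F (z + h *\<^sub>R v) - F z - D z (h *\<^sub>R v)) \<le> L * (norm (h *\<^sub>R v))\<^sup>2 * indicator (cball (0::'a) R) z"
      proof (cases "norm z \<le> R")
        case True then show ?thesis using L(2)[of z "h *\<^sub>R v"] by simp
      next
        case False
        have "norm (h *\<^sub>R v) \<le> norm v" using h mult_right_mono[of h 1 "norm v"] by simp
        moreover have "norm z \<le> norm (z + h *\<^sub>R v) + norm (h *\<^sub>R v)"
          using norm_triangle_ineq4[of "z + h *\<^sub>R v" "h *\<^sub>R v"] by simp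
        ultimately have "max r1 r2 < norm (z + h *\<^sub>R v)" "max r1 r2 < norm z"
          using False norm_ge_zero[of v] unfolding R_def by linarith+
        then show ?thesis using r1 r2 False by (simp add: linear_scale[OF lin])
      qed
    qed simp
    moreover have "(\<integral>z. L * (norm (h *\<^sub>R v))\<^sup>2 * indicator (cball (0::'a) R) z \<partial>lborel) =
        h * (h * (L * (norm v)\<^sup>2 * V))"
      using h by (simp add: V_def power_mult_distrib) (simp add: power2_eq_square ac_simps)
    ultimately have "\<bar>h * (\<integral>z. D z v \<partial>lborel)\<bar> \<le> h * (h * (L * (norm v)\<^sup>2 * V))"
      by (simp only: abs_minus_cancel real_norm_def)
    then show ?thesis using h by (simp only: abs_mult abs_of_pos mult_le_cancel_left_pos)
  qed
  have "((\<lambda>h. h * (L * (norm v)\<^sup>2 * V)) \<longlongrightarrow> 0) (at_right 0)"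
    by (auto intro!: tendsto_eq_intros)
  then have "\<bar>\<integral>z. D z v \<partial>lborel\<bar> \<le> 0"
  proof (rule tendsto_lowerbound)
    show "\<forall>\<^sub>F h in at_right 0. \<bar>\<integral>z. D z v \<partial>lborel\<bar> \<le> h * (L * (norm v)\<^sup>2 * V)"
      unfolding eventually_at_right_field by (intro exI[of _ 1]) (use bound in auto)
  qed simp
  then show "(\<integral>z. D z v \<partial>lborel) = 0" by simp
qed

context
  fixes \<alpha> :: real
  assumes \<alpha>: "0 < \<alpha>" "\<alpha> < 1"
begin

text \<open>All double integrals below are dominated by \<open>fmaj\<close> in z times a function of
  x with mass bounded uniformly in z. That function may depend on z, since the supports of
  increments move with z.\<close>

lemma fmaj_Fubini:
  fixes F :: "'a::euclidean_space \<Rightarrow> 'a \<Rightarrow> real"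
  assumes "(\<lambda>(z, x). F z x) \<in> borel_measurable (borel \<Otimes>\<^sub>M borel)"
    and G: "\<And>z. integrable lborel (G z)" "\<And>z. (\<integral>x. G z x \<partial>lborel) \<le> C"
    and F: "\<And>z x. \<bar>F z x\<bar> \<le> fmaj \<alpha> z * G z x"
  shows "integrable (lborel \<Otimes>\<^sub>M lborel) (\<lambda>(z, x). F z x)"
proof (rule lborel_pair.Fubini_integrable)
  have [measurable]: "(\<lambda>(z, x). F z x) \<in> borel_measurable (lborel \<Otimes>\<^sub>M lborel)"
    using assms(1) by (simp cong: measurable_cong_sets sets_pair_measure_cong)
  then have [measurable]: "F z \<in> borel_measurable lborel" for z
    using measurable_Pair2[of "\<lambda>(z, x). F z x"] by auto
  show "(\<lambda>(z, x). F z x) \<in> borel_measurable (lborel \<Otimes>\<^sub>M lborel)" by fact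
  have i: "integrable lborel (F z)" for z
    by (rule Bochner_Integration.integrable_bound[OF integrable_mult_right[OF G(1), of "fmaj \<alpha> z" z]])
      (use F order_trans[OF F abs_ge_self] in auto)
  then show "AE z in lborel. integrable lborel (\<lambda>x. case (z, x) of (z, x) \<Rightarrow> F z x)" by simp
  show "integrable lborel (\<lambda>z. \<integral>x. norm (case (z, x) of (z, x) \<Rightarrow> F z x) \<partial>lborel)"
  proof (rule Bochner_Integration.integrable_bound)
    show "integrable lborel (\<lambda>z::'a. C * fmaj \<alpha> z)" by (intro integrable_mult_right fmaj_integrable \<alpha>)
    show "(\<lambda>z. \<integral>x. norm (case (z, x) of (z, x) \<Rightarrow> F z x) \<partial>lborel) \<in> borel_measurable lborel"
      by (rule lborel.borel_measurable_lebesgue_integral) measurable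
    have "(\<integral>x. \<bar>F z x\<bar> \<partial>lborel) \<le> C * fmaj \<alpha> z" for z
    proof -
      have "(\<integral>x. \<bar>F z x\<bar> \<partial>lborel) \<le> (\<integral>x. fmaj \<alpha> z * G z x \<partial>lborel)"
        by (intro integral_mono integrable_abs i integrable_mult_right G F)
      also have "\<dots> \<le> fmaj \<alpha> z * C" using mult_left_mono[OF G(2) fmaj_nonneg] by simp
      finally show ?thesis by (simp add: mult.commute)
    qed
    then show "AE z in lborel. norm (\<integral>x. norm (case (z, x) of (z, x) \<Rightarrow> F z x) \<partial>lborel) \<le> norm (C * fmaj \<alpha> z)"
      using abs_ge_self order_trans by (fastforce intro!: AE_I2)
  qed
qed

text \<open>The operator is linear and commutes with translations, hence with superpositions of
  translates; the majorant justifies the exchange.\<close>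

lemma fdiv_conv:
  fixes \<Theta> :: "'a::euclidean_space \<Rightarrow> 'a"
  assumes g: "integrable lborel g" and \<Theta>: "blip B \<Theta>"
  shows "fdiv \<alpha> (conv g \<Theta>) x = (\<integral>w. g w * fdiv \<alpha> \<Theta> (x - w) \<partial>lborel)"
proof -
  have [measurable]: "g \<in> borel_measurable borel" "\<Theta> \<in> borel_measurable borel"
    using g blip_measurable[OF \<Theta>] by (auto dest: borel_measurable_integrable)
  let ?F = "\<lambda>z w. g w * (fker \<alpha> z * (z \<bullet> (\<Theta> (x - w + z) - \<Theta> (x - w))))"
  have int: "integrable (lborel \<Otimes>\<^sub>M lborel) (\<lambda>(z, w). ?F z w)"
  proof (rule fmaj_Fubini)
    show "(\<lambda>(z, w). ?F z w) \<in> borel_measurable (borel \<Otimes>\<^sub>M borel)" by measurable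
    show "integrable lborel (\<lambda>w. 2 * B * \<bar>g w\<bar>)" using g by simp
    show "(\<integral>w. 2 * B * \<bar>g w\<bar> \<partial>lborel) \<le> (\<integral>w. 2 * B * \<bar>g w\<bar> \<partial>lborel)" by simp
    show "\<bar>?F z w\<bar> \<le> fmaj \<alpha> z * (2 * B * \<bar>g w\<bar>)" for z w
      using mult_left_mono[OF fdiv_integrand_bound[OF \<Theta>], of "\<bar>g w\<bar>" \<alpha> z "x - w"]
      by (simp add: abs_mult ac_simps)
  qed
  note ci = conv_integrable[OF g blip_measurable[OF \<Theta>] blip_norm[OF \<Theta>]]
  have "fdiv \<alpha> (conv g \<Theta>) x = (\<integral>z. (\<integral>w. ?F z w \<partial>lborel) \<partial>lborel)"
    unfolding fdiv_def
  proof (rule Bochner_Integration.integral_cong[OF refl])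
    fix z
    have d: "conv g \<Theta> (x + z) - conv g \<Theta> x = (\<integral>w. g w *\<^sub>R (\<Theta> (x - w + z) - \<Theta> (x - w)) \<partial>lborel)"
      unfolding conv_def by (subst Bochner_Integration.integral_diff[symmetric, OF ci ci])
        (simp add: scaleR_diff_right algebra_simps)
    have i: "integrable lborel (\<lambda>w. g w *\<^sub>R (\<Theta> (x - w + z) - \<Theta> (x - w)))"
      using Bochner_Integration.integrable_diff[OF ci ci, of "x + z" x] by (simp add: scaleR_diff_right algebra_simps)
    have "fker \<alpha> z * (z \<bullet> (conv g \<Theta> (x + z) - conv g \<Theta> x)) =
      fker \<alpha> z * (\<integral>w. z \<bullet> (g w *\<^sub>R (\<Theta> (x - w + z) - \<Theta> (x - w))) \<partial>lborel)"
      by (subst d, subst integral_inner_right) (use i in auto)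
    also have "\<dots> = (\<integral>w. ?F z w \<partial>lborel)"
      by (subst integral_mult_right_zero[symmetric], intro Bochner_Integration.integral_cong) (auto simp: ac_simps)
    finally show "fker \<alpha> z * (z \<bullet> (conv g \<Theta> (x + z) - conv g \<Theta> x)) = (\<integral>w. ?F z w \<partial>lborel)" .
  qed
  also have "\<dots> = (\<integral>w. (\<integral>z. ?F z w \<partial>lborel) \<partial>lborel)"
    by (rule lborel_pair.Fubini_integral[OF int, symmetric])
  finally show ?thesis by (simp add: fdiv_def)
qed

text \<open>A nonlocal integration by parts: translating x by z moves the increment from the field
  to b, which is merely bounded. It is used with b constant (vanishing integral), b radially
  decreasing (positivity) and b an indicator (optimality).\<close>

lemma fdiv_pairing:
  fixes \<Theta> :: "'a::euclidean_space \<Rightarrow> 'a"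
  assumes \<Theta>: "blip B \<Theta>" "\<And>x. r < norm x \<Longrightarrow> \<Theta> x = 0"
    and [measurable]: "b \<in> borel_measurable borel" and b: "\<And>x. \<bar>b x\<bar> \<le> C"
  shows "integrable lborel (\<lambda>x. b x * fdiv \<alpha> \<Theta> x)" (is ?A)
    and "integrable lborel (\<lambda>z. fker \<alpha> z * (\<integral>x. (b (x - z) - b x) * (z \<bullet> \<Theta> x) \<partial>lborel))" (is ?B)
    and "(\<integral>x. b x * fdiv \<alpha> \<Theta> x \<partial>lborel) =
      (\<integral>z. fker \<alpha> z * (\<integral>x. (b (x - z) - b x) * (z \<bullet> \<Theta> x) \<partial>lborel) \<partial>lborel)" (is ?C)
proof -
  have [measurable]: "\<Theta> \<in> borel_measurable borel" using blip_measurable[OF \<Theta>(1)] .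
  have C: "0 \<le> C" using b[of 0] by (rule order_trans[OF abs_ge_zero])
  let ?F = "\<lambda>z x. b x * (fker \<alpha> z * (z \<bullet> (\<Theta> (x + z) - \<Theta> x)))"
  let ?I = "indicator (cball (0::'a) r) :: 'a \<Rightarrow> real"
  have It: "integrable lborel (\<lambda>x. ?I (x + z))" "(\<integral>x. ?I (x + z) \<partial>lborel) = (\<integral>x. ?I x \<partial>lborel)" for z
    using lborel_integral_affine[of ?I 1 z] by (simp_all add: add.commute)
  have int: "integrable (lborel \<Otimes>\<^sub>M lborel) (\<lambda>(z, x). ?F z x)"
  proof (rule fmaj_Fubini)
    show "(\<lambda>(z, x). ?F z x) \<in> borel_measurable (borel \<Otimes>\<^sub>M borel)" by measurable
    \<comment> \<open>The increment vanishes unless x or x + z lies in the support ball; both sets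
      have the same volume, whatever z is.\<close>
    show "integrable lborel (\<lambda>x. C * (2 * B) * (?I x + ?I (x + z)))" for z using It by simp
    show "(\<integral>x. C * (2 * B) * (?I x + ?I (x + z)) \<partial>lborel) \<le> C * (2 * B) * (2 * (\<integral>x. ?I x \<partial>lborel))" for z
      using It by simp
    show "\<bar>?F z x\<bar> \<le> fmaj \<alpha> z * (C * (2 * B) * (?I x + ?I (x + z)))" for z x
    proof (cases "norm x \<le> r \<or> norm (x + z) \<le> r")
      case True
      then have "1 \<le> ?I x + ?I (x + z)" by (auto simp: indicator_def)
      then have "C * (2 * B * fmaj \<alpha> z) * 1 \<le> C * (2 * B * fmaj \<alpha> z) * (?I x + ?I (x + z))"
        using C blip_pos[OF \<Theta>(1)] by (intro mult_left_mono) auto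
      moreover have "\<bar>?F z x\<bar> \<le> C * (2 * B * fmaj \<alpha> z)"
        unfolding abs_mult[of "b x"]
        using b fdiv_integrand_bound[OF \<Theta>(1), of \<alpha> z x] C by (intro mult_mono) auto
      ultimately show ?thesis by (simp only: ac_simps)
    qed (use \<Theta>(2) in auto)
  qed
  have inner: "(\<integral>x. ?F z x \<partial>lborel) = fker \<alpha> z * (\<integral>x. (b (x - z) - b x) * (z \<bullet> \<Theta> x) \<partial>lborel)" for z
  proof -
    have i1: "integrable lborel (\<lambda>x. c x * (z \<bullet> \<Theta> x))"
      if [measurable]: "c \<in> borel_measurable borel" and c: "\<And>x. \<bar>c x\<bar> \<le> C" for c
    proof (rule Bochner_Integration.integrable_bound)
      show "integrable lborel (\<lambda>x. C * (norm z * B) * ?I x)" by simp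
      show "AE x in lborel. norm (c x * (z \<bullet> \<Theta> x)) \<le> norm (C * (norm z * B) * ?I x)"
      proof (rule AE_I2)
        fix x
        have "\<bar>z \<bullet> \<Theta> x\<bar> \<le> norm z * B"
          by (rule order_trans[OF Cauchy_Schwarz_ineq2 mult_left_mono[OF blip_norm[OF \<Theta>(1)]]]) simp
        then have "\<bar>c x\<bar> * \<bar>z \<bullet> \<Theta> x\<bar> \<le> C * (norm z * B)" using c C by (intro mult_mono) auto
        then show "norm (c x * (z \<bullet> \<Theta> x)) \<le> norm (C * (norm z * B) * ?I x)"
          using \<Theta>(2)[of x] C blip_pos[OF \<Theta>(1)] by (auto simp: indicator_def abs_mult)
      qed
    qed measurable
    have m: "(\<lambda>x. b (x - z) * (z \<bullet> \<Theta> x)) \<in> borel_measurable borel" by measurable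
    have ib: "integrable lborel (\<lambda>x. b (x - z) * (z \<bullet> \<Theta> x))" by (rule i1) (use b in auto)
    have "(\<integral>x. b x * (z \<bullet> \<Theta> (x + z)) \<partial>lborel) = (\<integral>x. b (x - z) * (z \<bullet> \<Theta> x) \<partial>lborel)"
      and "integrable lborel (\<lambda>x. b x * (z \<bullet> \<Theta> (x + z)))"
      using lborel_integral_affine[OF m, of 1 z] ib by (simp_all add: add.commute)
    then have "(\<integral>x. b x * (z \<bullet> (\<Theta> (x + z) - \<Theta> x)) \<partial>lborel) = (\<integral>x. (b (x - z) - b x) * (z \<bullet> \<Theta> x) \<partial>lborel)"
      using i1[of b] b ib by (simp add: inner_diff_right right_diff_distrib left_diff_distrib)
    then show ?thesis
      by (simp add: mult.left_commute[of "b _" "fker _ _"])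
  qed
  show ?A using lborel_pair.integrable_snd[OF int] by (simp add: fdiv_def)
  show ?B using lborel_pair.integrable_fst[OF int] by (simp add: inner)
  show ?C using lborel_pair.Fubini_integral[OF int] by (simp add: fdiv_def inner)
qed

lemma integral_odd:
  fixes f :: "'a::euclidean_space \<Rightarrow> real"
  assumes "f \<in> borel_measurable borel" "\<And>x. f (- x) = - f x"
  shows "(\<integral>x. f x \<partial>lborel) = 0"
  using lborel_integral_affine(1)[OF assms(1), of "-1" 0] assms(2) by simp

text \<open>With the kernel regularized to \<open>(\<bar>z\<bar>\<^sup>2 + \<epsilon>)\<^sup>s\<close> the integrand becomes a difference of directional
  derivatives of compactly supported functions, because the kernel is radial.\<close>

lemma fdiv_curl:
  fixes H :: "'a::euclidean_space \<Rightarrow> real"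
  assumes H: "H \<in> Cc_infinity"
    and D: "\<And>x. (H has_derivative D x) (at x)" "\<And>v. (\<lambda>x. D x v) \<in> Cc_infinity"
  shows "fdiv \<alpha> (\<lambda>y. D y b *\<^sub>R a - D y a *\<^sub>R b) x = 0"
proof -
  define \<psi> where "\<psi> = (\<lambda>y. D y b *\<^sub>R a - D y a *\<^sub>R b)"
  have "\<psi> \<in> Cc_infinity" unfolding \<psi>_def
    by (intro Cc_infinity_diff Cc_infinity_linear[OF bounded_linear_scaleR_left] D)
  then obtain B where B: "blip B \<psi>" using Cc_infinity_blip by blast
  have [measurable]: "\<psi> \<in> borel_measurable borel" using blip_measurable[OF B] .
  \<comment> \<open>Half the exponent of the kernel, because the regularization acts on |z|^2, which
    is smooth at the origin.\<close>
  define s where "s = - ((real DIM('a) + \<alpha> + 1) / 2)"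
  have s: "s < 0" using \<alpha> by (simp add: s_def add_pos_pos)
  define k where "k = (\<lambda>\<epsilon>::real. \<lambda>z::'a. ((norm z)\<^sup>2 + \<epsilon>) powr s)"
  have fk: "((norm z)\<^sup>2) powr s = fker \<alpha> z" for z :: 'a
  proof -
    have "(norm z)\<^sup>2 = norm z powr 2" by simp
    then have "((norm z)\<^sup>2) powr s = norm z powr (2 * s)" by (simp only: powr_powr)
    moreover have "2 * - (t / 2) = - t" for t :: real by simp
    then have "2 * s = - (real DIM('a) + \<alpha> + 1)" unfolding s_def .
    ultimately show ?thesis by (simp only: fker_def)
  qed
  have k_le: "k \<epsilon> z \<le> fker \<alpha> z" if "0 < \<epsilon>" "z \<noteq> 0" for \<epsilon> z
  proof -
    have "k \<epsilon> z \<le> ((norm z)\<^sup>2) powr s" unfolding k_def using that s by (intro powr_mono2') auto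
    also have "\<dots> = fker \<alpha> z" by (rule fk)
    finally show ?thesis .
  qed
  have zero: "(\<integral>z. k \<epsilon> z * (z \<bullet> (\<psi> (x + z) - \<psi> x)) \<partial>lborel) = 0" if e: "0 < \<epsilon>" for \<epsilon>
  proof -
    have P: "0 < (norm z)\<^sup>2 + \<epsilon>" for z :: 'a using e by (simp add: add_nonneg_pos)
    have P_eq: "(norm z)\<^sup>2 + \<epsilon> = z \<bullet> z + \<epsilon>" for z :: 'a by (simp add: power2_norm_eq_inner)
    have CP: "class_C m (\<lambda>z::'a. (norm z)\<^sup>2 + \<epsilon>)" for m
      unfolding P_eq by (intro class_C_add class_C_inner class_C_ident class_C_const)
    have Ck: "class_C m (k \<epsilon>)" for m
      unfolding k_def by (rule class_C_powr[OF P CP])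
    have [measurable]: "k \<epsilon> \<in> borel_measurable borel" unfolding k_def by measurable
    define k' where "k' = (\<lambda>z::'a. 2 * (s * ((norm z)\<^sup>2 + \<epsilon>) powr (s - 1)))"
    have dk: "(k \<epsilon> has_derivative (\<lambda>v. (z \<bullet> v) * k' z)) (at z)" for z
    proof -
      have "((\<lambda>z::'a. (norm z)\<^sup>2 + \<epsilon>) has_derivative (\<lambda>v. 2 * (z \<bullet> v))) (at z)"
        unfolding P_eq by (auto intro!: derivative_eq_intros simp: inner_commute)
      from DERIV_compose_FDERIV[OF has_real_derivative_powr[OF P] this]
      show ?thesis unfolding k_def k'_def by (simp add: ac_simps)
    qed
    have dH: "((\<lambda>z. H (x + z)) has_derivative D (x + z)) (at z)" for z
    proof -
      have "((\<lambda>z. x + z) has_derivative (\<lambda>v. v)) (at z)" by (auto intro!: derivative_eq_intros)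
      from has_derivative_compose[OF this D(1)] show ?thesis .
    qed
    obtain r where r: "\<And>x. r < norm x \<Longrightarrow> H x = 0" using H by (auto simp: Cc_infinity_iff)
    have Hx: "(\<lambda>z. H (x + z)) \<in> Cc_infinity"
      using Cc_infinity_affine[OF H, of 1 x] by (simp add: add.commute)
    define F where "F = (\<lambda>c z. k \<epsilon> z * (z \<bullet> c) * H (x + z))"
    define DF where "DF = (\<lambda>c z v. ((z \<bullet> v) * k' z) * (z \<bullet> c) * H (x + z) +
        k \<epsilon> z * (v \<bullet> c) * H (x + z) + k \<epsilon> z * (z \<bullet> c) * D (x + z) v)"
    have FC: "F c \<in> Cc_infinity" for c
    proof -
      obtain r where "\<And>z. r < norm z \<Longrightarrow> H (x + z) = 0" using Hx by (auto simp: Cc_infinity_iff)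
      then show ?thesis unfolding F_def
        by (intro Cc_infinityI[where r=r] class_C_mult Ck class_C_inner class_C_ident class_C_const
            Cc_infinity_class_C[OF Hx]) auto
    qed
    have dF: "(F c has_derivative DF c z) (at z)" for c z
      unfolding F_def DF_def
      by (rule has_derivative_eq_rhs, (rule has_derivative_mult dk dH derivative_intros)+)
        (auto simp: fun_eq_iff algebra_simps)
    have DFC: "(\<lambda>z. DF c z v) \<in> Cc_infinity" for c v
    proof -
      obtain E where E: "\<And>z. (F c has_derivative E z) (at z)" "\<And>v. (\<lambda>z. E z v) \<in> Cc_infinity"
        by (rule Cc_infinity_derivative[OF FC[of c]]) blast
      have "E = DF c" by (rule ext, rule has_derivative_unique[OF E(1) dF])
      with E(2) show ?thesis by simp
    qed
    note zeroDF = integral_derivative_zero[OF FC dF DFC]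
    \<comment> \<open>The terms with \<open>k'\<close> and those with a . b are symmetric in a and b
      and cancel. Only the derivatives of H survive, and these form the curl field.\<close>
    have eq: "DF a z b - DF b z a = k \<epsilon> z * (z \<bullet> \<psi> (x + z))" for z
      by (simp add: DF_def \<psi>_def inner_diff_right algebra_simps inner_commute)
    have z1: "(\<integral>z. k \<epsilon> z * (z \<bullet> \<psi> (x + z)) \<partial>lborel) = 0" and i1: "integrable lborel (\<lambda>z. k \<epsilon> z * (z \<bullet> \<psi> (x + z)))"
      unfolding eq[symmetric] using zeroDF[of a b] zeroDF[of b a] by simp_all
    have i2: "integrable lborel (\<lambda>z. k \<epsilon> z * (z \<bullet> (\<psi> (x + z) - \<psi> x)))"
    proof (rule Bochner_Integration.integrable_bound[OF fdiv_integrable[OF \<alpha> B, of x]])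
      show "AE z in lborel. norm (k \<epsilon> z * (z \<bullet> (\<psi> (x + z) - \<psi> x))) \<le> norm (fker \<alpha> z * (z \<bullet> (\<psi> (x + z) - \<psi> x)))"
      proof (rule AE_I2)
        fix z show "norm (k \<epsilon> z * (z \<bullet> (\<psi> (x + z) - \<psi> x))) \<le> norm (fker \<alpha> z * (z \<bullet> (\<psi> (x + z) - \<psi> x)))"
          using k_le[OF e, of z] by (cases "z = 0") (auto simp: abs_mult k_def intro: mult_right_mono)
      qed
    qed measurable
    \<comment> \<open>The subtracted constant vector contributes an odd integrand.\<close>
    have z2: "(\<integral>z. k \<epsilon> z * (z \<bullet> \<psi> x) \<partial>lborel) = 0"
      by (rule integral_odd) (simp_all add: k_def)
    have i3: "integrable lborel (\<lambda>z. k \<epsilon> z * (z \<bullet> \<psi> x))"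
      using Bochner_Integration.integrable_diff[OF i1 i2] by (simp add: inner_diff_right algebra_simps)
    have "(\<integral>z. k \<epsilon> z * (z \<bullet> (\<psi> (x + z) - \<psi> x)) \<partial>lborel) =
        (\<integral>z. k \<epsilon> z * (z \<bullet> \<psi> (x + z)) - k \<epsilon> z * (z \<bullet> \<psi> x) \<partial>lborel)"
      by (simp add: inner_diff_right algebra_simps)
    also have "\<dots> = 0" using z1 z2 i1 i3 by simp
    finally show ?thesis .
  qed
  have "(\<lambda>i. \<integral>z. k (inverse (Suc i)) z * (z \<bullet> (\<psi> (x + z) - \<psi> x)) \<partial>lborel) \<longlonglongrightarrow>
      (\<integral>z. fker \<alpha> z * (z \<bullet> (\<psi> (x + z) - \<psi> x)) \<partial>lborel)"
  proof (rule integral_dominated_convergence)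
    have [measurable]: "k \<epsilon> \<in> borel_measurable borel" for \<epsilon> unfolding k_def by measurable
    show "integrable lborel (\<lambda>z. norm (fker \<alpha> z * (z \<bullet> (\<psi> (x + z) - \<psi> x))))"
      by (intro integrable_norm fdiv_integrable[OF \<alpha> B])
    show "(\<lambda>z. k (inverse (Suc i)) z * (z \<bullet> (\<psi> (x + z) - \<psi> x))) \<in> borel_measurable lborel" for i
      by measurable
    show "(\<lambda>z. fker \<alpha> z * (z \<bullet> (\<psi> (x + z) - \<psi> x))) \<in> borel_measurable lborel" by measurable
    show "AE z in lborel. norm (k (inverse (Suc i)) z * (z \<bullet> (\<psi> (x + z) - \<psi> x)))
        \<le> norm (fker \<alpha> z * (z \<bullet> (\<psi> (x + z) - \<psi> x)))" for i
    proof (rule AE_I2)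
      fix z show "norm (k (inverse (Suc i)) z * (z \<bullet> (\<psi> (x + z) - \<psi> x)))
        \<le> norm (fker \<alpha> z * (z \<bullet> (\<psi> (x + z) - \<psi> x)))"
        using k_le[of "inverse (Suc i)" z] by (cases "z = 0") (auto simp: abs_mult k_def intro: mult_right_mono)
    qed
    show "AE z in lborel. (\<lambda>i. k (inverse (Suc i)) z * (z \<bullet> (\<psi> (x + z) - \<psi> x))) \<longlonglongrightarrow>
        fker \<alpha> z * (z \<bullet> (\<psi> (x + z) - \<psi> x))"
    proof (rule AE_I2)
      fix z
      show "(\<lambda>i. k (inverse (Suc i)) z * (z \<bullet> (\<psi> (x + z) - \<psi> x))) \<longlonglongrightarrow>
        fker \<alpha> z * (z \<bullet> (\<psi> (x + z) - \<psi> x))"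
      proof (cases "z = 0")
        case False
        have "(\<lambda>i. ((norm z)\<^sup>2 + inverse (real (Suc i))) powr s) \<longlonglongrightarrow> ((norm z)\<^sup>2 + 0) powr s"
          using False by (intro tendsto_intros LIMSEQ_inverse_real_of_nat) auto
        then have "(\<lambda>i. k (inverse (Suc i)) z) \<longlonglongrightarrow> fker \<alpha> z"
          by (simp add: k_def fk)
        then show ?thesis by (intro tendsto_intros)
      qed simp
    qed
  qed
  then have "(\<integral>z. fker \<alpha> z * (z \<bullet> (\<psi> (x + z) - \<psi> x)) \<partial>lborel) = 0"
    by (simp add: zero LIMSEQ_const_iff)
  then show ?thesis by (simp add: fdiv_def \<psi>_def)
qed

end

section \<open>Invariance of Lebesgue measure under linear isometric involutions\<close>

lemma nn_integral_affine:
  fixes f :: "'a::euclidean_space \<Rightarrow> ennreal"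
  assumes [measurable]: "f \<in> borel_measurable borel" and "c \<noteq> 0"
  shows "(\<integral>\<^sup>+x. f x \<partial>lborel) = ennreal (\<bar>c\<bar> ^ DIM('a)) * (\<integral>\<^sup>+x. f (t + c *\<^sub>R x) \<partial>lborel)"
  by (subst lborel_affine[OF assms(2), of t]) (simp add: nn_integral_density nn_integral_distr nn_integral_cmult)

text \<open>A translation-invariant measure that agrees with Lebesgue measure on the unit ball is
  Lebesgue measure, by Tonelli's theorem.\<close>

lemma lborel_distr_involution:
  fixes T :: "'a::euclidean_space \<Rightarrow> 'a"
  assumes lin: "linear T" and T2: "\<And>x. T (T x) = x" and nT: "\<And>x. norm (T x) = norm x"
  shows "distr lborel borel T = lborel"
proof (rule measure_eqI)
  have [measurable]: "T \<in> borel_measurable borel"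
    by (intro borel_measurable_continuous_onI linear_continuous_on) (use lin in \<open>simp add: linear_conv_bounded_linear\<close>)
  let ?B = "cball (0::'a) 1"
  fix A assume "A \<in> sets (distr lborel borel T)"
  then have A[measurable]: "A \<in> sets borel" by simp
  have tr: "(\<integral>\<^sup>+u. f (T u - x) \<partial>lborel) = (\<integral>\<^sup>+u. f (T u) \<partial>lborel)"
    if [measurable]: "f \<in> borel_measurable borel" for f :: "'a \<Rightarrow> ennreal" and x
    using nn_integral_affine[of "\<lambda>u. f (T u - x)" 1 "T x"]
    by (simp add: linear_add[OF lin] T2)
  let ?a = "indicator A :: 'a \<Rightarrow> ennreal" and ?b = "indicator ?B :: 'a \<Rightarrow> ennreal"
  \<comment> \<open>The double integral of 1_A(x) 1_B(T u - x) is computed in both orders.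
    Integrating u first gives |A| |B|, as T preserves the ball B. Substituting x by T u - x and then
    integrating u first gives the measure of the preimage of A times |B|.\<close>
  have "emeasure lborel A * emeasure lborel ?B = (\<integral>\<^sup>+x. ?a x * (\<integral>\<^sup>+u. ?b (T u - x) \<partial>lborel) \<partial>lborel)"
  proof -
    have "(\<integral>\<^sup>+u. ?b (T u) \<partial>lborel) = emeasure lborel ?B"
    proof -
      have "?b (T u) = ?b u" for u by (simp add: indicator_def nT)
      then show ?thesis by simp
    qed
    then show ?thesis by (simp add: tr nn_integral_multc mult.commute)
  qed
  also have "\<dots> = (\<integral>\<^sup>+x. (\<integral>\<^sup>+u. ?a x * ?b (T u - x) \<partial>lborel) \<partial>lborel)"
    by (simp add: nn_integral_cmult)
  also have "\<dots> = (\<integral>\<^sup>+u. (\<integral>\<^sup>+x. ?a x * ?b (T u - x) \<partial>lborel) \<partial>lborel)"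
    by (rule lborel_pair.Fubini') measurable
  also have "\<dots> = (\<integral>\<^sup>+u. (\<integral>\<^sup>+x. ?a (T u - x) * ?b x \<partial>lborel) \<partial>lborel)"
  proof (rule nn_integral_cong)
    fix u
    show "(\<integral>\<^sup>+x. ?a x * ?b (T u - x) \<partial>lborel) = (\<integral>\<^sup>+x. ?a (T u - x) * ?b x \<partial>lborel)"
      using nn_integral_affine[of "\<lambda>x. ?a x * ?b (T u - x)" "-1" "T u"] by simp
  qed
  also have "\<dots> = (\<integral>\<^sup>+x. (\<integral>\<^sup>+u. ?a (T u - x) * ?b x \<partial>lborel) \<partial>lborel)"
    by (rule lborel_pair.Fubini') measurable
  also have "\<dots> = (\<integral>\<^sup>+u. ?a (T u) \<partial>lborel) * emeasure lborel ?B"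
    by (simp add: nn_integral_multc nn_integral_cmult tr)
  also have "(\<integral>\<^sup>+u. ?a (T u) \<partial>lborel) = emeasure (distr lborel borel T) A"
    using nn_integral_distr[of T lborel borel ?a] by simp
  finally have "emeasure lborel ?B * emeasure (distr lborel borel T) A = emeasure lborel ?B * emeasure lborel A"
    by (simp add: mult.commute)
  moreover have "emeasure lborel ?B \<noteq> 0"
    by (simp add: emeasure_cball unit_ball_vol_pos less_imp_neq[symmetric])
  moreover have "emeasure lborel ?B \<noteq> top"
    using emeasure_lborel_cball_finite[of "0::'a" 1] by auto
  ultimately show "emeasure (distr lborel borel T) A = emeasure lborel A"
    by (simp add: ennreal_mult_cancel_left)
qed simp

lemma integral_involution:
  fixes T :: "'a::euclidean_space \<Rightarrow> 'a" and f :: "'a \<Rightarrow> real"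
  assumes lin: "linear T" and "\<And>x. T (T x) = x" "\<And>x. norm (T x) = norm x"
    and [measurable]: "f \<in> borel_measurable borel"
  shows "(\<integral>x. f (T x) \<partial>lborel) = (\<integral>x. f x \<partial>lborel)"
proof -
  have [measurable]: "T \<in> borel_measurable borel"
    by (intro borel_measurable_continuous_onI linear_continuous_on) (use lin in \<open>simp add: linear_conv_bounded_linear\<close>)
  show ?thesis
    using integral_distr[of T lborel borel f] lborel_distr_involution[OF assms(1-3)] by simp
qed

subsection \<open>Smooth homogeneous fields\<close>

text \<open>Outside the unit ball \<open>smod z\<close> is \<open>\<bar>z\<bar>\<^sup>2\<close>, so \<open>sker q z\<close> is \<open>z \<bar>z\<bar>\<^sup>-\<^sup>2\<^sup>q\<close> there, and \<open>bumpf q t\<close>,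
  the difference of \<open>sker q\<close> and its dilate of the same homogeneity, has compact support.\<close>

definition smod :: "'a::euclidean_space \<Rightarrow> real" where
  "smod z = (norm z)\<^sup>2 + flat 0 (1 - (norm z)\<^sup>2)"

definition sker :: "real \<Rightarrow> 'a::euclidean_space \<Rightarrow> 'a" where
  "sker q z = smod z powr (- q) *\<^sub>R z"

text \<open>For |z|^2 \<le> 1/2 the flat term is at least its value exp(-2) at 1/2; otherwise |z|^2
  alone is large enough. The uniform bound keeps negative powers of \<open>smod\<close>
  bounded.\<close>

lemma smod_lower: "exp (- 2) \<le> smod z"
proof (cases "(norm z)\<^sup>2 \<le> 1 / 2")
  case True
  have "exp (- 2) = flat 0 (1 / 2)" by (simp add: flat_def)
  also have "\<dots> \<le> flat 0 (1 - (norm z)\<^sup>2)" using True by (intro flat0_mono) simp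
  finally show ?thesis by (simp add: smod_def add_increasing)
next
  case False
  have "exp (- 2) \<le> inverse (2::real)"
    unfolding exp_minus using exp_ge_add_one_self[of 2] by (intro le_imp_inverse_le) auto
  then show ?thesis using False flat_nonneg[of 0 "1 - (norm z)\<^sup>2"] by (simp add: smod_def)
qed

lemma smod_pos: "0 < smod z"
  by (rule less_le_trans[OF exp_gt_zero smod_lower])

lemma smod_outside: "1 \<le> norm z \<Longrightarrow> smod z = (norm z)\<^sup>2"
  by (simp add: smod_def flat_eq_0)

lemma smod_ge: "(norm z)\<^sup>2 \<le> smod z"
  by (simp add: smod_def flat_nonneg)

lemma smod_cong: "norm z = norm w \<Longrightarrow> smod z = smod w"
  by (simp add: smod_def)

text \<open>Both sides contain |z|^2, so only flat terms are compared, and \<open>flat 0\<close> is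
  increasing. Consequently the difference of the kernel and its dilate by 2 points outwards,
  strictly inside radius 2; positivity of the total mass rests on this.\<close>

lemma smod_le_half: "smod z \<le> 4 * smod (z /\<^sub>R 2)"
  and smod_less_half: "norm z < 2 \<Longrightarrow> smod z < 4 * smod (z /\<^sub>R 2)"
proof -
  have *: "4 * smod (z /\<^sub>R 2) = (norm z)\<^sup>2 + 4 * flat 0 (1 - (norm z)\<^sup>2 / 4)"
    by (simp add: smod_def power_divide)
  have m: "flat 0 (1 - (norm z)\<^sup>2) \<le> flat 0 (1 - (norm z)\<^sup>2 / 4)" by (intro flat0_mono) simp
  show "smod z \<le> 4 * smod (z /\<^sub>R 2)"
    unfolding * using m flat_nonneg[of 0 "1 - (norm z)\<^sup>2"] by (simp add: smod_def)
  assume "norm z < 2"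
  then have "(norm z)\<^sup>2 < 2\<^sup>2" by (intro power_strict_mono) auto
  then have "0 < flat 0 (1 - (norm z)\<^sup>2 / 4)" by (intro flat_pos) simp
  then show "smod z < 4 * smod (z /\<^sub>R 2)" unfolding * using m by (simp add: smod_def)
qed

lemma norm_sq_has_derivative: "((\<lambda>z::'a::euclidean_space. (norm z)\<^sup>2) has_derivative (\<lambda>v. 2 * (z \<bullet> v))) (at z)"
  unfolding power2_norm_eq_inner by (auto intro!: derivative_eq_intros simp: inner_commute)

lemma class_C_norm_sq: "class_C k (\<lambda>z::'a::euclidean_space. (norm z)\<^sup>2)"
  unfolding power2_norm_eq_inner by (intro class_C_inner class_C_ident)

lemma class_C_smod: "class_C k (smod :: 'a::euclidean_space \<Rightarrow> real)"
proof -
  have "class_C k (\<lambda>z::'a. (norm z)\<^sup>2 + flat 0 (1 - (norm z)\<^sup>2))"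
    by (intro class_C_add class_C_flat class_C_diff class_C_const class_C_norm_sq)
  then show ?thesis by (simp add: smod_def[abs_def])
qed

lemma class_C_sker: "class_C k (sker q)"
  unfolding sker_def[abs_def]
  by (intro class_C_scaleR class_C_ident class_C_powr smod_pos class_C_smod)

lemma sker_minus: "sker q (- z) = - sker q z"
  by (simp add: sker_def smod_cong[of "- z" z])

lemma sker_outside: "1 \<le> norm z \<Longrightarrow> sker q z = norm z powr (- 2 * q) *\<^sub>R z"
proof -
  assume z: "1 \<le> norm z"
  have "(norm z)\<^sup>2 = norm z powr 2" using z by simp
  then have "((norm z)\<^sup>2) powr (- q) = norm z powr (- 2 * q)" by (simp only: powr_powr) simp
  then show ?thesis using z by (simp add: sker_def smod_outside)
qed

text \<open>At infinity the field has size |z|^(1-2q), bounded exactly because q \<ge> 1/2. In the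
  derivative, the extra factor |z|^2 is absorbed by \<open>smod\<close>, so both terms are of size
  \<open>smod z powr (- q)\<close>.\<close>

lemma blip_sker:
  assumes q: "1 / 2 \<le> q"
  obtains B where "blip B (sker q :: 'a::euclidean_space \<Rightarrow> 'a)"
proof -
  define p where "p = exp (- 2) powr (- q)"
  have p: "0 < p" by (simp add: p_def)
  have pq: "smod z powr (- q) \<le> p" for z :: 'a
    unfolding p_def using q by (intro powr_mono2' smod_lower) auto
  \<comment> \<open>The derivative of \<open>flat 0\<close> is \<open>flat 2\<close>, which gives
    the factor 1 - \<open>flat 2\<close> in the gradient of \<open>smod\<close>.\<close>
  define D where "D = (\<lambda>z v::'a. smod z powr (- q) *\<^sub>R v +
      ((2 * (z \<bullet> v) * (1 - flat 2 (1 - (norm z)\<^sup>2))) * (- q * smod z powr (- q - 1))) *\<^sub>R z)"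
  have dsmod: "(smod has_derivative (\<lambda>v. 2 * (z \<bullet> v) * (1 - flat 2 (1 - (norm z)\<^sup>2)))) (at z)" for z :: 'a
  proof -
    have "((\<lambda>z. 1 - (norm z)\<^sup>2) has_derivative (\<lambda>v. - (2 * (z \<bullet> v)))) (at z)"
      by (rule has_derivative_eq_rhs, rule has_derivative_diff[OF has_derivative_const norm_sq_has_derivative]) simp
    from DERIV_compose_FDERIV[OF flat_has_derivative this, of 0]
    have "((\<lambda>z. flat 0 (1 - (norm z)\<^sup>2)) has_derivative (\<lambda>v. - (2 * (z \<bullet> v)) * flat 2 (1 - (norm z)\<^sup>2))) (at z)"
      by (simp add: numeral_2_eq_2)
    from has_derivative_add[OF norm_sq_has_derivative this] show ?thesis
      unfolding smod_def[abs_def] by (rule has_derivative_eq_rhs) (simp add: algebra_simps)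
  qed
  have D: "(sker q has_derivative D z) (at z)" for z :: 'a
  proof -
    have "((\<lambda>z. smod z powr (- q)) has_derivative
        (\<lambda>v. (2 * (z \<bullet> v) * (1 - flat 2 (1 - (norm z)\<^sup>2))) * (- q * smod z powr (- q - 1)))) (at z)"
      by (rule DERIV_compose_FDERIV[OF has_real_derivative_powr[OF smod_pos] dsmod])
    from has_derivative_scaleR[OF this has_derivative_ident]
    show ?thesis by (simp add: sker_def[abs_def] D_def)
  qed
  \<comment> \<open>25 = 1 + 24, with 24 = 4! from the quadratic bound for j = 2; the 50 below is 2
    times 25.\<close>
  have flat2: "\<bar>1 - flat 2 (1 - (norm z)\<^sup>2)\<bar> \<le> 25" for z :: 'a
  proof -
    have "flat 2 (1 - (norm z)\<^sup>2) \<le> 24"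
    proof (cases "(norm z)\<^sup>2 \<le> 1")
      case True
      then have "(1 - (norm z)\<^sup>2)\<^sup>2 \<le> 1" by (intro power_le_one) auto
      then show ?thesis using flat_le[of 2 "1 - (norm z)\<^sup>2"] by (simp add: fact_numeral)
    qed (simp add: flat_eq_0)
    then show ?thesis using flat_nonneg[of 2 "1 - (norm z)\<^sup>2"] by linarith
  qed
  have Dbound: "norm (D z v) \<le> p * (1 + 50 * q) * norm v" for z v
  proof -
    have "norm (D z v) \<le> p * norm v + (2 * (norm z * norm v) * 25) * (q * smod z powr (- q - 1)) * norm z"
      unfolding D_def
    proof (rule order_trans[OF norm_triangle_ineq add_mono])
      show "norm (smod z powr (- q) *\<^sub>R v) \<le> p * norm v" using pq by (simp add: mult_right_mono)
      have "\<bar>2 * (z \<bullet> v) * (1 - flat 2 (1 - (norm z)\<^sup>2))\<bar> \<le> 2 * (norm z * norm v) * 25"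
        unfolding abs_mult by (intro mult_mono flat2 Cauchy_Schwarz_ineq2) auto
      then have "\<bar>2 * (z \<bullet> v) * (1 - flat 2 (1 - (norm z)\<^sup>2))\<bar> * (q * smod z powr (- q - 1))
          \<le> (2 * (norm z * norm v) * 25) * (q * smod z powr (- q - 1))"
        by (rule mult_right_mono) (use q in simp)
      then show "norm ((2 * (z \<bullet> v) * (1 - flat 2 (1 - (norm z)\<^sup>2)) * (- q * smod z powr (- q - 1))) *\<^sub>R z)
          \<le> (2 * (norm z * norm v) * 25) * (q * smod z powr (- q - 1)) * norm z"
        unfolding norm_scaleR abs_mult[of _ "- q * _"]
        using q by (intro mult_right_mono) (auto simp: abs_mult)
    qed
    also have "(2 * (norm z * norm v) * 25) * (q * smod z powr (- q - 1)) * norm z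
        = 50 * q * norm v * ((norm z)\<^sup>2 * smod z powr (- q - 1))"
      by (simp add: power2_eq_square)
    also have "\<dots> \<le> 50 * q * norm v * p"
    proof (rule mult_left_mono)
      have "(norm z)\<^sup>2 * smod z powr (- q - 1) \<le> smod z * smod z powr (- q - 1)"
        by (intro mult_right_mono smod_ge) simp
      also have "\<dots> = smod z powr (- q)" using powr_mult_base[of "smod z" "- q - 1"] smod_pos[of z] by simp
      finally show "(norm z)\<^sup>2 * smod z powr (- q - 1) \<le> p" using pq[of z] by linarith
    qed (use q in auto)
    finally show ?thesis by (simp add: algebra_simps)
  qed
  have lip: "norm (sker q x - sker q y) \<le> p * (1 + 50 * q) * norm (x - y)" for x y :: 'a
    by (rule differentiable_bound[of UNIV _ D])
      (use D p q in \<open>auto intro!: onorm_bound Dbound\<close>)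
  have bnd: "norm (sker q z) \<le> p + 1" for z :: 'a
  proof (cases "1 \<le> norm z")
    case True
    have "norm (sker q z) = norm z powr (- 2 * q) * norm z powr 1" using True by (simp add: sker_outside)
    also have "\<dots> = norm z powr (1 - 2 * q)" by (simp only: powr_add[symmetric]) simp
    also have "\<dots> \<le> norm z powr 0" using True q by (intro powr_mono) auto
    also have "\<dots> = 1" using True by (subst powr_zero_eq_one) auto
    finally show ?thesis using p by linarith
  next
    case False
    then have "norm (sker q z) \<le> p * 1" unfolding sker_def norm_scaleR
      using pq[of z] p by (intro mult_mono) auto
    then show ?thesis by simp
  qed
  show ?thesis
  proof (rule that[of "p * (1 + 50 * q) + (p + 1)"], unfold blip_def, intro conjI allI)
    have pq0: "0 \<le> p * (1 + 50 * q)" using p q by simp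
    show "0 < p * (1 + 50 * q) + (p + 1)" using add_nonneg_pos[OF pq0, of "p + 1"] p by simp
    show "norm (sker q x) \<le> p * (1 + 50 * q) + (p + 1)" for x :: 'a
      using bnd[of x] pq0 by linarith
    show "norm (sker q x - sker q y) \<le> (p * (1 + 50 * q) + (p + 1)) * norm (x - y)" for x y :: 'a
    proof -
      have "0 \<le> (p + 1) * norm (x - y)" using p by simp
      then show ?thesis using lip[of x y] by (simp only: distrib_right[of "p * (1 + 50 * q)"])
    qed
  qed
qed

definition bumpf :: "real \<Rightarrow> real \<Rightarrow> 'a::euclidean_space \<Rightarrow> 'a" where
  "bumpf q t z = sker q z - t powr (1 - 2 * q) *\<^sub>R sker q (z /\<^sub>R t)"

lemma bumpf_zero:
  assumes "0 < t" "max 1 t \<le> norm z"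
  shows "bumpf q t z = 0"
proof -
  have z: "1 \<le> norm z" "1 \<le> norm (z /\<^sub>R t)" using assms by (auto simp: field_simps)
  have "t powr (1 - 2 * q) * (norm (z /\<^sub>R t) powr (- 2 * q) / t) = norm z powr (- 2 * q)"
  proof -
    have "norm (z /\<^sub>R t) powr (- 2 * q) = norm z powr (- 2 * q) * t powr (2 * q)"
      using assms by (simp add: powr_divide powr_minus field_simps)
    moreover have "t powr (1 - 2 * q) * t powr (2 * q) = t" using assms by (simp add: powr_add[symmetric])
    ultimately show ?thesis using assms by (simp add: field_simps)
  qed
  then show ?thesis
    unfolding bumpf_def sker_outside[OF z(1)] sker_outside[OF z(2)] by (simp add: divide_inverse)
qed

lemma bumpf_minus: "bumpf q t (- z) = - bumpf q t z"
  using sker_minus[of q z] sker_minus[of q "z /\<^sub>R t"] by (simp add: bumpf_def)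

lemma bumpf_Cc_infinity:
  assumes "0 < t"
  shows "bumpf q t \<in> Cc_infinity"
proof (rule Cc_infinityI[where r="max 1 t"])
  show "class_C k (bumpf q t)" for k
    unfolding bumpf_def[abs_def]
    using class_C_affine[OF class_C_sker, of k q "inverse t" 0]
    by (intro class_C_diff class_C_sker class_C_scaleR class_C_const) simp
  show "bumpf q t z = 0" if "max 1 t < norm z" for z :: 'a
    using bumpf_zero[OF assms, of z q] that by linarith
qed

lemma blip_dilate:
  fixes \<phi> :: "'a::real_normed_vector \<Rightarrow> 'b::real_normed_vector"
  assumes "blip B \<phi>" "1 \<le> t"
  shows "blip B (\<lambda>x. \<phi> (x /\<^sub>R t))"
  unfolding blip_def
proof (intro conjI allI)
  show "0 < B" "norm (\<phi> (x /\<^sub>R t)) \<le> B" for x using assms by (auto simp: blip_def)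
  fix x y :: 'a
  have "norm (x /\<^sub>R t - y /\<^sub>R t) \<le> norm (x - y)"
  proof -
    have "norm (x /\<^sub>R t - y /\<^sub>R t) = norm (x - y) / t"
      using assms(2) unfolding scaleR_diff_right[symmetric] by (simp add: divide_inverse mult.commute)
    also have "\<dots> \<le> norm (x - y) / 1" using assms(2) by (intro divide_left_mono) auto
    finally show ?thesis by simp
  qed
  then show "norm (\<phi> (x /\<^sub>R t) - \<phi> (y /\<^sub>R t)) \<le> B * norm (x - y)"
    using blip_diff[OF assms(1), of "x /\<^sub>R t" "y /\<^sub>R t"] blip_pos[OF assms(1)]
    by (meson mult_left_mono less_imp_le order_trans)
qed

lemma blip_sub:
  assumes "blip B \<phi>" "blip C \<psi>"
  shows "blip (B + C) (\<lambda>x. \<phi> x - \<psi> x)"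
  unfolding blip_def
proof (intro conjI allI)
  show "0 < B + C" using assms[THEN blip_pos] by simp
  show "norm (\<phi> x - \<psi> x) \<le> B + C" for x
    using blip_norm[OF assms(1), of x] blip_norm[OF assms(2), of x] norm_triangle_ineq4[of "\<phi> x" "\<psi> x"] by linarith
  show "norm ((\<phi> x - \<psi> x) - (\<phi> y - \<psi> y)) \<le> (B + C) * norm (x - y)" for x y
  proof -
    have "norm ((\<phi> x - \<psi> x) - (\<phi> y - \<psi> y)) = norm ((\<phi> x - \<phi> y) - (\<psi> x - \<psi> y))"
      by (simp add: algebra_simps)
    also have "\<dots> \<le> norm (\<phi> x - \<phi> y) + norm (\<psi> x - \<psi> y)" by (rule norm_triangle_ineq4)
    finally show ?thesis using blip_diff[OF assms(1), of x y] blip_diff[OF assms(2), of x y]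
      by (simp add: distrib_right)
  qed
qed

lemma blip_scale:
  assumes "blip B \<phi>" "\<bar>c\<bar> \<le> 1"
  shows "blip B (\<lambda>x. c *\<^sub>R \<phi> x)"
  unfolding blip_def
proof (intro conjI allI)
  have le: "\<bar>c\<bar> * n \<le> m" if "n \<le> m" "0 \<le> n" for n m
    using mult_right_mono[OF assms(2) that(2)] that by simp
  show "0 < B" using assms by (simp add: blip_def)
  show "norm (c *\<^sub>R \<phi> x) \<le> B" for x using le[OF blip_norm[OF assms(1)]] by simp
  show "norm (c *\<^sub>R \<phi> x - c *\<^sub>R \<phi> y) \<le> B * norm (x - y)" for x y
    using le[OF blip_diff[OF assms(1)], of x y] by (simp add: scaleR_diff_right[symmetric])
qed

lemma blip_bumpf:
  assumes "blip B (sker q :: 'a::euclidean_space \<Rightarrow> 'a)" "1 \<le> t" "1 / 2 \<le> q"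
  shows "blip (2 * B) (bumpf q t :: 'a \<Rightarrow> 'a)"
proof -
  have "t powr (1 - 2 * q) \<le> t powr 0" using assms by (intro powr_mono) auto
  then have "blip (B + B) (bumpf q t :: 'a \<Rightarrow> 'a)"
    unfolding bumpf_def[abs_def] using assms
    by (intro blip_sub blip_scale blip_dilate) auto
  then show ?thesis by simp
qed

lemma bumpf_half:
  fixes z :: "'a::euclidean_space"
  assumes "0 < q"
  shows "\<exists>\<theta>\<ge>0. bumpf q 2 z = \<theta> *\<^sub>R z \<and> (norm z < 2 \<longrightarrow> 0 < \<theta>)"
proof (intro exI conjI impI)
  define \<theta> where "\<theta> = smod z powr (- q) - (4 * smod (z /\<^sub>R 2)) powr (- q)"
  have "2 powr (1 - 2 * q) * smod (z /\<^sub>R 2) powr (- q) / 2 = (4 * smod (z /\<^sub>R 2)) powr (- q)"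
  proof -
    have "(4::real) = 2 powr 2" by simp
    then have "4 powr (- q) = (2::real) powr (- 2 * q)" by (simp only: powr_powr) simp
    moreover have "(2::real) powr (1 - 2 * q) = 2 powr 1 * 2 powr (- 2 * q)"
      by (simp only: powr_add[symmetric]) simp
    ultimately show ?thesis by (simp add: powr_mult)
  qed
  then have "2 powr (1 - 2 * q) *\<^sub>R sker q (z /\<^sub>R 2) = (4 * smod (z /\<^sub>R 2)) powr (- q) *\<^sub>R z"
    by (simp only: sker_def scaleR_scaleR divide_inverse mult.assoc)
  then show "bumpf q 2 z = \<theta> *\<^sub>R z"
    by (simp only: bumpf_def \<theta>_def scaleR_diff_left) (simp only: sker_def)
  show "0 \<le> \<theta>" 
    unfolding \<theta>_def diff_ge_0_iff_ge by (rule powr_mono2'[OF _ smod_pos smod_le_half]) (use assms in simp)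
  show "0 < \<theta>" if "norm z < 2"
    unfolding \<theta>_def diff_gt_0_iff_gt
    by (rule powr_less_mono2_neg[OF _ smod_pos smod_less_half[OF that]]) (use assms in simp)
qed

lemma powr_neg_lipschitz:
  fixes a b :: real
  assumes "0 < \<rho>" "\<rho> \<le> a" "\<rho> \<le> b" "0 \<le> s"
  shows "\<bar>a powr (- s) - b powr (- s)\<bar> \<le> s * \<rho> powr (- s - 1) * \<bar>a - b\<bar>"
proof -
  have "norm (a powr (- s) - b powr (- s)) \<le> s * \<rho> powr (- s - 1) * norm (a - b)"
  proof (rule field_differentiable_bound[where S="{\<rho>..}" and f'="\<lambda>x. - s * x powr (- s - 1)"])
    show "((\<lambda>x. x powr (- s)) has_field_derivative - s * x powr (- s - 1)) (at x within {\<rho>..})"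
      if "x \<in> {\<rho>..}" for x
      by (rule has_field_derivative_at_within[OF has_real_derivative_powr]) (use that assms in auto)
    show "norm (- s * x powr (- s - 1)) \<le> s * \<rho> powr (- s - 1)" if "x \<in> {\<rho>..}" for x
      using that assms by (auto simp: abs_mult intro!: mult_left_mono powr_mono2')
  qed (use assms in auto)
  then show ?thesis by simp
qed

context
  fixes \<alpha> :: real
  assumes \<alpha>: "0 < \<alpha>" "\<alpha> < 1"
begin

text \<open>Oddness makes the leading term of the far field cancel, which improves the decay by one power.\<close>

lemma fdiv_odd_decay:
  assumes r: "1 \<le> r"
  obtains C where "0 \<le> C" "\<And>\<phi> B x. blip B \<phi> \<Longrightarrow> (\<And>x. r < norm x \<Longrightarrow> \<phi> x = 0) \<Longrightarrow>
    (\<And>x. \<phi> (- x) = - \<phi> x) \<Longrightarrow>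
    \<bar>fdiv \<alpha> \<phi> (x::'a::euclidean_space)\<bar> \<le> C * B * (1 + norm x) powr (- (real DIM('a) + \<alpha> + 1))"
proof -
  define s where "s = real DIM('a) + \<alpha> + 1"
  define I where "I = (\<integral>z. fmaj \<alpha> (z::'a) \<partial>lborel)"
  define V where "V = (\<integral>y. indicator (cball (0::'a) r) y \<partial>lborel :: real)"
  have I: "0 \<le> I" unfolding I_def by (intro integral_nonneg_AE) simp
  have V: "0 \<le> V" unfolding V_def by (intro integral_nonneg_AE) simp
  have s: "0 < s" using \<alpha> by (simp add: s_def add_pos_pos)
  define C1 where "C1 = 2 * I * (1 + 2 * r) powr s"
  define C2 where "C2 = V * (r * (1 + 3 * s)) * 4 powr s"
  have C: "0 \<le> C1" "0 \<le> C2" using I V r s by (auto simp: C1_def C2_def)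
  show ?thesis
  proof (rule that)
    show "0 \<le> C1 + C2" using C by simp
    fix \<phi> :: "'a \<Rightarrow> 'a" and B and x :: 'a
    assume B: "blip B \<phi>" and supp: "\<And>x. r < norm x \<Longrightarrow> \<phi> x = 0" and odd: "\<And>x. \<phi> (- x) = - \<phi> x"
    have B0: "0 < B" using B by (rule blip_pos)
    have [measurable]: "\<phi> \<in> borel_measurable borel" using B by (rule blip_measurable)
    have "\<bar>fdiv \<alpha> \<phi> x\<bar> \<le> C1 * B * (1 + norm x) powr (- s) \<or> \<bar>fdiv \<alpha> \<phi> x\<bar> \<le> C2 * B * (1 + norm x) powr (- s)"
    proof (cases "norm x \<le> 2 * r")
      \<comment> \<open>Near the origin the uniform bound suffices; the decaying weight is there
        bounded below by a constant depending on r.\<close>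
      case True
      have "(1 + 2 * r) powr (- s) \<le> (1 + norm x) powr (- s)"
        using True s by (intro powr_mono2') (auto simp: add_pos_nonneg)
      then have "1 \<le> (1 + 2 * r) powr s * (1 + norm x) powr (- s)"
        using r by (simp add: powr_minus field_simps)
      from mult_left_mono[OF this, of "2 * B * I"]
      have "2 * B * I \<le> C1 * B * (1 + norm x) powr (- s)"
        using B0 I by (simp add: C1_def ac_simps)
      then show ?thesis using fdiv_bounded[OF \<alpha> B, of x] unfolding I_def by linarith
    next
      case False
      then have x: "2 * r < norm x" by simp
      define V' where "V' = (\<lambda>u::'a. fker \<alpha> u *\<^sub>R u)"
      have [measurable]: "V' \<in> borel_measurable borel" unfolding V'_def by measurable
      have \<phi>x: "\<phi> x = 0" using supp x r by simp
      have i0: "integrable lborel (\<lambda>z. fker \<alpha> z * (z \<bullet> \<phi> (x + z)))"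
        using fdiv_integrable[OF \<alpha> B, of x] by (simp add: \<phi>x)
      have f1: "fdiv \<alpha> \<phi> x = (\<integral>y. V' (y - x) \<bullet> \<phi> y \<partial>lborel)" and i1: "integrable lborel (\<lambda>y. V' (y - x) \<bullet> \<phi> y)"
        using lborel_integral_affine[of "\<lambda>z. fker \<alpha> z * (z \<bullet> \<phi> (x + z))" 1 "- x"] i0
        by (simp_all add: fdiv_def \<phi>x V'_def)
      have V'm: "V' (- u) = - V' u" for u by (simp add: V'_def)
      have e: "V' (- y - x) \<bullet> \<phi> (- y) = V' (y + x) \<bullet> \<phi> y" for y
        using V'm[of "y + x"] odd[of y] by simp
      \<comment> \<open>Replacing y by -y gives a second representation of the same value. In the
        sum of the two, the kernel enters through the difference of its values at x + y and x -
        y.\<close>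
      have f2: "fdiv \<alpha> \<phi> x = (\<integral>y. V' (y + x) \<bullet> \<phi> y \<partial>lborel)" and i2: "integrable lborel (\<lambda>y. V' (y + x) \<bullet> \<phi> y)"
        using lborel_integral_affine[of "\<lambda>y. V' (y - x) \<bullet> \<phi> y" "-1" 0] i1 f1 by (simp_all add: e)
      have "2 * fdiv \<alpha> \<phi> x = (\<integral>y. (V' (y - x) + V' (y + x)) \<bullet> \<phi> y \<partial>lborel)"
        using f1 f2 i1 i2 by (simp add: inner_add_left)
      also have "norm \<dots> \<le> (\<integral>y. (2 * r * (1 + 3 * s) * (norm x / 2) powr (- s) * B) * indicator (cball (0::'a) r) y \<partial>lborel)"
      proof (rule Bochner_Integration.integral_norm_bound_integral)
        show "integrable lborel (\<lambda>y. (V' (y - x) + V' (y + x)) \<bullet> \<phi> y)"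
          using i1 i2 by (simp add: inner_add_left)
        fix y
        show "norm ((V' (y - x) + V' (y + x)) \<bullet> \<phi> y)
            \<le> (2 * r * (1 + 3 * s) * (norm x / 2) powr (- s) * B) * indicator (cball (0::'a) r) y"
        proof (cases "norm y \<le> r")
          case y: True
          define \<rho> where "\<rho> = norm x / 2"
          have \<rho>: "0 < \<rho>" "r \<le> \<rho>" using x r by (auto simp: \<rho>_def)
          \<comment> \<open>Both points stay at distance at least |x|/2 from the singularity and
            differ by 2y, so the kernel difference is smaller than the kernel by a factor
            r/|x|.\<close>
          define a b where "a = y + x" and "b = x - y"
          have a: "\<rho> \<le> norm a" using x y norm_triangle_ineq4[of "y + x" y] by (simp add: a_def \<rho>_def)
          have b: "\<rho> \<le> norm b" "norm b \<le> 3 * \<rho>"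
            using x y norm_triangle_ineq2[of x y] norm_triangle_ineq4[of x y] by (auto simp: b_def \<rho>_def)
          have ab: "norm (a - b) \<le> 2 * r"
          proof -
            have "a - b = 2 *\<^sub>R y" by (simp add: a_def b_def scaleR_2)
            then show ?thesis using y by simp
          qed
          have fk: "fker \<alpha> u = norm u powr (- s)" for u :: 'a by (simp add: fker_def s_def)
          have "V' (y - x) + V' (y + x) = V' a - V' b" using V'm[of b] by (simp add: a_def b_def)
          also have "\<dots> = fker \<alpha> a *\<^sub>R (a - b) + (fker \<alpha> a - fker \<alpha> b) *\<^sub>R b"
            by (simp add: V'_def algebra_simps)
          also have "norm \<dots> \<le> \<rho> powr (- s) * (2 * r) + (s * \<rho> powr (- s - 1) * (2 * r)) * (3 * \<rho>)"
          proof (rule order_trans[OF norm_triangle_ineq add_mono])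
            have "fker \<alpha> a \<le> \<rho> powr (- s)" unfolding fk using \<rho> a s by (intro powr_mono2') auto
            then show "norm (fker \<alpha> a *\<^sub>R (a - b)) \<le> \<rho> powr (- s) * (2 * r)"
              using ab r by (simp add: mult_mono)
            have "\<bar>fker \<alpha> a - fker \<alpha> b\<bar> \<le> s * \<rho> powr (- s - 1) * \<bar>norm a - norm b\<bar>"
              unfolding fk using \<rho> a b s by (intro powr_neg_lipschitz) auto
            also have "\<dots> \<le> s * \<rho> powr (- s - 1) * (2 * r)"
              using ab norm_triangle_ineq3[of a b] s by (intro mult_left_mono) auto
            finally show "norm ((fker \<alpha> a - fker \<alpha> b) *\<^sub>R b) \<le> (s * \<rho> powr (- s - 1) * (2 * r)) * (3 * \<rho>)"
              unfolding norm_scaleR real_norm_def using b s r by (intro mult_mono) auto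
          qed
          also have "\<dots> = 2 * r * (1 + 3 * s) * \<rho> powr (- s)"
          proof -
            have "\<rho> powr (- s - 1) * \<rho> = \<rho> powr (- s)"
              using powr_mult_base[of \<rho> "- s - 1"] \<rho> by (simp add: mult.commute)
            then have "(s * \<rho> powr (- s - 1) * (2 * r)) * (3 * \<rho>) = s * (2 * r) * 3 * \<rho> powr (- s)"
              by (metis (no_types, opaque_lifting) mult.assoc mult.left_commute)
            then show ?thesis by (simp add: algebra_simps)
          qed
          finally have "norm (V' (y - x) + V' (y + x)) \<le> 2 * r * (1 + 3 * s) * \<rho> powr (- s)" .
          from mult_mono[OF this blip_norm[OF B, of y]]
          have "norm (V' (y - x) + V' (y + x)) * norm (\<phi> y) \<le> 2 * r * (1 + 3 * s) * \<rho> powr (- s) * B"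
            using r s by simp
          then show ?thesis
            using y order_trans[OF Cauchy_Schwarz_ineq2] by (simp add: \<rho>_def)
        qed (use supp in simp)
      qed simp
      also have "\<dots> = 2 * (V * (r * (1 + 3 * s)) * B) * (norm x / 2) powr (- s)"
        by (simp add: V_def)
      also have "\<dots> \<le> 2 * (V * (r * (1 + 3 * s)) * B) * (4 powr s * (1 + norm x) powr (- s))"
      proof (rule mult_left_mono)
        have "(norm x / 2) powr (- s) \<le> ((1 + norm x) / 4) powr (- s)"
          using x r s by (intro powr_mono2') auto
        also have "\<dots> = 4 powr s * (1 + norm x) powr (- s)"
          by (simp add: powr_divide powr_minus field_simps)
        finally show "(norm x / 2) powr (- s) \<le> 4 powr s * (1 + norm x) powr (- s)" .
      qed (use V r s B0 in auto)
      also have "\<dots> = 2 * (C2 * B * (1 + norm x) powr (- s))" by (simp only: C2_def ac_simps)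
      also have "norm (2 * fdiv \<alpha> \<phi> x) = 2 * \<bar>fdiv \<alpha> \<phi> x\<bar>" by simp
      finally show ?thesis by linarith
    qed
    moreover have "C1 * B * (1 + norm x) powr (- s) \<le> (C1 + C2) * B * (1 + norm x) powr (- s)"
      "C2 * B * (1 + norm x) powr (- s) \<le> (C1 + C2) * B * (1 + norm x) powr (- s)"
      using C B0 by (auto intro!: mult_right_mono)
    ultimately show "\<bar>fdiv \<alpha> \<phi> x\<bar> \<le> (C1 + C2) * B * (1 + norm x) powr (- (real DIM('a) + \<alpha> + 1))"
      unfolding s_def by linarith
  qed
qed

lemma fdiv_involution:
  fixes \<phi> :: "'a::euclidean_space \<Rightarrow> 'a"
  assumes "blip B \<phi>" and T: "linear T" "\<And>x. T (T x) = x" "\<And>x. norm (T x) = norm x"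
    and eqv: "\<And>x. \<phi> (T x) = T (\<phi> x)"
  shows "fdiv \<alpha> \<phi> (T x) = fdiv \<alpha> \<phi> x"
proof -
  have [measurable]: "\<phi> \<in> borel_measurable borel" using assms(1) by (rule blip_measurable)
  have ip: "T u \<bullet> T v = u \<bullet> v" for u v
    using T(3)[of "u + v"] T(3)[of u] T(3)[of v] unfolding norm_eq_sqrt_inner
    by (simp add: linear_add[OF T(1)] inner_add inner_commute)
  have "fdiv \<alpha> \<phi> (T x) = (\<integral>z. fker \<alpha> (T z) * (T z \<bullet> (\<phi> (T x + T z) - \<phi> (T x))) \<partial>lborel)"
    unfolding fdiv_def by (rule integral_involution[OF T, symmetric]) measurable
  also have "\<dots> = fdiv \<alpha> \<phi> x"
    unfolding fdiv_def
    by (simp add: linear_add[OF T(1), symmetric] linear_diff[OF T(1), symmetric] eqv ip) (simp add: fker_def T(3))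
  finally show ?thesis .
qed

text \<open>The reflection in the hyperplane orthogonal to x - y exchanges x and y. It commutes with
  \<open>sker\<close>, because \<open>smod\<close> is radial, and preserves Lebesgue
  measure.\<close>

lemma fdiv_sker_radial:
  fixes x y :: "'a::euclidean_space"
  assumes "1 / 2 \<le> q" "norm x = norm y"
  shows "fdiv \<alpha> (sker q) x = fdiv \<alpha> (sker q) y"
proof (cases "x = y")
  case False
  obtain B where B: "blip B (sker q :: 'a \<Rightarrow> 'a)" using blip_sker[OF assms(1)] by blast
  define d where "d = x - y"
  have dd: "d \<bullet> d \<noteq> 0" using False by (simp add: d_def)
  define T where "T = (\<lambda>z::'a. z - (2 * (z \<bullet> d) / (d \<bullet> d)) *\<^sub>R d)"
  have lin: "linear T" by (rule linearI) (simp_all add: T_def algebra_simps add_divide_distrib)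
  have T2: "T (T z) = z" for z using dd by (simp add: T_def algebra_simps inner_diff_left)
  have TT: "T z \<bullet> T z = z \<bullet> z" for z
    using dd by (simp add: T_def algebra_simps inner_diff_left inner_diff_right inner_commute field_simps)
  have nT: "norm (T z) = norm z" for z by (simp add: norm_eq_sqrt_inner TT)
  have "T x = y"
  proof -
    have "x \<bullet> x = y \<bullet> y" using assms(2) by (simp add: norm_eq_sqrt_inner)
    then have "2 * (x \<bullet> d) = d \<bullet> d" by (simp add: d_def inner_diff inner_commute)
    then show ?thesis using dd by (simp add: T_def) (simp add: d_def)
  qed
  moreover have "sker q (T z) = T (sker q z)" for z
    using smod_cong[OF nT] linear_scale[OF lin] by (simp add: sker_def)
  ultimately show ?thesis using fdiv_involution[OF B lin T2 nT, of x] by simp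
qed simp

end

subsection \<open>The approximate identity\<close>

text \<open>The function M of the overview. The index q with 2q = n + 1 - \<alpha> gives the kernel
  degree \<alpha> - n at infinity, and the fractional divergence lowers the degree by \<alpha>, to
  the critical value -n.\<close>

definition mker :: "real \<Rightarrow> 'a::euclidean_space \<Rightarrow> real" where
  "mker \<alpha> = fdiv \<alpha> (sker ((real DIM('a) + 1 - \<alpha>) / 2))"

context
  fixes \<alpha> :: real
  assumes \<alpha>: "0 < \<alpha>" "\<alpha> < 1"
begin

lemma mker_index: "1 / 2 \<le> (real DIM('a::euclidean_space) + 1 - \<alpha>) / 2"
proof -
  have "1 \<le> real DIM('a)" using DIM_ge_Suc0[where 'a='a] by linarith
  then have "1 \<le> real DIM('a) + 1 - \<alpha>" using \<alpha> by linarith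
  then show ?thesis by (rule divide_right_mono) simp
qed

lemma mker_bounded:
  obtains C where "0 \<le> C" "\<And>x::'a::euclidean_space. \<bar>mker \<alpha> x\<bar> \<le> C"
proof -
  obtain B where B: "blip B (sker ((real DIM('a) + 1 - \<alpha>) / 2) :: 'a \<Rightarrow> 'a)"
    using blip_sker[OF mker_index] by blast
  note b = fdiv_bounded[OF \<alpha> B]
  show ?thesis
  proof (rule that)
    show "\<bar>mker \<alpha> x\<bar> \<le> 2 * B * (\<integral>z. fmaj \<alpha> (z::'a) \<partial>lborel)" for x :: 'a
      unfolding mker_def by (rule b)
    then show "0 \<le> 2 * B * (\<integral>z. fmaj \<alpha> (z::'a) \<partial>lborel)" by (rule order_trans[OF abs_ge_zero])
  qed
qed

lemma mker_measurable [measurable]: "mker \<alpha> \<in> borel_measurable borel"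
proof -
  obtain B where B: "blip B (sker ((real DIM('a) + 1 - \<alpha>) / 2) :: 'a::euclidean_space \<Rightarrow> 'a)"
    using blip_sker[OF mker_index] by blast
  from fdiv_measurable[OF \<alpha> B] show "mker \<alpha> \<in> borel_measurable (borel :: 'a measure)" unfolding mker_def .
qed

lemma mker_radial: "norm (x::'a::euclidean_space) = norm (y::'a) \<Longrightarrow> mker \<alpha> x = mker \<alpha> y"
  unfolding mker_def by (intro fdiv_sker_radial \<alpha> mker_index)

text \<open>The normalizing power 1 - 2q = \<alpha> - n and the scaling exponent -\<alpha> of the
  divergence add up to -n, the factor of a dilation preserving the L^1 norm.\<close>

lemma fdiv_bumpf:
  fixes x :: "'a::euclidean_space"
  assumes "1 \<le> t"
  shows "fdiv \<alpha> (bumpf ((real DIM('a) + 1 - \<alpha>) / 2) t) x = mker \<alpha> x - t powr (- real DIM('a)) * mker \<alpha> (x /\<^sub>R t)"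
proof -
  define q where "q = (real DIM('a) + 1 - \<alpha>) / 2"
  obtain B where B: "blip B (sker q :: 'a \<Rightarrow> 'a)"
    unfolding q_def using blip_sker[OF mker_index] by blast
  have q: "1 - 2 * q = \<alpha> - real DIM('a)" unfolding q_def by (simp add: field_simps)
  have le: "\<bar>t powr (1 - 2 * q)\<bar> \<le> 1"
    using powr_mono[of "1 - 2 * q" 0 t] assms mker_index[where 'a='a] unfolding q_def by auto
  have "fdiv \<alpha> (bumpf q t) x = fdiv \<alpha> (sker q) x - t powr (1 - 2 * q) * (t powr (- \<alpha>) * fdiv \<alpha> (sker q) (x /\<^sub>R t))"
    unfolding bumpf_def[abs_def]
    using fdiv_diff[OF \<alpha> B blip_scale[OF blip_dilate[OF B assms] le]] assms
      fdiv_dilate[OF \<alpha> B, of t x] by (simp add: fdiv_scaleR[OF \<alpha>])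
  also have "t powr (1 - 2 * q) * (t powr (- \<alpha>) * fdiv \<alpha> (sker q) (x /\<^sub>R t)) = t powr (- real DIM('a)) * fdiv \<alpha> (sker q) (x /\<^sub>R t)"
    unfolding q mult.assoc[symmetric] powr_add[symmetric] by simp
  finally show ?thesis unfolding q_def mker_def .
qed

text \<open>The left side is the divergence of an odd field. Restricting t to [1, 2] gives all these
  fields support in radius 2 and one bounded-Lipschitz constant, so the decay estimate for odd
  fields is uniform in t.\<close>

lemma mker_almost_homogeneous:
  obtains C where "0 \<le> C" "\<And>(x::'a::euclidean_space) t. 1 \<le> t \<Longrightarrow> t \<le> 2 \<Longrightarrow>
    \<bar>mker \<alpha> x - t powr (- real DIM('a)) * mker \<alpha> (x /\<^sub>R t)\<bar> \<le> C * (1 + norm x) powr (- (real DIM('a) + \<alpha> + 1))"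
proof -
  define q where "q = (real DIM('a) + 1 - \<alpha>) / 2"
  have q: "1 / 2 \<le> q" unfolding q_def by (rule mker_index)
  obtain B where B: "blip B (sker q :: 'a \<Rightarrow> 'a)" using blip_sker[OF q] by blast
  obtain C where C: "0 \<le> C" "\<And>\<phi> B x. blip B \<phi> \<Longrightarrow> (\<And>x. 2 < norm x \<Longrightarrow> \<phi> x = 0) \<Longrightarrow>
    (\<And>x. \<phi> (- x) = - \<phi> x) \<Longrightarrow>
    \<bar>fdiv \<alpha> \<phi> (x::'a)\<bar> \<le> C * B * (1 + norm x) powr (- (real DIM('a) + \<alpha> + 1))"
    using fdiv_odd_decay[OF \<alpha>, of 2] by auto
  show ?thesis
  proof (rule that)
    show "0 \<le> C * (2 * B)" using C(1) blip_pos[OF B] by simp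
    fix x :: 'a and t :: real assume t: "1 \<le> t" "t \<le> 2"
    have "\<bar>fdiv \<alpha> (bumpf q t) x\<bar> \<le> C * (2 * B) * (1 + norm x) powr (- (real DIM('a) + \<alpha> + 1))"
    proof (rule C(2)[OF blip_bumpf[OF B t(1) q]])
      show "bumpf q t y = 0" if "2 < norm y" for y :: 'a using bumpf_zero[of t y q] t that by simp
    qed (rule bumpf_minus)
    then show "\<bar>mker \<alpha> x - t powr (- real DIM('a)) * mker \<alpha> (x /\<^sub>R t)\<bar>
        \<le> C * (2 * B) * (1 + norm x) powr (- (real DIM('a) + \<alpha> + 1))"
      unfolding fdiv_bumpf[OF t(1), symmetric] q_def .
  qed
qed

text \<open>This is the pairing with b = 1, whose increments vanish identically.\<close>

lemma mker_difference_integral: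
  shows "integrable lborel (\<lambda>x::'a::euclidean_space. mker \<alpha> x - 2 powr (- real DIM('a)) * mker \<alpha> (x /\<^sub>R 2))"
    and "(\<integral>(x::'a). mker \<alpha> x - 2 powr (- real DIM('a)) * mker \<alpha> (x /\<^sub>R 2) \<partial>lborel) = 0"
proof -
  define q where "q = (real DIM('a) + 1 - \<alpha>) / 2"
  have q: "1 / 2 \<le> q" unfolding q_def by (rule mker_index)
  obtain B where B: "blip B (sker q :: 'a \<Rightarrow> 'a)" using blip_sker[OF q] by blast
  note p = fdiv_pairing[OF \<alpha> blip_bumpf[OF B _ q, of 2], of 2 "\<lambda>_. 1" 1]
  have z: "2 < norm x \<Longrightarrow> bumpf q 2 x = 0" for x :: 'a using bumpf_zero[of 2 x q] by simp
  show "integrable lborel (\<lambda>x::'a. mker \<alpha> x - 2 powr (- real DIM('a)) * mker \<alpha> (x /\<^sub>R 2))"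
    using p(1) z fdiv_bumpf[of 2, where 'a='a] unfolding q_def by simp
  show "(\<integral>(x::'a). mker \<alpha> x - 2 powr (- real DIM('a)) * mker \<alpha> (x /\<^sub>R 2) \<partial>lborel) = 0"
    using p(3) z fdiv_bumpf[of 2, where 'a='a] unfolding q_def by simp
qed

text \<open>By almost homogeneity and radial symmetry, \<open>mker\<close> behaves like a multiple of \<open>\<bar>x\<bar>\<^sup>-\<^sup>n\<close> at
  infinity. The multiple vanishes because the dyadic difference of \<open>mker\<close> has integral zero: its
  integral over a large ball is the integral of \<open>mker\<close> over a dyadic annulus.\<close>

lemma mker_decay:
  obtains C where "0 \<le> C" "\<And>x::'a::euclidean_space. \<bar>mker \<alpha> x\<bar> \<le> C * (1 + norm x) powr (- (real DIM('a) + 1))"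
proof -
  define n where "n = real DIM('a)"
  have n: "1 \<le> n" using DIM_ge_Suc0[where 'a='a] by (simp add: n_def)
  define \<omega> where "\<omega> = unit_ball_vol n"
  have \<omega>: "0 < \<omega>" unfolding \<omega>_def using n by (intro unit_ball_vol_pos) simp
  obtain C where C: "0 \<le> C" "\<And>(x::'a) t. 1 \<le> t \<Longrightarrow> t \<le> 2 \<Longrightarrow>
    \<bar>mker \<alpha> x - t powr (- n) * mker \<alpha> (x /\<^sub>R t)\<bar> \<le> C * (1 + norm x) powr (- (n + \<alpha> + 1))"
    unfolding n_def using mker_almost_homogeneous by blast
  obtain C0 where C0: "0 \<le> C0" "\<And>x::'a. \<bar>mker \<alpha> x\<bar> \<le> C0" using mker_bounded by blast
  define m where "m = (\<lambda>x::'a. mker \<alpha> x - 2 powr (- n) * mker \<alpha> (x /\<^sub>R 2))"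
  have m_int: "integrable lborel m" and m0: "(\<integral>x. m x \<partial>lborel) = 0"
    unfolding m_def n_def using mker_difference_integral by auto
  define I1 where "I1 = (\<integral>y. (1 + norm (y::'a)) powr (- (n + \<alpha>)) \<partial>lborel)"
  have i1: "integrable lborel (\<lambda>y::'a. (1 + norm y) powr (- (n + \<alpha>)))"
    using \<alpha> integrable_norm_powr_outside(2)[of "n + \<alpha>", where 'a='a] by (simp add: n_def)
  have I1: "0 \<le> I1" unfolding I1_def by (intro integral_nonneg_AE) simp
  \<comment> \<open>The first summand is the homogeneity defect on the annulus, the second the
    integral over the annulus divided by half the volume of the ball.\<close>
  define C' where "C' = 2 powr n * C + 2 * C * I1 / \<omega>"
  have C'0: "0 \<le> C'" using C I1 \<omega> by (simp add: C'_def)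
  have main: "\<bar>mker \<alpha> x\<bar> \<le> C' * norm x powr (- (n + 1))" if x1: "1 \<le> norm x" for x :: 'a
  proof -
    define r where "r = norm x"
    have r: "1 \<le> r" using x1 by (simp add: r_def)
    let ?I = "\<lambda>r. indicator (cball (0::'a) r) :: 'a \<Rightarrow> real"
    have iM: "integrable lborel (\<lambda>y. ?I \<rho> y * mker \<alpha> y)" for \<rho>
    proof (rule Bochner_Integration.integrable_bound)
      show "integrable lborel (\<lambda>y. C0 * ?I \<rho> y)" by simp
      show "AE y in lborel. norm (?I \<rho> y * mker \<alpha> y) \<le> norm (C0 * ?I \<rho> y)"
        using C0 by (auto simp: indicator_def)
    qed measurable
    \<comment> \<open>An L^1 dilation by 2 turns the ball of radius r into that of radius r/2, so
      integrating the dyadic difference over a ball leaves the annulus between these radii.\<close>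
    have half: "(\<integral>y. ?I r y * (2 powr (- n) * mker \<alpha> (y /\<^sub>R 2)) \<partial>lborel) = (\<integral>y. ?I (r / 2) y * mker \<alpha> y \<partial>lborel)"
      and ih: "integrable lborel (\<lambda>y. ?I r y * (2 powr (- n) * mker \<alpha> (y /\<^sub>R 2)))"
    proof -
      have e: "?I r (2 *\<^sub>R y) = ?I (r / 2) y" for y by (simp add: indicator_def)
      have p: "2 ^ DIM('a) * 2 powr (- n) = (1::real)" by (simp add: n_def powr_minus powr_realpow)
      show "(\<integral>y. ?I r y * (2 powr (- n) * mker \<alpha> (y /\<^sub>R 2)) \<partial>lborel) = (\<integral>y. ?I (r / 2) y * mker \<alpha> y \<partial>lborel)"
        using lborel_integral_affine(1)[of "\<lambda>y. ?I r y * (2 powr (- n) * mker \<alpha> (y /\<^sub>R 2))" 2 0] p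
        by (simp add: e mult.left_commute[of _ "2 powr (- n)"]) (simp add: mult.assoc[symmetric] mult.commute[of "2 powr _"])
      show "integrable lborel (\<lambda>y. ?I r y * (2 powr (- n) * mker \<alpha> (y /\<^sub>R 2)))"
        using lborel_integral_affine(2)[of "\<lambda>y. ?I r y * (2 powr (- n) * mker \<alpha> (y /\<^sub>R 2))" 2 0] iM[of "r / 2"]
        by (simp add: e mult.left_commute[of _ "2 powr (- n)"])
    qed
    define A where "A = (\<lambda>y. ?I r y - ?I (r / 2) y)"
    have A01: "A y = (if r / 2 < norm y \<and> norm y \<le> r then 1 else 0)" for y
      using r by (auto simp: A_def indicator_def)
    have iA: "integrable lborel A" unfolding A_def by simp
    have ann: "(\<integral>y. A y * mker \<alpha> y \<partial>lborel) = (\<integral>y. ?I r y * m y \<partial>lborel)"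
      using iM[of r] iM[of "r / 2"] half ih by (simp add: A_def m_def left_diff_distrib right_diff_distrib)
    \<comment> \<open>Total integral zero converts the integral over the ball into one over its
      complement. There one power of the decay of order n + \<alpha> + 1 is traded for 1/r and the
      rest is still integrable.\<close>
    have far: "\<bar>\<integral>y. ?I r y * m y \<partial>lborel\<bar> \<le> C * I1 / r"
    proof -
      have iIm: "integrable lborel (\<lambda>y. ?I r y * m y)"
        using integrable_mult_indicator[of "cball 0 r" lborel m] m_int by simp
      have "(\<integral>y. ?I r y * m y \<partial>lborel) = - (\<integral>y. m y - ?I r y * m y \<partial>lborel)"
        using m_int iIm m0 by simp
      moreover have "norm (\<integral>y. m y - ?I r y * m y \<partial>lborel) \<le> (\<integral>y. C / r * (1 + norm (y::'a)) powr (- (n + \<alpha>)) \<partial>lborel)"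
      proof (rule Bochner_Integration.integral_norm_bound_integral)
        show "integrable lborel (\<lambda>y::'a. C / r * (1 + norm y) powr (- (n + \<alpha>)))" using i1 by simp
        show "integrable lborel (\<lambda>y. m y - ?I r y * m y)" using m_int iIm by simp
        fix y :: 'a
        show "norm (m y - ?I r y * m y) \<le> C / r * (1 + norm y) powr (- (n + \<alpha>))"
        proof (cases "norm y \<le> r")
          case False
          have "\<bar>m y\<bar> \<le> C * (1 + norm y) powr (- (n + \<alpha> + 1))" using C(2)[of 2 y] by (simp add: m_def)
          also have "(1 + norm y) powr (- (n + \<alpha> + 1)) = (1 + norm y) powr (- (n + \<alpha>)) / (1 + norm y)"
          proof -
            have e: "- (n + \<alpha> + 1) = - (n + \<alpha>) - 1" by simp
            have "0 < 1 + norm y" by (simp add: add_pos_nonneg)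
            then show ?thesis unfolding e by (simp only: powr_diff powr_one_gt_zero_iff[THEN iffD2])
          qed
          also have "C * ((1 + norm y) powr (- (n + \<alpha>)) / (1 + norm y)) \<le> C * ((1 + norm y) powr (- (n + \<alpha>)) / r)"
            using False r C(1) by (intro mult_left_mono divide_left_mono) auto
          finally show ?thesis using False by simp
        qed (use C(1) r in simp)
      qed
      ultimately show ?thesis by (simp add: I1_def)
    qed
    define \<delta> where "\<delta> = 2 powr n * C * r powr (- (n + 1))"
    define \<sigma> where "\<sigma> = (if mker \<alpha> x \<ge> 0 then 1 else - 1 :: real)"
    have \<sigma>: "\<sigma> * mker \<alpha> x = \<bar>mker \<alpha> x\<bar>" "\<bar>\<sigma>\<bar> = 1" by (auto simp: \<sigma>_def)
    \<comment> \<open>With t = r/|y| in [1, 2], the point t y has the norm of x, so radial symmetry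
      and almost homogeneity give t^n M(x) = M(y) up to \<delta>. As t^n \<ge> 1, M keeps the sign
      of M(x) on the annulus up to \<delta>, and no cancellation hides its size.\<close>
    have low: "A y * (\<bar>mker \<alpha> x\<bar> - \<delta>) \<le> \<sigma> * (A y * mker \<alpha> y)" for y
    proof (cases "r / 2 < norm y \<and> norm y \<le> r")
      case True
      define t where "t = r / norm y"
      have y0: "0 < norm y" using True r by linarith
      have t: "1 \<le> t" "t \<le> 2" using True y0 by (auto simp: t_def field_simps)
      have "norm (t *\<^sub>R y) = norm x" using y0 r by (simp add: t_def r_def)
      then have Mx: "mker \<alpha> (t *\<^sub>R y) = mker \<alpha> x" by (rule mker_radial)
      have "\<bar>mker \<alpha> x - t powr (- n) * mker \<alpha> y\<bar> \<le> C * (1 + r) powr (- (n + \<alpha> + 1))"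
        using C(2)[of t "t *\<^sub>R y"] t y0 Mx r by (simp add: t_def)
      then have "t powr n * \<bar>mker \<alpha> x - t powr (- n) * mker \<alpha> y\<bar> \<le> 2 powr n * (C * r powr (- (n + 1)))"
      proof (intro mult_mono)
        show "t powr n \<le> 2 powr n" using t n by (intro powr_mono2) auto
        assume "\<bar>mker \<alpha> x - t powr (- n) * mker \<alpha> y\<bar> \<le> C * (1 + r) powr (- (n + \<alpha> + 1))"
        also have "(1 + r) powr (- (n + \<alpha> + 1)) \<le> (1 + r) powr (- (n + 1))"
          using r \<alpha> by (intro powr_mono) auto
        also have "(1 + r) powr (- (n + 1)) \<le> r powr (- (n + 1))" using r n by (intro powr_mono2') auto
        finally show "\<bar>mker \<alpha> x - t powr (- n) * mker \<alpha> y\<bar> \<le> C * r powr (- (n + 1))"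
          using C(1) by (simp add: mult_left_mono)
      qed auto
      also have "t powr n * \<bar>mker \<alpha> x - t powr (- n) * mker \<alpha> y\<bar> = \<bar>t powr n * mker \<alpha> x - mker \<alpha> y\<bar>"
      proof -
        have "t powr n * (mker \<alpha> x - t powr (- n) * mker \<alpha> y) = t powr n * mker \<alpha> x - mker \<alpha> y"
          using t by (simp add: powr_minus field_simps)
        then show ?thesis by (metis abs_mult abs_of_nonneg powr_ge_zero)
      qed
      finally have d: "\<bar>t powr n * mker \<alpha> x - mker \<alpha> y\<bar> \<le> \<delta>" by (simp add: \<delta>_def mult.assoc)
      have "1 \<le> t powr n" using t n by (simp add: ge_one_powr_ge_zero)
      then have "\<bar>mker \<alpha> x\<bar> \<le> t powr n * \<bar>mker \<alpha> x\<bar>" using mult_right_mono[of 1 "t powr n" "\<bar>mker \<alpha> x\<bar>"] by simp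
      also have "\<dots> = \<sigma> * (t powr n * mker \<alpha> x)" using \<sigma>(1) by (simp add: mult.left_commute)
      also have "\<dots> \<le> \<sigma> * mker \<alpha> y + \<delta>"
        using d by (cases "mker \<alpha> x \<ge> 0") (auto simp: \<sigma>_def)
      finally show ?thesis using True by (simp add: A01)
    next
      case False
      then show ?thesis by (simp only: A01 if_False)
    qed
    have "(\<integral>y. A y * (\<bar>mker \<alpha> x\<bar> - \<delta>) \<partial>lborel) \<le> (\<integral>y. \<sigma> * (A y * mker \<alpha> y) \<partial>lborel)"
    proof (rule integral_mono[OF _ _ low])
      show "integrable lborel (\<lambda>y. A y * (\<bar>mker \<alpha> x\<bar> - \<delta>))" using iA by simp
      show "integrable lborel (\<lambda>y. \<sigma> * (A y * mker \<alpha> y))"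
        using iM[of r] iM[of "r / 2"] by (simp add: A_def left_diff_distrib)
    qed
    also have "\<dots> \<le> C * I1 / r"
      using far ann \<sigma>(2) by (simp add: \<sigma>_def abs_if split: if_splits)
    finally have a: "(\<integral>y. A y \<partial>lborel) * (\<bar>mker \<alpha> x\<bar> - \<delta>) \<le> C * I1 / r" by simp
    have vol: "(\<integral>y. ?I \<rho> y \<partial>lborel) = \<omega> * \<rho> ^ DIM('a)" if "0 \<le> \<rho>" for \<rho>
      using content_cball[OF that, of "0::'a"] by (simp add: \<omega>_def n_def)
    have "(\<integral>y. A y \<partial>lborel) = \<omega> * r ^ DIM('a) - \<omega> * (r / 2) ^ DIM('a)"
      using r vol[of r] vol[of "r / 2"] unfolding A_def by (subst Bochner_Integration.integral_diff) auto
    also have "\<dots> = \<omega> * r ^ DIM('a) * (1 - (1 / 2) ^ DIM('a))" by (simp add: power_divide field_simps)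
    also have "\<dots> \<ge> \<omega> * r ^ DIM('a) * (1 / 2)"
    proof (rule mult_left_mono)
      have "(1 / 2) ^ DIM('a) \<le> (1 / 2 :: real) ^ 1" by (intro power_decreasing) (auto simp: Suc_leI)
      then show "1 / 2 \<le> 1 - (1 / 2 :: real) ^ DIM('a)" by simp
    qed (use \<omega> r in simp)
    finally have a_low: "\<omega> * r powr n / 2 \<le> (\<integral>y. A y \<partial>lborel)" using r by (simp add: n_def powr_realpow)
    have wr: "0 < \<omega> * r powr n / 2" using \<omega> r by simp
    have "\<bar>mker \<alpha> x\<bar> - \<delta> \<le> (C * I1 / r) / (\<omega> * r powr n / 2)"
    proof (cases "\<bar>mker \<alpha> x\<bar> - \<delta> \<le> 0")
      case True
      have "0 \<le> (C * I1 / r) / (\<omega> * r powr n / 2)" using C I1 r \<omega> by simp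
      with True show ?thesis by linarith
    next
      case False
      then have "(\<omega> * r powr n / 2) * (\<bar>mker \<alpha> x\<bar> - \<delta>) \<le> (\<integral>y. A y \<partial>lborel) * (\<bar>mker \<alpha> x\<bar> - \<delta>)"
        using a_low by (intro mult_right_mono) auto
      with a have "(\<omega> * r powr n / 2) * (\<bar>mker \<alpha> x\<bar> - \<delta>) \<le> C * I1 / r" by linarith
      then show ?thesis unfolding pos_le_divide_eq[OF wr] by (simp only: mult.commute)
    qed
    also have "(C * I1 / r) / (\<omega> * r powr n / 2) = 2 * C * I1 / \<omega> * r powr (- (n + 1))"
    proof -
      have "r powr (- (n + 1)) = 1 / (r powr n * r)"
        unfolding powr_minus powr_add using r by (simp add: divide_inverse)
      then show ?thesis by (simp add: ac_simps)
    qed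
    finally show ?thesis unfolding C'_def \<delta>_def r_def by (simp add: distrib_right)
  qed
  show ?thesis
  proof (rule that[of "(C0 + C') * 2 powr (n + 1)"])
    show "0 \<le> (C0 + C') * 2 powr (n + 1)" using C0 C'0 by simp
    fix x :: 'a
    have "((1 + norm x) / 2) powr (- s) = 2 powr s * (1 + norm x) powr (- s)" for s
      by (simp add: powr_divide powr_minus field_simps)
    note half = this[of "n + 1"]
    have "\<bar>mker \<alpha> x\<bar> \<le> (C0 + C') * ((1 + norm x) / 2) powr (- (n + 1))"
    proof (cases "1 \<le> norm x")
      case True
      have "norm x powr (- (n + 1)) \<le> ((1 + norm x) / 2) powr (- (n + 1))"
        using True n by (intro powr_mono2') auto
      then have "C' * norm x powr (- (n + 1)) \<le> (C0 + C') * ((1 + norm x) / 2) powr (- (n + 1))"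
        using C0 C'0 by (intro mult_mono) auto
      then show ?thesis using main[OF True] by linarith
    next
      case False
      have "1 powr (- (n + 1)) \<le> ((1 + norm x) / 2) powr (- (n + 1))"
        using False n by (intro powr_mono2') (auto simp: add_pos_nonneg)
      then have "C0 * 1 \<le> (C0 + C') * ((1 + norm x) / 2) powr (- (n + 1))"
        using C0 C'0 by (intro mult_mono) auto
      then show ?thesis using C0(2)[of x] by linarith
    qed
    then show "\<bar>mker \<alpha> x\<bar> \<le> (C0 + C') * 2 powr (n + 1) * (1 + norm x) powr (- (real DIM('a) + 1))"
      unfolding half by (simp add: n_def mult.assoc)
  qed
qed

lemma mker_integrable: "integrable lborel (mker \<alpha> :: 'a::euclidean_space \<Rightarrow> real)"
proof -
  obtain C where C: "0 \<le> C" "\<And>x::'a. \<bar>mker \<alpha> x\<bar> \<le> C * (1 + norm x) powr (- (real DIM('a) + 1))"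
    using mker_decay by blast
  show ?thesis
  proof (rule Bochner_Integration.integrable_bound)
    show "integrable lborel (\<lambda>x::'a. C * (1 + norm x) powr (- (real DIM('a) + 1)))"
      by (intro integrable_mult_right integrable_norm_powr_outside(2)) simp
    show "AE x in lborel. norm (mker \<alpha> (x::'a)) \<le> norm (C * (1 + norm x) powr (- (real DIM('a) + 1)))"
      using C by (auto intro!: AE_I2)
  qed measurable
qed

text \<open>Testing against a radially decreasing function shows that the integral is positive.\<close>

lemma mker_integral_pos: "0 < (\<integral>(x::'a::euclidean_space). mker \<alpha> x \<partial>lborel)"
proof -
  define n where "n = real DIM('a)"
  define q where "q = (real DIM('a) + 1 - \<alpha>) / 2"
  have q: "1 / 2 \<le> q" unfolding q_def by (rule mker_index)
  obtain B where B: "blip B (sker q :: 'a \<Rightarrow> 'a)" using blip_sker[OF q] by blast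
  define \<Theta> where "\<Theta> = (bumpf q 2 :: 'a \<Rightarrow> 'a)"
  have \<Theta>B: "blip (2 * B) \<Theta>" unfolding \<Theta>_def by (rule blip_bumpf[OF B _ q]) simp
  have [measurable]: "\<Theta> \<in> borel_measurable borel" by (rule blip_measurable[OF \<Theta>B])
  have \<Theta>0: "2 < norm x \<Longrightarrow> \<Theta> x = 0" for x unfolding \<Theta>_def by (rule bumpf_zero) auto
  have \<Theta>m: "\<Theta> (- x) = - \<Theta> x" for x unfolding \<Theta>_def by (rule bumpf_minus)
  have "\<exists>\<theta>\<ge>0. \<Theta> x = \<theta> *\<^sub>R x \<and> (norm x < 2 \<longrightarrow> 0 < \<theta>)" for x
    unfolding \<Theta>_def using bumpf_half[of q x] q by simp
  then obtain \<theta> where \<theta>: "\<And>x. 0 \<le> \<theta> x" "\<And>x. \<Theta> x = \<theta> x *\<^sub>R x" "\<And>x. norm x < 2 \<Longrightarrow> 0 < \<theta> x" by metis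
  \<comment> \<open>This family is radially decreasing, is mapped to itself by dilation (b at 2x is
    b with parameter 2 \<epsilon>), tends to 1 as \<epsilon> tends to 0 and, off the origin, to 0 as
    \<epsilon> grows.\<close>
  define b where "b = (\<lambda>\<epsilon>. \<lambda>x::'a. (1 + \<epsilon> * norm x) powr (- (1::real)))"
  have b_meas[measurable]: "b \<epsilon> \<in> borel_measurable borel" for \<epsilon> unfolding b_def by measurable
  have b1: "\<bar>b \<epsilon> x\<bar> \<le> 1" if "0 \<le> \<epsilon>" for \<epsilon> x
  proof -
    have "b \<epsilon> x \<le> 1 powr (- 1)" unfolding b_def using that by (intro powr_mono2') auto
    then show ?thesis by (simp add: b_def)
  qed
  have b_anti: "b \<epsilon> v \<le> b \<epsilon> u" if "0 < \<epsilon>" "norm u \<le> norm v" for \<epsilon> u v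
  proof -
    have "1 + \<epsilon> * norm u \<le> 1 + \<epsilon> * norm v" using that by simp
    moreover have "0 < 1 + \<epsilon> * norm u" using that by (intro add_pos_nonneg) auto
    ultimately show ?thesis unfolding b_def by (intro powr_mono2') auto
  qed
  define Q where "Q = (\<lambda>\<epsilon> z. \<integral>x. (b \<epsilon> (x - z) - b \<epsilon> x) * (z \<bullet> \<Theta> x) \<partial>lborel)"
  \<comment> \<open>As b is even and \<Theta> odd, the unshifted term integrates to zero and the
    shifts by z and -z give opposite values. Averaging them produces an integrand of one
    sign.\<close>
  have Q: "Q \<epsilon> z = (\<integral>x. (b \<epsilon> (x - z) - b \<epsilon> (x + z)) * (z \<bullet> \<Theta> x) \<partial>lborel) / 2"
    and iQ: "integrable lborel (\<lambda>x. (b \<epsilon> (x - z) - b \<epsilon> (x + z)) * (z \<bullet> \<Theta> x))" if e: "0 < \<epsilon>" for \<epsilon> z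
  proof -
    have int: "integrable lborel (\<lambda>x. c x * (z \<bullet> \<Theta> x))"
      if [measurable]: "c \<in> borel_measurable borel" and c: "\<And>x. \<bar>c x\<bar> \<le> 2" for c
    proof (rule Bochner_Integration.integrable_bound)
      show "integrable lborel (\<lambda>x. 2 * (norm z * (2 * B)) * indicator (cball (0::'a) 2) x)" by simp
      show "AE x in lborel. norm (c x * (z \<bullet> \<Theta> x)) \<le> norm (2 * (norm z * (2 * B)) * indicator (cball 0 2) x :: real)"
      proof (rule AE_I2)
        fix x
        have "\<bar>z \<bullet> \<Theta> x\<bar> \<le> norm z * (2 * B)"
          by (rule order_trans[OF Cauchy_Schwarz_ineq2 mult_left_mono[OF blip_norm[OF \<Theta>B]]]) simp
        then have "\<bar>c x\<bar> * \<bar>z \<bullet> \<Theta> x\<bar> \<le> 2 * (norm z * (2 * B))" using c by (intro mult_mono) auto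
        then show "norm (c x * (z \<bullet> \<Theta> x)) \<le> norm (2 * (norm z * (2 * B)) * indicator (cball 0 2) x :: real)"
          using \<Theta>0[of x] blip_pos[OF B] by (auto simp: indicator_def abs_mult)
      qed
    qed measurable
    have b2: "\<bar>b \<epsilon> x\<bar> \<le> 2" for x using b1[of \<epsilon> x] e by simp
    have i0: "integrable lborel (\<lambda>x. b \<epsilon> x * (z \<bullet> \<Theta> x))" by (rule int) (use b2 in auto)
    have i1: "integrable lborel (\<lambda>x. b \<epsilon> (x - z) * (z \<bullet> \<Theta> x))" by (rule int) (use b2 in auto)
    have i2: "integrable lborel (\<lambda>x. b \<epsilon> (x + z) * (z \<bullet> \<Theta> x))" by (rule int) (use b2 in auto)
    have "(\<integral>x. b \<epsilon> x * (z \<bullet> \<Theta> x) \<partial>lborel) = 0"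
      by (rule integral_odd[OF \<alpha>]) (simp_all add: \<Theta>m, simp add: b_def)
    then have q1: "Q \<epsilon> z = (\<integral>x. b \<epsilon> (x - z) * (z \<bullet> \<Theta> x) \<partial>lborel)"
      unfolding Q_def using i0 i1 by (simp add: left_diff_distrib)
    have "b \<epsilon> (- x - z) = b \<epsilon> (x + z)" for x
      using norm_minus_cancel[of "x + z"] by (simp add: b_def)
    then have q2: "Q \<epsilon> z = - (\<integral>x. b \<epsilon> (x + z) * (z \<bullet> \<Theta> x) \<partial>lborel)"
      unfolding q1 using lborel_integral_affine(1)[of "\<lambda>x. b \<epsilon> (x - z) * (z \<bullet> \<Theta> x)" "-1" 0] by (simp add: \<Theta>m)
    show "integrable lborel (\<lambda>x. (b \<epsilon> (x - z) - b \<epsilon> (x + z)) * (z \<bullet> \<Theta> x))"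
      using i1 i2 by (simp add: left_diff_distrib)
    show "Q \<epsilon> z = (\<integral>x. (b \<epsilon> (x - z) - b \<epsilon> (x + z)) * (z \<bullet> \<Theta> x) \<partial>lborel) / 2"
      using q1 q2 i1 i2 by (simp add: left_diff_distrib)
  qed
  \<comment> \<open>|x + z|^2 - |x - z|^2 = 4 z . x, so the decrease of b makes the difference of b
    agree in sign with z . x, and \<Theta> is a nonnegative multiple of x.\<close>
  have sgn: "0 \<le> (b \<epsilon> (x - z) - b \<epsilon> (x + z)) * (z \<bullet> \<Theta> x)" if e: "0 < \<epsilon>" for \<epsilon> x z
  proof -
    have nn: "(norm (x + z))\<^sup>2 - (norm (x - z))\<^sup>2 = 4 * (z \<bullet> x)"
      unfolding power2_norm_eq_inner by (simp add: inner_add inner_diff inner_commute)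
    show ?thesis
    proof (cases "0 \<le> z \<bullet> x")
      case True
      then have "norm (x - z) \<le> norm (x + z)" using nn by (intro power2_le_imp_le[OF _ norm_ge_zero]) linarith
      then have "b \<epsilon> (x + z) \<le> b \<epsilon> (x - z)" by (rule b_anti[OF e])
      then show ?thesis using True \<theta>(1)[of x] by (simp add: \<theta>(2))
    next
      case False
      then have "norm (x + z) \<le> norm (x - z)" using nn by (intro power2_le_imp_le[OF _ norm_ge_zero]) linarith
      then have "b \<epsilon> (x - z) \<le> b \<epsilon> (x + z)" by (rule b_anti[OF e])
      then show ?thesis using False \<theta>(1)[of x] by (simp add: \<theta>(2) mult_nonpos_nonpos mult_nonneg_nonpos)
    qed
  qed
  define I where "I = (\<lambda>\<epsilon>. \<integral>x. b \<epsilon> x * fdiv \<alpha> \<Theta> x \<partial>lborel)"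
  have Ieq: "I \<epsilon> = (\<integral>z. fker \<alpha> z * Q \<epsilon> z \<partial>lborel)" and Iint: "integrable lborel (\<lambda>z. fker \<alpha> z * Q \<epsilon> z)"
    if e: "0 < \<epsilon>" for \<epsilon>
    unfolding I_def Q_def
    by (rule fdiv_pairing(3)[OF \<alpha> \<Theta>B \<Theta>0 b_meas b1], use e in auto)
      (rule fdiv_pairing(2)[OF \<alpha> \<Theta>B \<Theta>0 b_meas b1], use e in auto)
  have Q0: "0 \<le> Q \<epsilon> z" if "0 < \<epsilon>" for \<epsilon> z
    unfolding Q[OF that] using sgn[OF that] by (simp add: integral_nonneg_AE)
  have I0: "0 \<le> I \<epsilon>" if "0 < \<epsilon>" for \<epsilon>
    unfolding Ieq[OF that] by (intro integral_nonneg_AE AE_I2 mult_nonneg_nonneg Q0 that fker_nonneg)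
  have "I 1 \<noteq> 0"
  proof
    assume "I 1 = 0"
    then have "AE z in lborel. fker \<alpha> z * Q 1 z = 0"
      using integral_nonneg_eq_0_iff_AE[OF Iint[of 1]] Q0[of 1] by (simp add: Ieq)
    moreover have "AE z in lborel. z \<noteq> (0::'a)"
      by (rule AE_lborel_singleton)
    ultimately have "AE z in lborel. z \<noteq> (0::'a) \<and> fker \<alpha> z * Q 1 z = 0" by eventually_elim simp
    moreover have "ae_filter (lborel :: 'a measure) \<noteq> bot" by (simp add: ae_filter_eq_bot_iff)
    ultimately obtain z :: 'a where z: "z \<noteq> 0" "fker \<alpha> z * Q 1 z = 0" using eventually_happens' by blast
    then have "Q 1 z = 0" by (simp add: fker_def)
    then have "AE x in lborel. (b 1 (x - z) - b 1 (x + z)) * (z \<bullet> \<Theta> x) = 0"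
      using integral_nonneg_eq_0_iff_AE[OF iQ[of 1 z]] sgn[of 1] by (simp add: Q)
    \<comment> \<open>On this nonempty open half ball the integrand is strictly positive, so it
      cannot vanish almost everywhere.\<close>
    moreover define U where "U = {x. 0 < z \<bullet> x} \<inter> ball 0 2"
    have pos: "(b 1 (x - z) - b 1 (x + z)) * (z \<bullet> \<Theta> x) \<noteq> 0" if "x \<in> U" for x
    proof -
      have zx: "0 < z \<bullet> x" "norm x < 2" using that by (auto simp: U_def)
      have nn: "(norm (x + z))\<^sup>2 - (norm (x - z))\<^sup>2 = 4 * (z \<bullet> x)"
        unfolding power2_norm_eq_inner by (simp add: inner_add inner_diff inner_commute)
      then have "norm (x - z) < norm (x + z)" using zx by (intro power2_less_imp_less[OF _ norm_ge_zero]) linarith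
      moreover have "0 < 1 + 1 * norm (x - z)" by (intro add_pos_nonneg) auto
      ultimately have "b 1 (x + z) < b 1 (x - z)" unfolding b_def
        by (intro powr_less_mono2_neg) auto
      then show ?thesis using zx \<theta>(3)[of x] by (simp add: \<theta>(2))
    qed
    ultimately have "AE x in lborel. x \<notin> U" by (auto elim: eventually_mono)
    moreover have "open U" unfolding U_def by (intro open_Int open_halfspace_gt open_ball)
    ultimately have "U \<in> null_sets lborel" using AE_iff_null_sets[of U lborel] borel_open[of U] by auto
    then have "negligible U" using null_sets_completionI negligible_iff_null_sets by blast
    moreover have "z /\<^sub>R norm z \<in> U" using z(1) by (simp add: U_def)
    ultimately show False using open_not_negligible[OF \<open>open U\<close>] by blast
  qed
  then have I1: "0 < I 1" using I0[of 1] by simp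
  define N where "N = (\<lambda>\<epsilon>. \<integral>(x::'a). b \<epsilon> x * mker \<alpha> x \<partial>lborel)"
  have iN: "integrable lborel (\<lambda>x::'a. b \<epsilon> x * mker \<alpha> x)" if "0 \<le> \<epsilon>" for \<epsilon>
  proof (rule Bochner_Integration.integrable_bound[OF mker_integrable])
    show "AE x in lborel. norm (b \<epsilon> x * mker \<alpha> x) \<le> norm (mker \<alpha> x)"
      using mult_right_mono[OF b1[OF that] abs_ge_zero] by (auto simp: abs_mult)
  qed measurable
  \<comment> \<open>The dilation behaviour of b makes the pairings telescope over \<epsilon> = 2^k,
    k any integer: the total mass is at least N(1), and 0, the limit for large \<epsilon>, is at
    most N(1) - I(1).\<close>
  have NI: "N \<epsilon> - N (2 * \<epsilon>) = I \<epsilon>" if e: "0 < \<epsilon>" for \<epsilon>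
  proof -
    have p: "2 ^ DIM('a) * 2 powr (- n) = (1::real)" by (simp add: n_def powr_minus powr_realpow)
    have bb: "b \<epsilon> (2 *\<^sub>R x) = b (2 * \<epsilon>) x" for x by (simp add: b_def ac_simps)
    have 1: "(\<integral>(x::'a). b \<epsilon> x * (2 powr (- n) * mker \<alpha> (x /\<^sub>R 2)) \<partial>lborel) = N (2 * \<epsilon>)"
      using lborel_integral_affine(1)[of "\<lambda>x::'a. b \<epsilon> x * (2 powr (- n) * mker \<alpha> (x /\<^sub>R 2))" 2 0] p
      by (simp add: N_def bb mult.left_commute[of _ "2 powr (- n)"]) (simp add: mult.assoc[symmetric] mult.commute[of "2 powr _"])
    have 2: "integrable lborel (\<lambda>x::'a. b \<epsilon> x * (2 powr (- n) * mker \<alpha> (x /\<^sub>R 2)))"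
      using lborel_integral_affine(2)[of "\<lambda>x::'a. b \<epsilon> x * (2 powr (- n) * mker \<alpha> (x /\<^sub>R 2))" 2 0] iN[of "2 * \<epsilon>"] e
      by (simp add: bb mult.left_commute[of _ "2 powr (- n)"])
    have f: "fdiv \<alpha> \<Theta> x = mker \<alpha> x - 2 powr (- n) * mker \<alpha> (x /\<^sub>R 2)" for x
      unfolding \<Theta>_def q_def n_def by (rule fdiv_bumpf) simp
    show ?thesis unfolding I_def f right_diff_distrib
      using 1 2 iN[of \<epsilon>] e by (simp add: N_def)
  qed
  have mono: "N (2 ^ k) \<le> N 1 - I 1" if "1 \<le> k" for k
    using that
  proof (induction k rule: dec_induct)
    case base then show ?case using NI[of 1] by simp
  next
    case (step k) then show ?case using NI[of "2 ^ k"] I0[of "2 ^ k"] by simp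
  qed
  have mono': "N 1 \<le> N ((1 / 2) ^ k)" for k
  proof (induction k)
    case (Suc k) then show ?case using NI[of "(1 / 2) ^ Suc k"] I0[of "(1 / 2) ^ Suc k"] by simp
  qed simp
  have "(\<lambda>k. N (2 ^ k)) \<longlonglongrightarrow> (\<integral>(x::'a). 0 \<partial>lborel)"
    unfolding N_def
  proof (rule integral_dominated_convergence)
    show "integrable lborel (\<lambda>x::'a. norm (mker \<alpha> x))" using mker_integrable by (rule integrable_norm)
    show "AE x in lborel. (\<lambda>k. b (2 ^ k) x * mker \<alpha> x) \<longlonglongrightarrow> 0"
      using AE_lborel_singleton[of "0::'a"]
    proof eventually_elim
      fix x :: 'a assume "x \<noteq> 0"
      then have x: "0 < norm x" by simp
      have "(\<lambda>k. (1 + 2 ^ k * norm x) powr (- 1)) \<longlonglongrightarrow> 0"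
      proof (rule Lim_null_comparison)
        show "(\<lambda>k. (1 / norm x) * (1 / 2) ^ k) \<longlonglongrightarrow> 0"
          by (intro tendsto_mult_right_zero LIMSEQ_power_zero) simp
        show "\<forall>\<^sub>F k in sequentially. norm ((1 + 2 ^ k * norm x) powr (- 1)) \<le> (1 / norm x) * (1 / 2) ^ k"
        proof (intro always_eventually allI)
          fix k :: nat
          have "inverse (1 + 2 ^ k * norm x) \<le> inverse (2 ^ k * norm x)"
            using x by (intro le_imp_inverse_le) auto
          moreover have "0 < 1 + 2 ^ k * norm x" using x by (intro add_pos_pos) auto
          ultimately show "norm ((1 + 2 ^ k * norm x) powr (- 1)) \<le> (1 / norm x) * (1 / 2) ^ k"
            using x by (simp add: powr_minus power_divide field_simps)
        qed
      qed
      then show "(\<lambda>k. b (2 ^ k) x * mker \<alpha> x) \<longlonglongrightarrow> 0"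
        unfolding b_def by (rule tendsto_mult_left_zero)
    qed
    show "AE x in lborel. norm (b (2 ^ k) x * mker \<alpha> x) \<le> norm (mker \<alpha> x)" for k
      using mult_right_mono[OF b1 abs_ge_zero, of "2 ^ k"] by (auto simp: abs_mult)
  qed measurable
  then have a: "0 \<le> N 1 - I 1"
    using mono by (intro LIMSEQ_le_const2[of "\<lambda>k. N (2 ^ k)"]) auto
  have "(\<lambda>k. N ((1 / 2) ^ k)) \<longlonglongrightarrow> (\<integral>(x::'a). mker \<alpha> x \<partial>lborel)"
    unfolding N_def
  proof (rule integral_dominated_convergence)
    show "integrable lborel (\<lambda>x::'a. norm (mker \<alpha> x))" using mker_integrable by (rule integrable_norm)
    show "AE x in lborel. (\<lambda>k. b ((1 / 2) ^ k) x * mker \<alpha> x) \<longlonglongrightarrow> mker \<alpha> x"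
    proof (rule AE_I2)
      fix x :: 'a
      have "(\<lambda>k. (1 + (1 / 2) ^ k * norm x) powr (- 1)) \<longlonglongrightarrow> (1 + 0 * norm x) powr (- 1)"
        by (intro tendsto_intros LIMSEQ_power_zero) auto
      then have "(\<lambda>k. (1 + (1 / 2) ^ k * norm x) powr (- 1)) \<longlonglongrightarrow> 1" by simp
      from tendsto_mult_right[OF this, of "mker \<alpha> x"]
      show "(\<lambda>k. b ((1 / 2) ^ k) x * mker \<alpha> x) \<longlonglongrightarrow> mker \<alpha> x" by (simp add: b_def)
    qed
    show "AE x in lborel. norm (b ((1 / 2) ^ k) x * mker \<alpha> x) \<le> norm (mker \<alpha> x)" for k
      using mult_right_mono[OF b1 abs_ge_zero, of "(1 / 2) ^ k"] by (auto simp: abs_mult)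
  qed measurable
  then have "N 1 \<le> (\<integral>(x::'a). mker \<alpha> x \<partial>lborel)"
    using mono' by (intro LIMSEQ_le_const[of "\<lambda>k. N ((1 / 2) ^ k)"]) auto
  with a I1 show ?thesis by linarith
qed

end

subsection \<open>Dimension at least two\<close>

lemma norm_powr_ball_integral:
  assumes "0 < R" "0 \<le> s" "s < real DIM('a)"
  shows "integrable lborel (\<lambda>x::'a::euclidean_space. indicator (cball 0 R) x * norm x powr (- s))"
    and "(\<integral>(x::'a). indicator (cball 0 R) x * norm x powr (- s) \<partial>lborel) =
      R powr (real DIM('a) - s) * (\<integral>(x::'a). indicator (cball 0 1) x * norm x powr (- s) \<partial>lborel)"
proof -
  let ?f = "\<lambda>x::'a. indicator (cball 0 R) x * norm x powr (- s)"
  let ?g = "\<lambda>x::'a. indicator (cball 0 1) x * norm x powr (- s)"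
  have e: "?f (0 + R *\<^sub>R x) = R powr (- s) * ?g x" for x
    using assms(1) by (auto simp: indicator_def powr_mult)
  have i: "integrable lborel ?g" using assms by (intro integrable_norm_powr_inside) auto
  show "integrable lborel ?f"
    using lborel_integral_affine(2)[of ?f R 0] i assms(1) unfolding e by simp
  have "(\<integral>x. ?f x \<partial>lborel) = R ^ DIM('a) * (R powr (- s) * (\<integral>x. ?g x \<partial>lborel))"
    using lborel_integral_affine(1)[of ?f R 0] assms(1) unfolding e by simp
  also have "\<dots> = R powr (real DIM('a) - s) * (\<integral>x. ?g x \<partial>lborel)"
    using assms(1) by (simp add: powr_diff powr_minus powr_realpow divide_inverse)
  finally show "(\<integral>x. ?f x \<partial>lborel) = R powr (real DIM('a) - s) * (\<integral>x. ?g x \<partial>lborel)" .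
qed

text \<open>The normalization makes the fractional divergence of \<open>scaled \<alpha> t \<Theta>\<close> the \<open>L\<^sup>1\<close>-dilate of that of \<open>\<Theta>\<close>.\<close>

definition scaled :: "real \<Rightarrow> real \<Rightarrow> ('a::euclidean_space \<Rightarrow> 'a) \<Rightarrow> 'a \<Rightarrow> 'a" where
  "scaled \<alpha> t \<Theta> z = t powr (\<alpha> - real DIM('a)) *\<^sub>R \<Theta> (z /\<^sub>R t)"

text \<open>Convolution of g with the L^1 dilate of \<open>mker\<close> at scale t. The kernel is
  not normalized, so the limit for small t is g times the integral of \<open>mker\<close>.\<close>

definition appr :: "real \<Rightarrow> ('a::euclidean_space \<Rightarrow> real) \<Rightarrow> real \<Rightarrow> 'a \<Rightarrow> real" where
  "appr \<alpha> g t x = (\<integral>w. g w * (t powr (- real DIM('a)) * mker \<alpha> ((x - w) /\<^sub>R t)) \<partial>lborel)"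

context
  fixes \<alpha> :: real
  assumes \<alpha>: "0 < \<alpha>" "\<alpha> < 1"
begin

text \<open>A divergence-free test field with a prescribed value at the origin exists only in dimension at
  least two: a combination of planar curls of the functions \<open>(y \<bullet> b) \<zeta>(y)\<close>, \<open>\<zeta>\<close> a radial bump.\<close>

lemma curl_field:
  assumes dim: "2 \<le> DIM('a::euclidean_space)"
  obtains \<psi> :: "'a \<Rightarrow> 'a::euclidean_space \<Rightarrow> 'a" and L where "0 \<le> L" "\<And>a. \<psi> a \<in> Cc_infinity" "\<And>a x. fdiv \<alpha> (\<psi> a) x = 0"
    "\<And>a y. 2 < norm y \<Longrightarrow> \<psi> a y = 0" "\<And>a y. norm (\<psi> a y - a) \<le> L * norm a * norm y"
proof -
  \<comment> \<open>The factor exp(1/4) cancels \<open>flat 0 4\<close>, so that \<zeta> is 1 at the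
    origin.\<close>
  define \<zeta> where "\<zeta> = (\<lambda>y::'a. exp (1 / 4) * flat 0 (4 - (norm y)\<^sup>2))"
  have \<zeta>C: "class_C k \<zeta>" for k
    unfolding \<zeta>_def by (intro class_C_mult class_C_const class_C_flat class_C_diff class_C_norm_sq)
  have \<zeta>0: "\<zeta> 0 = 1" by (simp add: \<zeta>_def flat_def exp_add[symmetric])
  have \<zeta>out: "\<zeta> y = 0" if "2 < norm y" for y
  proof -
    have "2\<^sup>2 \<le> (norm y)\<^sup>2" using that by (intro power_mono) auto
    then show ?thesis by (simp add: \<zeta>_def flat_eq_0)
  qed
  define H where "H = (\<lambda>b y::'a. (y \<bullet> b) * \<zeta> y)"
  have HC: "H b \<in> Cc_infinity" for b
    unfolding H_def using \<zeta>out
    by (intro Cc_infinityI[where r=2] class_C_mult class_C_inner class_C_ident class_C_const \<zeta>C) auto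
  have "\<exists>D. (\<forall>y. (H b has_derivative D y) (at y)) \<and> (\<forall>v. (\<lambda>y. D y v) \<in> Cc_infinity) \<and>
      (\<forall>y. 2 < norm y \<longrightarrow> D y = (\<lambda>v. 0))" for b
  proof -
    obtain D where D: "\<And>x. (H b has_derivative D x) (at x)" "\<And>v. (\<lambda>x. D x v) \<in> Cc_infinity"
      "\<And>x r. (\<And>y. r < norm y \<Longrightarrow> H b y = 0) \<Longrightarrow> r < norm x \<Longrightarrow> D x = (\<lambda>v. 0)"
      using Cc_infinity_derivative[OF HC[of b]] by metis
    have "D y = (\<lambda>v. 0)" if "2 < norm y" for y
      using D(3)[of 2 y] \<zeta>out that by (simp add: H_def)
    with D(1,2) show ?thesis by blast
  qed
  then obtain D where D: "\<And>b y. (H b has_derivative D b y) (at y)" "\<And>b v. (\<lambda>y. D b y v) \<in> Cc_infinity"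
    "\<And>b y. 2 < norm y \<Longrightarrow> D b y = (\<lambda>v. 0)" by metis
  have D0: "D b 0 v = v \<bullet> b" for b v
  proof -
    obtain D\<zeta> where "(\<zeta> has_derivative D\<zeta>) (at 0)" using \<zeta>C[of 1] class_C_SucE[of 0 \<zeta>] by (metis One_nat_def)
    then have "(H b has_derivative (\<lambda>v. (0 \<bullet> b) * D\<zeta> v + (v \<bullet> b) * \<zeta> 0)) (at 0)"
      unfolding H_def by (intro has_derivative_mult) (auto intro!: derivative_eq_intros)
    from has_derivative_unique[OF D(1) this] show ?thesis by (simp add: \<zeta>0 fun_eq_iff)
  qed
  have "\<exists>L. 0 < L \<and> (\<forall>x y v. norm (D b x v - D b y v) \<le> L * norm (x - y) * norm v)" for b
    using Cc_infinity_derivative_lipschitz[OF D(1,2), of b] by metis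
  then obtain L where L: "\<And>b. 0 < L b" "\<And>b x y v. norm (D b x v - D b y v) \<le> L b * norm (x - y) * norm v"
    by metis
  \<comment> \<open>At the origin the curl for the basis vector b equals a - (a . b) b; summed over
    the basis this is (n - 1) a. Dividing by n - 1 is where the dimension condition enters.\<close>
  define N where "N = real DIM('a) - 1"
  have N: "0 < N" using dim by (simp add: N_def)
  define \<psi> where "\<psi> = (\<lambda>a y. inverse N *\<^sub>R (\<Sum>b\<in>Basis. D b y b *\<^sub>R a - D b y a *\<^sub>R b))"
  have curlC: "(\<lambda>y. D b y b *\<^sub>R a - D b y a *\<^sub>R b) \<in> Cc_infinity" for a b
    by (intro Cc_infinity_diff Cc_infinity_linear[OF bounded_linear_scaleR_left] D)
  have \<psi>0: "\<psi> a 0 = a" for a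
  proof -
    have "(\<Sum>b\<in>Basis. D b 0 b *\<^sub>R a - D b 0 a *\<^sub>R b) = (\<Sum>b\<in>(Basis::'a set). a - (a \<bullet> b) *\<^sub>R b)"
      by (intro sum.cong) (auto simp: D0)
    also have "\<dots> = real DIM('a) *\<^sub>R a - a"
      by (simp add: sum_subtractf euclidean_representation sum_constant_scaleR)
    also have "\<dots> = N *\<^sub>R a" by (simp add: N_def algebra_simps)
    finally show ?thesis using N by (simp add: \<psi>_def)
  qed
  show ?thesis
  proof (rule that)
    show "\<psi> a \<in> Cc_infinity" for a
      unfolding \<psi>_def by (intro Cc_infinity_linear[OF bounded_linear_scaleR_right] Cc_infinity_sum curlC)
    show "fdiv \<alpha> (\<psi> a) x = 0" for a x
    proof -
      have "\<forall>b. \<exists>B. blip B (\<lambda>y. D b y b *\<^sub>R a - D b y a *\<^sub>R b)" using Cc_infinity_blip[OF curlC] by metis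
      then obtain B where "\<And>b. blip (B b) (\<lambda>y. D b y b *\<^sub>R a - D b y a *\<^sub>R b)" by metis
      then show ?thesis
        unfolding \<psi>_def by (simp add: fdiv_scaleR[OF \<alpha>] fdiv_sum[OF \<alpha>, where B=B] fdiv_curl[OF \<alpha> HC D(1,2)])
    qed
    show "\<psi> a y = 0" if "2 < norm y" for a y using D(3)[OF that] by (simp add: \<psi>_def)
    define L' where "L' = inverse N * (\<Sum>b\<in>Basis. 2 * L b)"
    show "0 \<le> L'" unfolding L'_def using N L(1) by (intro mult_nonneg_nonneg sum_nonneg) (auto intro: less_imp_le)
    show "norm (\<psi> a y - a) \<le> L' * norm a * norm y" for a y
    proof -
      have "\<psi> a y - a = \<psi> a y - \<psi> a 0" by (simp add: \<psi>0)
      also have "\<dots> = inverse N *\<^sub>R (\<Sum>b\<in>Basis. (D b y b - D b 0 b) *\<^sub>R a - (D b y a - D b 0 a) *\<^sub>R b)"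
        unfolding \<psi>_def scaleR_diff_right[symmetric] sum_subtractf[symmetric]
        by (intro arg_cong2[where f=scaleR] sum.cong refl) (simp add: algebra_simps)
      also have "norm \<dots> \<le> inverse N * (\<Sum>b\<in>(Basis::'a set). 2 * L b * norm a * norm y)"
        unfolding norm_scaleR
      proof (intro mult_mono sum_norm_le)
        fix b :: 'a assume b: "b \<in> Basis"
        have "norm ((D b y b - D b 0 b) *\<^sub>R a - (D b y a - D b 0 a) *\<^sub>R b) \<le>
            \<bar>D b y b - D b 0 b\<bar> * norm a + \<bar>D b y a - D b 0 a\<bar> * norm b"
          by (rule order_trans[OF norm_triangle_ineq4]) simp
        also have "\<dots> \<le> (L b * norm y * 1) * norm a + (L b * norm y * norm a) * 1"
          using L(2)[of b y b 0] L(2)[of b y a 0] b by (intro add_mono mult_mono) auto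
        finally show "norm ((D b y b - D b 0 b) *\<^sub>R a - (D b y a - D b 0 a) *\<^sub>R b) \<le> 2 * L b * norm a * norm y"
          by (simp add: ac_simps)
      qed (use N in auto)
      finally show ?thesis by (simp add: L'_def sum_distrib_right sum_distrib_left mult.assoc)
    qed
  qed
qed

text \<open>For |y| < 4t the Lipschitz bounds of the piece and of \<psi>, equal at the origin, gain
  |y|/t. For |y| \<ge> 4t, \<psi> has already vanished, and only points w with |w| \<ge> |y|/2
  contribute, where |g| is at most a multiple of |y|^(-\<alpha>). The constant depends on g only
  through the pointwise bound by |x|^(-\<alpha>).\<close>

lemma scale_piece_bound:
  fixes \<psi> :: "'a::euclidean_space \<Rightarrow> 'a \<Rightarrow> 'a" and \<Theta> :: "'a \<Rightarrow> 'a"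
  assumes \<Theta>: "blip B \<Theta>" "\<And>x. 2 < norm x \<Longrightarrow> \<Theta> x = 0"
    and \<psi>: "0 \<le> L" "\<And>a y. 2 < norm y \<Longrightarrow> \<psi> a y = 0" "\<And>a y. norm (\<psi> a y - a) \<le> L * norm a * norm y"
  obtains C where "0 \<le> C" "\<And>g t y. \<lbrakk>integrable lborel g; \<And>x. \<bar>g x\<bar> \<le> norm x powr (- \<alpha>); 0 < t\<rbrakk> \<Longrightarrow>
    norm (conv g (scaled \<alpha> t \<Theta>) y - \<psi> (conv g (scaled \<alpha> t \<Theta>) 0) (y /\<^sub>R t)) \<le>
    C * (if norm y < 4 * t then norm y / t else (t / norm y) powr \<alpha>)"
proof -
  define n where "n = real DIM('a)"
  have n: "1 \<le> n" using DIM_ge_Suc0[where 'a='a] by (simp add: n_def)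
  define W where "W = (\<integral>(x::'a). indicator (cball 0 1) x * norm x powr (- \<alpha>) \<partial>lborel)"
  have W: "0 \<le> W" unfolding W_def by (intro integral_nonneg_AE) simp
  define V where "V = measure lborel (cball (0::'a) 1)"
  have B: "0 < B" using \<Theta>(1) by (rule blip_pos)
  \<comment> \<open>6 = 4 + 2: for |y| < 4t both \<Theta>-terms vanish for |w| > 6t.
    \<open>C2\<close> bounds the value at the origin, where radius 2t suffices, and
    \<open>C3\<close> belongs to |y| \<ge> 4t.\<close>
  define C1 where "C1 = 6 powr (n - \<alpha>) * W * B"
  define C2 where "C2 = 2 powr (n - \<alpha>) * W * B"
  define C3 where "C3 = 2 powr \<alpha> * B * (2 ^ DIM('a) * V)"
  have C: "0 \<le> C1" "0 \<le> C2" "0 \<le> C3" using W B by (auto simp: C1_def C2_def C3_def V_def)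
  show ?thesis
  proof (rule that)
    show C0: "0 \<le> C1 + L * C2 + C3" using C \<psi>(1) by simp
    fix g :: "'a \<Rightarrow> real" and t :: real and y :: 'a
    assume g: "integrable lborel g" and gb: "\<And>x. \<bar>g x\<bar> \<le> norm x powr (- \<alpha>)" and t: "0 < t"
    let ?\<Theta> = "scaled \<alpha> t \<Theta>"
    define c where "c = t powr (\<alpha> - n)"
    have c: "0 < c" using t by (simp add: c_def)
    have [measurable]: "\<Theta> \<in> borel_measurable borel" by (rule blip_measurable[OF \<Theta>(1)])
    have \<Theta>m: "?\<Theta> \<in> borel_measurable borel" unfolding scaled_def[abs_def] by measurable
    have \<Theta>t: "norm (?\<Theta> z) \<le> c * B" for z
      using blip_norm[OF \<Theta>(1), of "z /\<^sub>R t"] c by (simp add: scaled_def c_def n_def mult_left_mono)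
    have \<Theta>z: "?\<Theta> z = 0" if "2 * t < norm z" for z
      using \<Theta>(2)[of "z /\<^sub>R t"] that t by (simp add: scaled_def field_simps)
    have \<Theta>l: "norm (?\<Theta> u - ?\<Theta> v) \<le> c * B * norm (u - v) / t" for u v
    proof -
      have "norm (?\<Theta> u - ?\<Theta> v) = c * norm (\<Theta> (u /\<^sub>R t) - \<Theta> (v /\<^sub>R t))"
        using c by (simp add: scaled_def c_def n_def scaleR_diff_right[symmetric])
      also have "\<dots> \<le> c * (B * norm (u /\<^sub>R t - v /\<^sub>R t))" using c blip_diff[OF \<Theta>(1)] by (intro mult_left_mono) auto
      also have "norm (u /\<^sub>R t - v /\<^sub>R t) = norm (u - v) / t"
        unfolding scaleR_diff_right[symmetric] using t by (simp add: divide_inverse mult.commute)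
      finally show ?thesis by simp
    qed
    note ci = conv_integrable[OF g \<Theta>m \<Theta>t]
    \<comment> \<open>The weight |w|^(-\<alpha>) has mass R^(n-\<alpha>) W on the ball of radius R.
      For R a multiple of t this cancels the normalization t^(\<alpha>-n) of the scaled
      field.\<close>
    have est: "norm (\<integral>w. g w *\<^sub>R F w \<partial>lborel) \<le> k * (R powr (n - \<alpha>) * W)"
      if i: "integrable lborel (\<lambda>w. g w *\<^sub>R F w)" and F: "\<And>w. norm (F w) \<le> k" "\<And>w. R < norm w \<Longrightarrow> F w = 0"
        and R: "0 < R" for F :: "'a \<Rightarrow> 'a" and k R
    proof -
      have k: "0 \<le> k" using F(1)[of 0] by (rule order_trans[OF norm_ge_zero])
      have an: "\<alpha> < real DIM('a)" using \<alpha> n unfolding n_def by linarith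
      note J = norm_powr_ball_integral[OF R less_imp_le[OF \<alpha>(1)] an]
      have "norm (\<integral>w. g w *\<^sub>R F w \<partial>lborel) \<le> (\<integral>w. k * (indicator (cball (0::'a) R) w * norm w powr (- \<alpha>)) \<partial>lborel)"
      proof (rule Bochner_Integration.integral_norm_bound_integral[OF i])
        show "integrable lborel (\<lambda>w. k * (indicator (cball (0::'a) R) w * norm w powr (- \<alpha>)))"
          using J(1) by (rule integrable_mult_right)
        show "norm (g w *\<^sub>R F w) \<le> k * (indicator (cball (0::'a) R) w * norm w powr (- \<alpha>))" for w
          using mult_mono[OF gb F(1), of w w] F(2)[of w] k by (cases "R < norm w") (auto simp: mult.commute)
      qed
      also have "\<dots> = k * (R powr (n - \<alpha>) * W)" using J(2) by (simp add: W_def n_def)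
      finally show ?thesis .
    qed
    have a0: "norm (conv g ?\<Theta> 0) \<le> C2"
    proof -
      have "norm (conv g ?\<Theta> 0) \<le> c * B * ((2 * t) powr (n - \<alpha>) * W)"
        unfolding conv_def by (rule est[OF ci \<Theta>t]) (use \<Theta>z t in auto)
      also have "\<dots> = C2 * (c * t powr (n - \<alpha>))" using t by (simp add: C2_def powr_mult)
      also have "c * t powr (n - \<alpha>) = 1" using t by (simp add: c_def powr_add[symmetric])
      finally show ?thesis by simp
    qed
    show "norm (conv g ?\<Theta> y - \<psi> (conv g ?\<Theta> 0) (y /\<^sub>R t)) \<le>
        (C1 + L * C2 + C3) * (if norm y < 4 * t then norm y / t else (t / norm y) powr \<alpha>)"
    proof (cases "norm y < 4 * t")
      case True
      have d: "conv g ?\<Theta> y - conv g ?\<Theta> 0 = (\<integral>w. g w *\<^sub>R (?\<Theta> (y - w) - ?\<Theta> (0 - w)) \<partial>lborel)"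
        unfolding conv_def scaleR_diff_right
        by (rule Bochner_Integration.integral_diff[OF ci ci, symmetric])
      have "norm (conv g ?\<Theta> y - conv g ?\<Theta> 0) \<le> (c * B * norm y / t) * ((6 * t) powr (n - \<alpha>) * W)"
        unfolding d
      proof (rule est)
        show "integrable lborel (\<lambda>w. g w *\<^sub>R (?\<Theta> (y - w) - ?\<Theta> (0 - w)))"
          unfolding scaleR_diff_right by (rule Bochner_Integration.integrable_diff[OF ci ci])
        show "norm (?\<Theta> (y - w) - ?\<Theta> (0 - w)) \<le> c * B * norm y / t" for w
          using \<Theta>l[of "y - w" "0 - w"] by simp
        show "?\<Theta> (y - w) - ?\<Theta> (0 - w) = 0" if "6 * t < norm w" for w
          using \<Theta>z[of "y - w"] \<Theta>z[of "0 - w"] that True t norm_triangle_ineq2[of w y]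
          by (simp add: norm_minus_commute)
      qed (use t in simp)
      also have "\<dots> = C1 * (c * t powr (n - \<alpha>)) * (norm y / t)" using t by (simp add: C1_def powr_mult)
      also have "c * t powr (n - \<alpha>) = 1" using t by (simp add: c_def powr_add[symmetric])
      finally have 1: "norm (conv g ?\<Theta> y - conv g ?\<Theta> 0) \<le> C1 * (norm y / t)" by simp
      have "norm (conv g ?\<Theta> 0 - \<psi> (conv g ?\<Theta> 0) (y /\<^sub>R t)) \<le> L * norm (conv g ?\<Theta> 0) * norm (y /\<^sub>R t)"
        using \<psi>(3)[of "conv g ?\<Theta> 0" "y /\<^sub>R t"] by (simp add: norm_minus_commute)
      also have "\<dots> \<le> L * C2 * (norm y / t)"
        using a0 \<psi>(1) t C(2) by (intro mult_mono mult_nonneg_nonneg) (auto simp: divide_inverse mult.commute)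
      finally have "norm (conv g ?\<Theta> y - \<psi> (conv g ?\<Theta> 0) (y /\<^sub>R t)) \<le> C1 * (norm y / t) + L * C2 * (norm y / t)"
        using 1 norm_triangle_ineq[of "conv g ?\<Theta> y - conv g ?\<Theta> 0" "conv g ?\<Theta> 0 - \<psi> (conv g ?\<Theta> 0) (y /\<^sub>R t)"] by simp
      moreover have "0 \<le> C3 * (norm y / t)" using C t by simp
      ultimately show ?thesis using True by (simp only: distrib_right if_True)
    next
      case False
      then have y: "4 * t \<le> norm y" by simp
      have "\<psi> (conv g ?\<Theta> 0) (y /\<^sub>R t) = 0" using y t by (intro \<psi>(2)) (simp add: field_simps)
      moreover have "norm (conv g ?\<Theta> y) \<le> C3 * (t / norm y) powr \<alpha>"
      proof -
        let ?k = "(norm y / 2) powr (- \<alpha>) * (c * B)"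
        have "norm (conv g ?\<Theta> y) \<le> (\<integral>w. ?k * indicator (cball y (2 * t)) w \<partial>lborel)"
          unfolding conv_def
        proof (rule Bochner_Integration.integral_norm_bound_integral[OF ci])
          show "integrable lborel (\<lambda>w. ?k * indicator (cball y (2 * t)) w :: real)" by simp
          show "norm (g w *\<^sub>R ?\<Theta> (y - w)) \<le> ?k * indicator (cball y (2 * t)) w" for w
          proof (cases "norm (y - w) \<le> 2 * t")
            case True
            have "norm y / 2 \<le> norm w" using True y norm_triangle_ineq2[of y "y - w"] by simp
            then have "norm w powr (- \<alpha>) \<le> (norm y / 2) powr (- \<alpha>)"
              using y t \<alpha> by (intro powr_mono2') auto
            then have "\<bar>g w\<bar> * norm (?\<Theta> (y - w)) \<le> ?k" using gb[of w] \<Theta>t[of "y - w"] by (intro mult_mono) auto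
            then show ?thesis using True by (simp add: dist_norm)
          qed (use \<Theta>z[of "y - w"] in \<open>simp add: dist_norm\<close>)
        qed
        also have "\<dots> = ?k * measure lborel (cball y (2 * t))" by simp
        also have "measure lborel (cball y (2 * t)) = (2 * t) ^ DIM('a) * V"
          using t by (simp add: V_def content_cball)
        also have "?k * ((2 * t) ^ DIM('a) * V) = C3 * ((c * t ^ DIM('a)) * norm y powr (- \<alpha>))"
          using y t by (simp add: C3_def powr_divide power_mult_distrib powr_minus field_simps)
        also have "c * t ^ DIM('a) = t powr \<alpha>"
          using t by (simp add: c_def n_def powr_realpow[symmetric] powr_add[symmetric])
        also have "t powr \<alpha> * norm y powr (- \<alpha>) = (t / norm y) powr \<alpha>"
          by (subst powr_divide) (use t in \<open>auto simp: powr_minus divide_inverse\<close>)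
        finally show ?thesis .
      qed
      moreover have "C3 * (t / norm y) powr \<alpha> \<le> (C1 + L * C2 + C3) * (t / norm y) powr \<alpha>"
        using C \<psi>(1) by (intro mult_right_mono) auto
      ultimately show ?thesis using False by simp
    qed
  qed
qed

text \<open>Two geometric series meet at the scale t = r/4. They are summed by two capped monotone
  sequences: T drops by exactly r/t while t > r/4, and U grows by (2^\<alpha> - 1)(t/r)^\<alpha>
  before. The caps 8 and 1 bound the total whatever \<open>N\<close> and \<epsilon> are.\<close>

lemma dyadic_telescope:
  fixes r \<epsilon> :: real
  assumes r: "0 \<le> r" and \<epsilon>: "0 < \<epsilon>"
  shows "(\<Sum>i<N. if r < 4 * (\<epsilon> * 2 ^ i) then r / (\<epsilon> * 2 ^ i) else ((\<epsilon> * 2 ^ i) / r) powr \<alpha>) \<le> 8 + 1 / (2 powr \<alpha> - 1)"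
proof -
  define t where "t = (\<lambda>i. \<epsilon> * 2 ^ i)"
  have t: "0 < t i" "t (Suc i) = 2 * t i" for i using \<epsilon> by (auto simp: t_def)
  define T where "T = (\<lambda>i. min 8 (2 * r / t i))"
  define U where "U = (\<lambda>i. min 1 ((t i / r) powr \<alpha>))"
  define k where "k = 2 powr \<alpha> - 1"
  have k: "0 < k" unfolding k_def using \<alpha> powr_less_mono[of 0 \<alpha> 2] by simp
  have "(if r < 4 * t i then r / t i else (t i / r) powr \<alpha>) \<le> (T i - T (Suc i)) + (U (Suc i) - U i) / k" for i
  proof -
    have T: "T (Suc i) = min 8 (r / t i)" by (simp add: T_def t(2))
    have T0: "T (Suc i) \<le> T i"
      unfolding T using r t(1)[of i] by (simp add: T_def min_le_iff_disj divide_right_mono)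
    have U1: "(t (Suc i) / r) powr \<alpha> = 2 powr \<alpha> * (t i / r) powr \<alpha>"
      using t(1)[of i] r by (simp add: t(2) powr_mult[symmetric])
    have "1 \<le> 2 powr \<alpha>" using k by (simp add: k_def)
    then have "(t i / r) powr \<alpha> \<le> (t (Suc i) / r) powr \<alpha>"
      unfolding U1 by (metis mult_right_mono mult_1 powr_ge_zero)
    then have U0: "U i \<le> U (Suc i)" by (auto simp: U_def)
    show ?thesis
    proof (cases "r < 4 * t i")
      case True
      then have "r / t i < 4" using t(1)[of i] by (simp add: divide_less_eq)
      then have "T i = 2 * (r / t i)" "T (Suc i) = r / t i" unfolding T by (simp_all add: T_def)
      then have "T i - T (Suc i) = r / t i" by simp
      moreover have "0 \<le> (U (Suc i) - U i) / k" using U0 k by simp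
      ultimately show ?thesis using True by simp
    next
      case False
      then have r0: "0 < r" using t(1)[of i] by linarith
      have le: "t i / r \<le> 1" "t (Suc i) / r \<le> 1" using False r0 t(1)[of i] by (auto simp: t(2) divide_le_eq)
      have "(t i / r) powr \<alpha> \<le> 1" "(t (Suc i) / r) powr \<alpha> \<le> 1"
        using le r0 t(1)[of i] t(1)[of "Suc i"] \<alpha> by (auto intro!: powr_le1)
      then have "U (Suc i) - U i = k * (t i / r) powr \<alpha>" unfolding U_def using U1 by (simp add: k_def left_diff_distrib)
      then have "(U (Suc i) - U i) / k = (t i / r) powr \<alpha>" using k by simp
      then show ?thesis using False T0 by simp
    qed
  qed
  then have "(\<Sum>i<N. if r < 4 * t i then r / t i else (t i / r) powr \<alpha>)
      \<le> (\<Sum>i<N. (T i - T (Suc i)) + (U (Suc i) - U i) / k)"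
    by (rule sum_mono)
  also have "\<dots> = (T 0 - T N) + (U N - U 0) / k"
    by (simp add: sum.distrib sum_divide_distrib[symmetric] sum_lessThan_telescope sum_lessThan_telescope')
  also have "\<dots> \<le> 8 + 1 / k"
  proof -
    have "T 0 \<le> 8" "0 \<le> T N" using r t(1)[of N] by (simp_all add: T_def)
    then have "T 0 - T N \<le> 8" by linarith
    moreover have "U N \<le> 1" "0 \<le> U 0" by (simp_all add: U_def)
    then have "U N - U 0 \<le> 1" by linarith
    ultimately show ?thesis using k by (intro add_mono divide_right_mono) auto
  qed
  finally show ?thesis unfolding t_def k_def .
qed

text \<open>Dyadic pieces are summed, each corrected by the divergence-free field with its value at
  the origin. The corrections make the sup norm bounded and leave the divergence alone, which
  telescopes to the two extreme scales. That C precedes g, \<rho>, \<epsilon> and N is the point of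
  the construction.\<close>

lemma bounded_test_field:
  assumes dim: "2 \<le> DIM('a::euclidean_space)"
  obtains C where "0 < C" "\<And>(g::'a::euclidean_space \<Rightarrow> real) \<rho> \<epsilon> N. \<lbrakk>integrable lborel g; \<And>x. \<bar>g x\<bar> \<le> norm x powr (- \<alpha>);
    \<And>x. \<rho> < norm x \<Longrightarrow> g x = 0; 0 < \<epsilon>\<rbrakk> \<Longrightarrow>
    \<exists>\<phi>\<in>Cc_infinity. (\<forall>x. norm (\<phi> x) \<le> C) \<and> (\<forall>x. fdiv \<alpha> \<phi> x = appr \<alpha> g \<epsilon> x - appr \<alpha> g (\<epsilon> * 2 ^ N) x)"
proof -
  define n where "n = real DIM('a)"
  define q where "q = (real DIM('a) + 1 - \<alpha>) / 2"
  have q: "1 / 2 \<le> q" unfolding q_def by (rule mker_index[OF \<alpha>])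
  obtain B0 where B0: "blip B0 (sker q :: 'a \<Rightarrow> 'a)" using blip_sker[OF q] by blast
  define \<Theta> where "\<Theta> = (bumpf q 2 :: 'a \<Rightarrow> 'a)"
  have \<Theta>B: "blip (2 * B0) \<Theta>" unfolding \<Theta>_def by (rule blip_bumpf[OF B0 _ q]) simp
  have \<Theta>0: "2 < norm x \<Longrightarrow> \<Theta> x = 0" for x unfolding \<Theta>_def by (rule bumpf_zero) auto
  have \<Theta>C: "\<Theta> \<in> Cc_infinity" unfolding \<Theta>_def by (rule bumpf_Cc_infinity) simp
  obtain \<psi> :: "'a \<Rightarrow> 'a \<Rightarrow> 'a" and L where \<psi>: "0 \<le> L" "\<And>a. \<psi> a \<in> Cc_infinity" "\<And>a x. fdiv \<alpha> (\<psi> a) x = 0"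
    "\<And>a y. 2 < norm y \<Longrightarrow> \<psi> a y = 0" "\<And>a y. norm (\<psi> a y - a) \<le> L * norm a * norm y"
    using curl_field[OF dim] by metis
  obtain C where C: "0 \<le> C" "\<And>g t y. \<lbrakk>integrable lborel g; \<And>x. \<bar>g x\<bar> \<le> norm x powr (- \<alpha>); 0 < t\<rbrakk> \<Longrightarrow>
    norm (conv g (scaled \<alpha> t \<Theta>) y - \<psi> (conv g (scaled \<alpha> t \<Theta>) 0) (y /\<^sub>R t)) \<le>
    C * (if norm y < 4 * t then norm y / t else (t / norm y) powr \<alpha>)"
    using scale_piece_bound[OF \<Theta>B \<Theta>0 \<psi>(1,4,5)] by blast
  define K where "K = 8 + 1 / (2 powr \<alpha> - 1)"
  have "0 < 2 powr \<alpha> - 1" using \<alpha> powr_less_mono[of 0 \<alpha> 2] by simp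
  then have K: "0 < K" unfolding K_def by (simp add: add_pos_pos)
  obtain CM where CM: "\<And>x::'a. \<bar>mker \<alpha> x\<bar> \<le> CM" using mker_bounded[OF \<alpha>] by metis
  show ?thesis
  proof (rule that)
    \<comment> \<open>The summand 1 ensures strict positivity, since fields are later divided by
      this bound.\<close>
    show "0 < C * K + 1" using C(1) K by (simp add: add_nonneg_pos)
    fix g :: "'a \<Rightarrow> real" and \<rho> \<epsilon> :: real and N :: nat
    assume g: "integrable lborel g" and gb: "\<And>x. \<bar>g x\<bar> \<le> norm x powr (- \<alpha>)"
      and gs: "\<And>x. \<rho> < norm x \<Longrightarrow> g x = 0" and \<epsilon>: "0 < \<epsilon>"
    define t where "t = (\<lambda>i::nat. \<epsilon> * 2 ^ i)"
    have t: "0 < t i" "t (Suc i) = 2 * t i" for i using \<epsilon> by (auto simp: t_def)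
    define G where "G = (\<lambda>i. conv g (scaled \<alpha> (t i) \<Theta>))"
    define P where "P = (\<lambda>i y. G i y - \<psi> (G i 0) (y /\<^sub>R t i))"
    have sC: "scaled \<alpha> (t i) \<Theta> \<in> Cc_infinity" for i
      unfolding scaled_def[abs_def] using Cc_infinity_affine[OF \<Theta>C, of "inverse (t i)" 0] t(1)[of i]
      by (intro Cc_infinity_linear[OF bounded_linear_scaleR_right]) simp
    have GC: "G i \<in> Cc_infinity" for i
      unfolding G_def by (rule conv_Cc_infinity[OF g gs sC])
    have \<psi>C: "(\<lambda>y. \<psi> a (y /\<^sub>R t i)) \<in> Cc_infinity" for a i
      using Cc_infinity_affine[OF \<psi>(2)[of a], of "inverse (t i)" 0] t(1)[of i] by simp
    have PC: "P i \<in> Cc_infinity" for i unfolding P_def by (intro Cc_infinity_diff GC \<psi>C)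
    have mi: "integrable lborel (\<lambda>w. g w * (s powr (- n) * mker \<alpha> ((x - w) /\<^sub>R s)))" for s x
    proof (rule Bochner_Integration.integrable_bound[OF integrable_mult_left[OF g, of "s powr (- n) * CM"]])
      have [measurable]: "g \<in> borel_measurable borel" using g by (auto dest: borel_measurable_integrable)
      note mker_measurable[OF \<alpha>, measurable]
      show "(\<lambda>w. g w * (s powr (- n) * mker \<alpha> ((x - w) /\<^sub>R s))) \<in> borel_measurable lborel" by measurable
      show "AE w in lborel. norm (g w * (s powr (- n) * mker \<alpha> ((x - w) /\<^sub>R s))) \<le> norm (g w * (s powr (- n) * CM))"
        using order_trans[OF CM abs_ge_self] by (auto simp: abs_mult intro!: mult_left_mono)
    qed
    have fP: "fdiv \<alpha> (P i) x = appr \<alpha> g (t i) x - appr \<alpha> g (t (Suc i)) x" for i x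
    proof -
      obtain B1 where B1: "blip B1 (G i)" using Cc_infinity_blip[OF GC] by metis
      obtain B2 where B2: "blip B2 (\<lambda>y. \<psi> (G i 0) (y /\<^sub>R t i))" using Cc_infinity_blip[OF \<psi>C] by metis
      obtain B3 where B3: "blip B3 (\<psi> (G i 0))" using Cc_infinity_blip[OF \<psi>(2)] by metis
      obtain B4 where B4: "blip B4 (scaled \<alpha> (t i) \<Theta>)" using Cc_infinity_blip[OF sC] by metis
      have "fdiv \<alpha> (P i) x = fdiv \<alpha> (G i) x"
        unfolding P_def using fdiv_diff[OF \<alpha> B1 B2] fdiv_dilate[OF \<alpha> B3 t(1)] \<psi>(3) by simp
      also have "\<dots> = (\<integral>w. g w * fdiv \<alpha> (scaled \<alpha> (t i) \<Theta>) (x - w) \<partial>lborel)"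
        unfolding G_def by (rule fdiv_conv[OF \<alpha> g B4])
      also have "\<dots> = (\<integral>w. g w * (t i powr (- n) * mker \<alpha> ((x - w) /\<^sub>R t i)) -
          g w * (t (Suc i) powr (- n) * mker \<alpha> ((x - w) /\<^sub>R t (Suc i))) \<partial>lborel)"
      proof (rule Bochner_Integration.integral_cong[OF refl])
        fix w
        have "fdiv \<alpha> (scaled \<alpha> (t i) \<Theta>) (x - w) =
            t i powr (\<alpha> - n) * (t i powr (- \<alpha>) * fdiv \<alpha> \<Theta> ((x - w) /\<^sub>R t i))"
          unfolding scaled_def[abs_def] n_def fdiv_scaleR[OF \<alpha>] fdiv_dilate[OF \<alpha> \<Theta>B t(1)] ..
        also have "\<dots> = t i powr (- n) * fdiv \<alpha> \<Theta> ((x - w) /\<^sub>R t i)"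
          unfolding mult.assoc[symmetric] powr_add[symmetric] by simp
        also have "fdiv \<alpha> \<Theta> ((x - w) /\<^sub>R t i) = mker \<alpha> ((x - w) /\<^sub>R t i) -
            2 powr (- n) * mker \<alpha> (((x - w) /\<^sub>R t i) /\<^sub>R 2)"
          unfolding \<Theta>_def q_def n_def by (rule fdiv_bumpf[OF \<alpha>]) simp
        also have "((x - w) /\<^sub>R t i) /\<^sub>R 2 = (x - w) /\<^sub>R t (Suc i)" by (simp add: t(2))
        also have "t i powr (- n) * (mker \<alpha> ((x - w) /\<^sub>R t i) - 2 powr (- n) * mker \<alpha> ((x - w) /\<^sub>R t (Suc i))) =
            t i powr (- n) * mker \<alpha> ((x - w) /\<^sub>R t i) - t (Suc i) powr (- n) * mker \<alpha> ((x - w) /\<^sub>R t (Suc i))"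
          using t(1)[of i] by (simp add: t(2)[of i] powr_mult right_diff_distrib)
        finally show "g w * fdiv \<alpha> (scaled \<alpha> (t i) \<Theta>) (x - w) = g w * (t i powr (- n) * mker \<alpha> ((x - w) /\<^sub>R t i)) -
            g w * (t (Suc i) powr (- n) * mker \<alpha> ((x - w) /\<^sub>R t (Suc i)))" by (simp add: right_diff_distrib)
      qed
      also have "\<dots> = appr \<alpha> g (t i) x - appr \<alpha> g (t (Suc i)) x"
        unfolding appr_def n_def[symmetric] by (rule Bochner_Integration.integral_diff[OF mi mi])
      finally show ?thesis .
    qed
    show "\<exists>\<phi>\<in>Cc_infinity. (\<forall>x. norm (\<phi> x) \<le> C * K + 1) \<and>
      (\<forall>x. fdiv \<alpha> \<phi> x = appr \<alpha> g \<epsilon> x - appr \<alpha> g (\<epsilon> * 2 ^ N) x)"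
    proof (intro bexI conjI allI)
      show "(\<lambda>y. \<Sum>i<N. P i y) \<in> Cc_infinity" by (intro Cc_infinity_sum PC)
      fix x
      have "\<forall>i. \<exists>B. blip B (P i)" using Cc_infinity_blip[OF PC] by metis
      then obtain B where B: "\<And>i. blip (B i) (P i)" by metis
      have "fdiv \<alpha> (\<lambda>y. \<Sum>i<N. P i y) x = (\<Sum>i<N. appr \<alpha> g (t i) x - appr \<alpha> g (t (Suc i)) x)"
        using fdiv_sum[OF \<alpha> B, where I="{..<N}"] by (simp add: fP)
      also have "\<dots> = appr \<alpha> g (t 0) x - appr \<alpha> g (t N) x" by (rule sum_lessThan_telescope')
      finally show "fdiv \<alpha> (\<lambda>y. \<Sum>i<N. P i y) x = appr \<alpha> g \<epsilon> x - appr \<alpha> g (\<epsilon> * 2 ^ N) x" by (simp add: t_def)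
      have "norm (\<Sum>i<N. P i x) \<le> (\<Sum>i<N. C * (if norm x < 4 * t i then norm x / t i else (t i / norm x) powr \<alpha>))"
        unfolding P_def G_def by (intro sum_norm_le C(2) g gb t)
      also have "\<dots> \<le> C * K"
        unfolding sum_distrib_left[symmetric] K_def t_def
        by (intro mult_left_mono dyadic_telescope C \<epsilon>) simp
      finally show "norm (\<Sum>i<N. P i x) \<le> C * K + 1" by simp
    qed
  qed
qed

end

section \<open>Passage to the normalized divergence, the variation and the Lebesgue classes\<close>

lemma lebesgue_borelI: "f \<in> borel_measurable borel \<Longrightarrow> f \<in> borel_measurable lebesgue"
  by (intro measurable_completion) simp

lemma frac_div_eq:
  fixes \<phi> :: "real^'n \<Rightarrow> real^'n"
  assumes "\<phi> \<in> borel_measurable borel"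
  shows "frac_div \<alpha> \<phi> x = mu CARD('n) \<alpha> * fdiv \<alpha> \<phi> x"
proof -
  note [measurable] = assms
  let ?h = "\<lambda>y. ((y - x) \<bullet> (\<phi> y - \<phi> x)) / norm (y - x) powr (real CARD('n) + \<alpha> + 1)"
  have [measurable]: "?h \<in> borel_measurable borel" by measurable
  have "(\<integral>y. ?h y \<partial>lebesgue) = (\<integral>y. ?h y \<partial>lborel)" by (rule integral_completion) measurable
  also have "\<dots> = (\<integral>z. ?h (x + z) \<partial>lborel)"
    using lborel_integral_affine(1)[of ?h 1 x] by simp
  also have "\<dots> = fdiv \<alpha> \<phi> x"
  proof -
    have "fker \<alpha> z = inverse (norm z powr (real CARD('n) + \<alpha> + 1))" for z :: "real^'n"
      unfolding fker_def powr_minus by simp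
    then show ?thesis by (simp add: fdiv_def divide_inverse mult.commute)
  qed
  finally show ?thesis by (simp add: frac_div_def)
qed

lemma Linfinity_norm_le_1:
  assumes "\<phi> \<in> borel_measurable borel" "\<And>x. norm (\<phi> x) \<le> 1"
  shows "Linfinity_norm \<phi> \<le> 1"
  unfolding Linfinity_norm_def
proof (rule esssup_I)
  note [measurable] = assms(1)
  have "(\<lambda>x. ereal (norm (\<phi> x))) \<in> borel_measurable borel" by measurable
  then show "(\<lambda>x. ereal (norm (\<phi> x))) \<in> borel_measurable lebesgue"
    by (rule lebesgue_borelI)
  show "AE x in lebesgue. ereal (norm (\<phi> x)) \<le> 1" using assms(2) by simp
qed

text \<open>Division by C makes the field admissible in the supremum, and the divergence is
  linear.\<close>

lemma variation_test:
  fixes f :: "real^'n \<Rightarrow> real"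
  assumes V: "frac_variation \<alpha> f \<le> ereal V" and \<phi>: "\<phi> \<in> Cc_infinity" "\<And>x. norm (\<phi> x) \<le> C" and C: "0 < C"
  shows "mu CARD('n) \<alpha> * (\<integral>x. f x * fdiv \<alpha> \<phi> x \<partial>lebesgue) \<le> C * V"
proof -
  define \<psi> where "\<psi> = (\<lambda>x. inverse C *\<^sub>R \<phi> x)"
  have \<psi>C: "\<psi> \<in> Cc_infinity" unfolding \<psi>_def by (intro Cc_infinity_linear[OF bounded_linear_scaleR_right] \<phi>)
  then obtain B where "blip B \<psi>" using Cc_infinity_blip by blast
  then have m: "\<psi> \<in> borel_measurable borel" by (rule blip_measurable)
  have "norm (\<psi> x) \<le> 1" for x using \<phi>(2)[of x] C by (simp add: \<psi>_def field_simps)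
  then have "Linfinity_norm \<psi> \<le> 1" by (intro Linfinity_norm_le_1 m)
  then have "ereal (\<integral>x. f x * frac_div \<alpha> \<psi> x \<partial>lebesgue) \<le> frac_variation \<alpha> f"
    unfolding frac_variation_def using \<psi>C by (intro SUP_upper) simp
  also note V
  also have "(\<integral>x. f x * frac_div \<alpha> \<psi> x \<partial>lebesgue) = (\<integral>x. inverse C * (mu CARD('n) \<alpha> * (f x * fdiv \<alpha> \<phi> x)) \<partial>lebesgue)"
  proof (rule Bochner_Integration.integral_cong[OF refl])
    fix x
    have "fdiv \<alpha> \<psi> x = inverse C * fdiv \<alpha> \<phi> x"
      unfolding \<psi>_def fdiv_def
      by (subst integral_mult_right_zero[symmetric], intro Bochner_Integration.integral_cong) (auto simp: algebra_simps)
    then show "f x * frac_div \<alpha> \<psi> x = inverse C * (mu CARD('n) \<alpha> * (f x * fdiv \<alpha> \<phi> x))"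
      by (simp add: frac_div_eq[OF m])
  qed
  also have "\<dots> = inverse C * (mu CARD('n) \<alpha> * (\<integral>x. f x * fdiv \<alpha> \<phi> x \<partial>lebesgue))" by simp
  finally show ?thesis using C by (simp add: field_simps)
qed

text \<open>The condition on s says that the weight lies in the dual Lebesgue class, i.e. s p' > n.
  For p > 1 a crude form of Young's inequality suffices: comparing w with |f|^(p-1) bounds |f| w by
  one of |f|^p and w^p'. It is applied with s = n for n \<ge> 2, and with s = \<alpha> for n = 1,
  where the condition becomes p < 1/(1 - \<alpha>).\<close>

lemma Lp_weight_integrable:
  fixes f :: "real^'n \<Rightarrow> real" and x0 :: "real^'n"
  assumes f: "f \<in> Lp p" and p: "1 \<le> p" and s: "0 \<le> s" "real CARD('n) * (1 - 1 / p) < s"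
  shows "integrable lebesgue (\<lambda>x. f x * (1 + norm (x - x0)) powr (- s))"
proof -
  define w where "w = (\<lambda>x. (1 + norm (x - x0)) powr (- s))"
  have [measurable]: "w \<in> borel_measurable borel" unfolding w_def by measurable
  have w: "0 < w x" "w x \<le> 1" for x
  proof -
    have x: "0 < 1 + norm (x - x0)" by (simp add: add_pos_nonneg)
    then show "0 < w x" by (simp add: w_def)
    have "w x \<le> 1 powr (- s)" unfolding w_def using s by (intro powr_mono2') auto
    then show "w x \<le> 1" by simp
  qed
  have fm: "f \<in> borel_measurable lebesgue" and fi: "integrable lebesgue (\<lambda>x. \<bar>f x\<bar> powr p)"
    using f by (auto simp: Lp_def)
  have wm: "w \<in> borel_measurable lebesgue" by (rule lebesgue_borelI) measurable
  have fwm: "(\<lambda>x. f x * w x) \<in> borel_measurable lebesgue" using fm wm by (rule borel_measurable_times)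
  have "integrable lebesgue (\<lambda>x. f x * w x)"
  proof (cases "p = 1")
    case True
    show ?thesis
    proof (rule Bochner_Integration.integrable_bound[OF fi fwm])
      show "AE x in lebesgue. norm (f x * w x) \<le> norm (\<bar>f x\<bar> powr p)"
      proof (rule AE_I2)
        fix x
        show "norm (f x * w x) \<le> norm (\<bar>f x\<bar> powr p)"
          using True w[of x] mult_left_le[of "w x" "\<bar>f x\<bar>"] by (simp add: abs_mult)
      qed
    qed
  next
    case False
    then have p1: "1 < p" using p by simp
    define p' where "p' = p / (p - 1)"
    have sp: "real CARD('n) < s * p'"
    proof -
      have "real CARD('n) * ((p - 1) / p) < s" using s(2) p1 by (simp add: diff_divide_distrib)
      then show ?thesis using p1 by (simp add: p'_def field_simps)
    qed
    have wi: "integrable lborel (\<lambda>x::real^'n. (1 + norm x) powr (- (s * p')))"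
      by (rule integrable_norm_powr_outside(2)) (use sp in simp)
    have "integrable lborel (\<lambda>x::real^'n. (1 + norm (x - x0)) powr (- (s * p')))"
      using lborel_integral_affine(2)[of "\<lambda>x::real^'n. (1 + norm x) powr (- (s * p'))" 1 "- x0"] wi by simp
    then have wi': "integrable lebesgue (\<lambda>x::real^'n. (1 + norm (x - x0)) powr (- (s * p')))"
      by (subst integrable_completion) auto
    show ?thesis
    proof (rule Bochner_Integration.integrable_bound[OF Bochner_Integration.integrable_add[OF fi wi'] fwm], rule AE_I2)
      fix x
      have wp: "(1 + norm (x - x0)) powr (- (s * p')) = w x powr p'" by (simp add: w_def powr_powr)
      have "\<bar>f x\<bar> * w x \<le> \<bar>f x\<bar> powr p + w x powr p'"
      proof (cases "w x \<le> \<bar>f x\<bar> powr (p - 1)")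
        case True
        then have "\<bar>f x\<bar> * w x \<le> \<bar>f x\<bar> * \<bar>f x\<bar> powr (p - 1)" by (intro mult_left_mono) auto
        also have "\<dots> \<le> \<bar>f x\<bar> powr p" using powr_mult_base[of "\<bar>f x\<bar>" "p - 1"] by (cases "f x = 0") auto
        finally show ?thesis by (simp add: add_increasing2)
      next
        case False
        have "\<bar>f x\<bar> = (\<bar>f x\<bar> powr (p - 1)) powr (1 / (p - 1))" using p1 by (simp add: powr_powr)
        also have "\<dots> \<le> w x powr (1 / (p - 1))" using False p1 by (intro powr_mono2) auto
        finally have "\<bar>f x\<bar> * w x \<le> w x powr (1 / (p - 1)) * w x" using w[of x] by (intro mult_right_mono) auto
        also have "\<dots> = w x powr p'"
        proof -
          have "p' = 1 + 1 / (p - 1)" using p1 by (simp add: p'_def field_simps)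
          then show ?thesis using powr_mult_base[of "w x" "1 / (p - 1)"] w[of x] by (simp add: mult.commute)
        qed
        finally show ?thesis by (simp add: add_increasing)
      qed
      then show "norm (f x * w x) \<le> norm (\<bar>f x\<bar> powr p + (1 + norm (x - x0)) powr (- (s * p')))"
        using w[of x] unfolding wp by (simp add: abs_mult)
    qed
  qed
  then show ?thesis by (simp add: w_def)
qed

lemma mu_pos: "0 < \<alpha> \<Longrightarrow> \<alpha> < 1 \<Longrightarrow> 0 < mu n \<alpha>"
  unfolding mu_def by (intro divide_pos_pos mult_pos_pos Gamma_real_pos) (auto simp: add_nonneg_pos)

context
  fixes \<alpha> :: real
  assumes \<alpha>: "0 < \<alpha>" "\<alpha> < 1"
begin

section \<open>Limits of the approximate identity and duality with f\<close>

lemma appr_measurable: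
  assumes "g \<in> borel_measurable borel"
  shows "appr \<alpha> g t \<in> borel_measurable borel"
proof -
  note [measurable] = assms mker_measurable[OF \<alpha>]
  have "(\<lambda>x. \<integral>w. g w * (t powr (- real DIM('a)) * mker \<alpha> ((x - w) /\<^sub>R t)) \<partial>lborel) \<in> borel_measurable lborel"
    by (rule lborel.borel_measurable_lebesgue_integral) measurable
  then show ?thesis by (simp add: appr_def[abs_def])
qed

lemma appr_rescale:
  fixes g :: "'a::euclidean_space \<Rightarrow> real"
  assumes [measurable]: "g \<in> borel_measurable borel" and t: "0 < t"
  shows "appr \<alpha> g t y = (\<integral>u. g (y - t *\<^sub>R u) * mker \<alpha> u \<partial>lborel)"
proof -
  note [measurable] = mker_measurable[OF \<alpha>]
  have "appr \<alpha> g t y = t ^ DIM('a) * (\<integral>u. g (y - t *\<^sub>R u) * (t powr (- real DIM('a)) * mker \<alpha> u) \<partial>lborel)"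
    unfolding appr_def
    using t lborel_integral_affine(1)[of "\<lambda>w. g w * (t powr (- real DIM('a)) * mker \<alpha> ((y - w) /\<^sub>R t))" "- t" y] by simp
  also have "\<dots> = (t ^ DIM('a) * t powr (- real DIM('a))) * (\<integral>u. g (y - t *\<^sub>R u) * mker \<alpha> u \<partial>lborel)"
    by (simp add: mult.left_commute[of _ "t powr _"])
  also have "t ^ DIM('a) * t powr (- real DIM('a)) = 1" using t by (simp add: powr_minus powr_realpow)
  finally show ?thesis by simp
qed

lemma appr_tendsto:
  fixes g :: "'a::euclidean_space \<Rightarrow> real"
  assumes g: "continuous_on UNIV g" "\<And>x. \<bar>g x\<bar> \<le> G"
  shows "(\<lambda>k. appr \<alpha> g ((1 / 2) ^ k) y) \<longlonglongrightarrow> g y * (\<integral>u. mker \<alpha> (u::'a) \<partial>lborel)"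
proof -
  have gm[measurable]: "g \<in> borel_measurable borel" using g(1) by (rule borel_measurable_continuous_onI)
  note [measurable] = mker_measurable[OF \<alpha>]
  have "(\<lambda>k. \<integral>u. g (y - (1 / 2) ^ k *\<^sub>R u) * mker \<alpha> u \<partial>lborel) \<longlonglongrightarrow> (\<integral>(u::'a). g y * mker \<alpha> u \<partial>lborel)"
  proof (rule integral_dominated_convergence)
    show "integrable lborel (\<lambda>u::'a. G * \<bar>mker \<alpha> u\<bar>)"
          by (intro integrable_mult_right integrable_abs mker_integrable \<alpha>)
    show "AE u in lborel. norm (g (y - (1 / 2) ^ k *\<^sub>R u) * mker \<alpha> u) \<le> G * \<bar>mker \<alpha> u\<bar>" for k
      using mult_right_mono[OF g(2) abs_ge_zero] by (auto simp: abs_mult)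
    show "AE u in lborel. (\<lambda>k. g (y - (1 / 2) ^ k *\<^sub>R u) * mker \<alpha> u) \<longlonglongrightarrow> g y * mker \<alpha> u"
    proof (rule AE_I2)
      fix u :: 'a
      have "(\<lambda>k. (1 / 2) ^ k *\<^sub>R u) \<longlonglongrightarrow> 0 *\<^sub>R u" by (intro tendsto_scaleR LIMSEQ_power_zero tendsto_const) simp
      then have "(\<lambda>k. y - (1 / 2) ^ k *\<^sub>R u) \<longlonglongrightarrow> y - 0 *\<^sub>R u" by (intro tendsto_diff tendsto_const)
      then have "(\<lambda>k. y - (1 / 2) ^ k *\<^sub>R u) \<longlonglongrightarrow> y" by simp
      moreover have "isCont g y" using g(1) by (simp add: continuous_on_eq_continuous_at)
      ultimately have "(\<lambda>k. g (y - (1 / 2) ^ k *\<^sub>R u)) \<longlonglongrightarrow> g y" by (rule isCont_tendsto_compose[rotated])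
      then show "(\<lambda>k. g (y - (1 / 2) ^ k *\<^sub>R u) * mker \<alpha> u) \<longlonglongrightarrow> g y * mker \<alpha> u"
        by (intro tendsto_mult tendsto_const)
    qed
  qed measurable
  then show ?thesis by (simp add: appr_rescale[OF gm])
qed

text \<open>Supplies the dominating function as t tends to 0. On bounded sets the sup norm of g
  suffices; far away the decay of order n + 1 of \<open>mker\<close> is used.\<close>

lemma appr_near:
  fixes g :: "'a::euclidean_space \<Rightarrow> real"
  assumes g: "continuous_on UNIV g" "\<And>x. \<rho> < norm x \<Longrightarrow> g x = 0" "integrable lborel g"
  obtains C where "0 \<le> C" "\<And>t y. 0 < t \<Longrightarrow> t \<le> 1 \<Longrightarrow> \<bar>appr \<alpha> g t y\<bar> \<le> C * (1 + norm y) powr (- real DIM('a))"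
proof -
  define n where "n = real DIM('a)"
  have n: "1 \<le> n" using DIM_ge_Suc0[where 'a='a] by (simp add: n_def)
  obtain G where G: "0 < G" "\<And>x. norm (g x) \<le> G"
    using compact_support_bounded[OF g(1,2)] by metis
  have gm[measurable]: "g \<in> borel_measurable borel" using g(1) by (rule borel_measurable_continuous_onI)
  note [measurable] = mker_measurable[OF \<alpha>]
  obtain C where C: "0 \<le> C" "\<And>x::'a. \<bar>mker \<alpha> x\<bar> \<le> C * (1 + norm x) powr (- (n + 1))"
    using mker_decay[OF \<alpha>] unfolding n_def by blast
  \<comment> \<open>Beyond radius r, every w in the support of g satisfies |y - w| \<ge>
    |y|/2.\<close>
  define r where "r = max 1 (2 * \<bar>\<rho>\<bar>)"
  have r: "1 \<le> r" "2 * \<bar>\<rho>\<bar> \<le> r" by (auto simp: r_def)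
  define M1 where "M1 = (\<integral>u. \<bar>mker \<alpha> (u::'a)\<bar> \<partial>lborel)"
  define G1 where "G1 = (\<integral>u. \<bar>g u\<bar> \<partial>lborel)"
  have MG: "0 \<le> M1" "0 \<le> G1" unfolding M1_def G1_def by (auto intro!: integral_nonneg_AE)
  define A where "A = G * M1 * (1 + r) powr n + G1 * C * 4 powr (n + 1)"
  show ?thesis
  proof (rule that)
    show A0: "0 \<le> A" using G MG C by (auto simp: A_def intro!: add_nonneg_nonneg mult_nonneg_nonneg)
    fix t :: real and y :: 'a assume t: "0 < t" "t \<le> 1"
    have Y: "0 < 1 + norm y" by (simp add: add_pos_nonneg)
    show "\<bar>appr \<alpha> g t y\<bar> \<le> A * (1 + norm y) powr (- real DIM('a))"
    proof (cases "norm y \<le> r")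
      case True
      have "norm (appr \<alpha> g t y) \<le> (\<integral>u. G * \<bar>mker \<alpha> (u::'a)\<bar> \<partial>lborel)"
        unfolding appr_rescale[OF gm t(1)]
      proof (rule Bochner_Integration.integral_norm_bound_integral)
        show i: "integrable lborel (\<lambda>u::'a. G * \<bar>mker \<alpha> u\<bar>)"
          by (intro integrable_mult_right integrable_abs mker_integrable \<alpha>)
        show b: "norm (g (y - t *\<^sub>R u) * mker \<alpha> u) \<le> G * \<bar>mker \<alpha> u\<bar>" for u
          using mult_right_mono[OF G(2) abs_ge_zero] by (auto simp: abs_mult)
        show "integrable lborel (\<lambda>u. g (y - t *\<^sub>R u) * mker \<alpha> u)"
          by (rule Bochner_Integration.integrable_bound[OF i]) (measurable, use b order_trans[OF b abs_ge_self] in auto)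
      qed
      then have "\<bar>appr \<alpha> g t y\<bar> \<le> G * M1" by (simp add: M1_def)
      also have "\<dots> \<le> G * M1 * ((1 + r) powr n * (1 + norm y) powr (- n))"
      proof -
        have "(1 + norm y) powr n \<le> (1 + r) powr n" using True n by (intro powr_mono2) auto
        then have "1 \<le> (1 + r) powr n * (1 + norm y) powr (- n)" using Y by (simp add: powr_minus field_simps)
        from mult_left_mono[OF this, of "G * M1"] show ?thesis using G MG by simp
      qed
      also have "\<dots> \<le> A * (1 + norm y) powr (- n)"
      proof -
        have "G * M1 * (1 + r) powr n \<le> A" using MG C by (simp add: A_def)
        from mult_right_mono[OF this, of "(1 + norm y) powr (- n)"] show ?thesis by (simp add: mult.assoc)
      qed
      finally show ?thesis by (simp add: n_def)
    next
      case False
      then have y: "1 \<le> norm y" "2 * \<bar>\<rho>\<bar> \<le> norm y" using r by auto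
      let ?k = "C * (4 powr (n + 1) * (1 + norm y) powr (- n))"
      have "norm (appr \<alpha> g t y) \<le> (\<integral>w. ?k * \<bar>g w\<bar> \<partial>lborel)"
        unfolding appr_def
      proof (rule Bochner_Integration.integral_norm_bound_integral)
        show i: "integrable lborel (\<lambda>w. ?k * \<bar>g w\<bar>)" using g(3) by simp
        show b: "norm (g w * (t powr (- real DIM('a)) * mker \<alpha> ((y - w) /\<^sub>R t))) \<le> ?k * \<bar>g w\<bar>" for w
        proof (cases "norm w \<le> \<rho>")
          case True
          then have yw: "norm y / 2 \<le> norm (y - w)" using y norm_triangle_ineq2[of y w] by linarith
          have q: "norm y / (2 * t) \<le> 1 + norm ((y - w) /\<^sub>R t)"
          proof -
            have "norm y / 2 / t \<le> norm (y - w) / t" using yw t by (intro divide_right_mono) auto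
            moreover have "norm ((y - w) /\<^sub>R t) = norm (y - w) / t" using t by (simp add: divide_inverse mult.commute)
            ultimately show ?thesis by simp
          qed
          have "\<bar>mker \<alpha> ((y - w) /\<^sub>R t)\<bar> \<le> C * (norm y / (2 * t)) powr (- (n + 1))"
            by (rule order_trans[OF C(2) mult_left_mono[OF powr_mono2' C(1)]]) (use q y t n in \<open>auto intro!: divide_pos_pos\<close>)
          then have "t powr (- n) * \<bar>mker \<alpha> ((y - w) /\<^sub>R t)\<bar> \<le> t powr (- n) * (C * (norm y / (2 * t)) powr (- (n + 1)))"
            by (intro mult_left_mono) auto
          \<comment> \<open>The decay exponent n + 1 exceeds the dilation exponent n by one, so a
            factor t \<le> 1 is left and no negative power of t.\<close>
          also have "\<dots> = C * ((norm y / 2) powr (- (n + 1)) * t)"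
          proof -
            have "(norm y / (2 * t)) = (norm y / 2) * inverse t" unfolding inverse_eq_divide by simp
            moreover have "inverse t powr (- s) = t powr s" for s
              using inverse_powr[of t "- s"] powr_minus[of t s] t by simp
            ultimately have "(norm y / (2 * t)) powr (- (n + 1)) = (norm y / 2) powr (- (n + 1)) * t powr (n + 1)"
              by (simp only: powr_mult)
            moreover have "t powr (- n) * t powr (n + 1) = t" using t by (simp add: powr_add[symmetric])
            ultimately show ?thesis by (metis (no_types, opaque_lifting) mult.assoc mult.left_commute)
          qed
          also have "\<dots> \<le> C * ((4 powr (n + 1) * (1 + norm y) powr (- n)) * 1)"
          proof (intro mult_left_mono[OF mult_mono])
            have "(norm y / 2) powr (- (n + 1)) \<le> ((1 + norm y) / 4) powr (- (n + 1))"
              using y n by (intro powr_mono2') (auto simp: Y)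
            also have "\<dots> = 4 powr (n + 1) * (1 + norm y) powr (- (n + 1))"
              unfolding powr_minus using Y by (simp add: powr_divide field_simps)
            also have "\<dots> \<le> 4 powr (n + 1) * (1 + norm y) powr (- n)"
              by (intro mult_left_mono powr_mono) auto
            finally show "(norm y / 2) powr (- (n + 1)) \<le> 4 powr (n + 1) * (1 + norm y) powr (- n)" .
          qed (use t C in auto)
          finally have "t powr (- n) * \<bar>mker \<alpha> ((y - w) /\<^sub>R t)\<bar> \<le> ?k" by simp
          from mult_left_mono[OF this, of "\<bar>g w\<bar>"] show ?thesis by (simp add: abs_mult n_def ac_simps)
        qed (use g(2) in simp)
        show "integrable lborel (\<lambda>w. g w * (t powr (- real DIM('a)) * mker \<alpha> ((y - w) /\<^sub>R t)))"
          by (rule Bochner_Integration.integrable_bound[OF i]) (measurable, use b order_trans[OF b abs_ge_self] in auto)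
      qed
      also have "\<dots> = (G1 * C * 4 powr (n + 1)) * (1 + norm y) powr (- n)" by (simp add: G1_def)
      also have "\<dots> \<le> A * (1 + norm y) powr (- n)"
        using G MG by (intro mult_right_mono) (auto simp: A_def)
      finally show ?thesis by (simp add: n_def)
    qed
  qed
qed

text \<open>For large t the spatial bound is the dominating function, and the bound by t^(-n) gives
  pointwise convergence to zero.\<close>

lemma appr_far:
  fixes g :: "'a::euclidean_space \<Rightarrow> real"
  assumes g: "integrable lborel g" "\<And>x. \<rho> < norm x \<Longrightarrow> g x = 0"
  obtains C where "0 \<le> C" "\<And>t y. 1 \<le> t \<Longrightarrow> \<bar>appr \<alpha> g t y\<bar> \<le> C * (1 + norm y) powr (- real DIM('a))"
    "\<And>t y. 1 \<le> t \<Longrightarrow> \<bar>appr \<alpha> g t y\<bar> \<le> C * t powr (- real DIM('a))"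
proof -
  define n where "n = real DIM('a)"
  have n: "1 \<le> n" using DIM_ge_Suc0[where 'a='a] by (simp add: n_def)
  have gm[measurable]: "g \<in> borel_measurable borel" using g(1) by (auto dest: borel_measurable_integrable)
  note [measurable] = mker_measurable[OF \<alpha>]
  obtain C where C: "0 \<le> C" "\<And>x::'a. \<bar>mker \<alpha> x\<bar> \<le> C * (1 + norm x) powr (- (n + 1))"
    using mker_decay[OF \<alpha>] unfolding n_def by blast
  define G1 where "G1 = (\<integral>u. \<bar>g u\<bar> \<partial>lborel)"
  have G1: "0 \<le> G1" unfolding G1_def by (auto intro!: integral_nonneg_AE)
  define R where "R = 1 + \<bar>\<rho>\<bar>"
  have R: "1 \<le> R" by (simp add: R_def)
  have est: "\<bar>appr \<alpha> g t y\<bar> \<le> G1 * k"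
    if k: "\<And>w. norm w \<le> \<rho> \<Longrightarrow> t powr (- n) * \<bar>mker \<alpha> ((y - w) /\<^sub>R t)\<bar> \<le> k" for t y k
  proof -
    have "norm (appr \<alpha> g t y) \<le> (\<integral>w. k * \<bar>g w\<bar> \<partial>lborel)"
      unfolding appr_def
    proof (rule Bochner_Integration.integral_norm_bound_integral)
      show i: "integrable lborel (\<lambda>w. k * \<bar>g w\<bar>)" using g(1) by simp
      show b: "norm (g w * (t powr (- real DIM('a)) * mker \<alpha> ((y - w) /\<^sub>R t))) \<le> k * \<bar>g w\<bar>" for w
      proof (cases "norm w \<le> \<rho>")
        case True
        from mult_left_mono[OF k[OF this], of "\<bar>g w\<bar>"] show ?thesis by (simp add: abs_mult n_def ac_simps)
      qed (use g(2) in simp)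
      show "integrable lborel (\<lambda>w. g w * (t powr (- real DIM('a)) * mker \<alpha> ((y - w) /\<^sub>R t)))"
        by (rule Bochner_Integration.integrable_bound[OF i]) (measurable, use b order_trans[OF b abs_ge_self] in auto)
    qed
    then show ?thesis by (simp add: G1_def mult.commute)
  qed
  show ?thesis
  proof (rule that[of "G1 * (C * R powr n)"])
    show "0 \<le> G1 * (C * R powr n)" using G1 C by simp
    fix t :: real and y :: 'a assume t: "1 \<le> t"
    have mC: "\<bar>mker \<alpha> x\<bar> \<le> C * (1 + norm x) powr (- n)" for x :: 'a
      by (rule order_trans[OF C(2) mult_left_mono[OF powr_mono C(1)]]) auto
    \<comment> \<open>Weakening the decay of \<open>mker\<close> to order n makes dilation factor
      and kernel combine into (t + |y - w|)^(-n), from which both bounds are read off.\<close>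
    have k1: "t powr (- n) * \<bar>mker \<alpha> ((y - w) /\<^sub>R t)\<bar> \<le> C * (t + norm (y - w)) powr (- n)" for w
    proof -
      have "t powr (- n) * \<bar>mker \<alpha> ((y - w) /\<^sub>R t)\<bar> \<le> t powr (- n) * (C * (1 + norm ((y - w) /\<^sub>R t)) powr (- n))"
        by (intro mult_left_mono mC) simp
      also have "\<dots> = C * (t * (1 + norm ((y - w) /\<^sub>R t))) powr (- n)"
        using t by (subst powr_mult) (auto simp: add_nonneg_nonneg)
      also have "t * (1 + norm ((y - w) /\<^sub>R t)) = t + norm (y - w)" using t by (simp add: distrib_left)
      finally show ?thesis .
    qed
    have "t powr (- n) * \<bar>mker \<alpha> ((y - w) /\<^sub>R t)\<bar> \<le> C * (R powr n * (1 + norm y) powr (- n))" if w: "norm w \<le> \<rho>" for w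
    proof -
      have "1 + norm y \<le> 1 + \<rho> + norm (y - w)" using norm_triangle_ineq2[of y w] w by linarith
      also have "\<dots> \<le> R * (t + norm (y - w))"
      proof -
        have "1 * norm (y - w) \<le> R * norm (y - w)" "R * 1 \<le> R * t" using R t by (intro mult_right_mono mult_left_mono; simp)+
        moreover have "1 + \<rho> \<le> R" by (simp add: R_def)
        ultimately show ?thesis unfolding distrib_left by linarith
      qed
      finally have "(R * (t + norm (y - w))) powr (- n) \<le> (1 + norm y) powr (- n)"
        using n by (intro powr_mono2') (auto simp: add_pos_nonneg)
      then have "R powr n * (R * (t + norm (y - w))) powr (- n) \<le> R powr n * (1 + norm y) powr (- n)" by (intro mult_left_mono) auto
      moreover have "R powr n * (R * (t + norm (y - w))) powr (- n) = (t + norm (y - w)) powr (- n)"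
        using R t by (simp add: powr_mult powr_minus)
      ultimately have "(t + norm (y - w)) powr (- n) \<le> R powr n * (1 + norm y) powr (- n)" by simp
      from mult_left_mono[OF this C(1)] show ?thesis using k1[of w] by linarith
    qed
    from est[OF this] show "\<bar>appr \<alpha> g t y\<bar> \<le> G1 * (C * R powr n) * (1 + norm y) powr (- real DIM('a))" by (simp add: n_def mult.assoc)
    have "t powr (- n) * \<bar>mker \<alpha> ((y - w) /\<^sub>R t)\<bar> \<le> C * R powr n * t powr (- n)" for w
    proof -
      have "(t + norm (y - w)) powr (- n) \<le> t powr (- n)" using t n by (intro powr_mono2') auto
      moreover have "1 \<le> R powr n" using R n by (simp add: ge_one_powr_ge_zero)
      ultimately have "(t + norm (y - w)) powr (- n) \<le> R powr n * t powr (- n)"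
        using mult_right_mono[of 1 "R powr n" "t powr (- n)"] by simp
      from mult_left_mono[OF this C(1)] show ?thesis using k1[of w] by (simp add: mult.assoc)
    qed
    from est[OF this] show "\<bar>appr \<alpha> g t y\<bar> \<le> G1 * (C * R powr n) * t powr (- real DIM('a))" by (simp add: n_def mult.assoc)
  qed
qed

text \<open>The test fields have divergence \<open>appr\<close> at scale 2^(-k) minus
  \<open>appr\<close> at scale 2^k. As k grows, this tends to \<kappa> g, while the sup norms stay
  below C; translation by x0 changes neither, so the constant is m \<kappa> / C.\<close>

lemma dual_bound:
  assumes dim: "2 \<le> CARD('n)"
  obtains c where "0 < c" "\<And>(f :: real^'n \<Rightarrow> real) p V g \<rho> x0. \<lbrakk>f \<in> Lp p; 1 \<le> p; frac_variation \<alpha> f \<le> ereal V;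
    continuous_on UNIV g; \<And>x. \<bar>g x\<bar> \<le> norm x powr (- \<alpha>); \<And>x. \<rho> < norm x \<Longrightarrow> g x = 0\<rbrakk> \<Longrightarrow>
    c * (\<integral>x. f x * g (x - x0) \<partial>lebesgue) \<le> V"
proof -
  define n where "n = real CARD('n)"
  have nD: "real DIM(real^'n) = n" by (simp add: n_def)
  have dim': "2 \<le> DIM(real^'n)" using dim by simp
  obtain C where C: "0 < C" "\<And>(g::real^'n \<Rightarrow> real) \<rho> \<epsilon> N. \<lbrakk>integrable lborel g; \<And>x. \<bar>g x\<bar> \<le> norm x powr (- \<alpha>);
    \<And>x. \<rho> < norm x \<Longrightarrow> g x = 0; 0 < \<epsilon>\<rbrakk> \<Longrightarrow>
    \<exists>\<phi>\<in>Cc_infinity. (\<forall>x. norm (\<phi> x) \<le> C) \<and> (\<forall>x. fdiv \<alpha> \<phi> x = appr \<alpha> g \<epsilon> x - appr \<alpha> g (\<epsilon> * 2 ^ N) x)"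
    using bounded_test_field[OF \<alpha> dim'] by blast
  define \<kappa> where "\<kappa> = (\<integral>u. mker \<alpha> (u::real^'n) \<partial>lborel)"
  have \<kappa>: "0 < \<kappa>" unfolding \<kappa>_def by (rule mker_integral_pos[OF \<alpha>])
  define m where "m = mu CARD('n) \<alpha>"
  have m: "0 < m" unfolding m_def using \<alpha> by (rule mu_pos)
  show ?thesis
  proof (rule that[of "m * \<kappa> / C"])
    show "0 < m * \<kappa> / C" using m \<kappa> C by simp
    fix f g :: "real^'n \<Rightarrow> real" and p V \<rho> and x0 :: "real^'n"
    assume f: "f \<in> Lp p" and p: "1 \<le> p" and V: "frac_variation \<alpha> f \<le> ereal V"
      and g: "continuous_on UNIV g" "\<And>x. \<bar>g x\<bar> \<le> norm x powr (- \<alpha>)" "\<And>x. \<rho> < norm x \<Longrightarrow> g x = 0"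
    have gi: "integrable lborel g" using g(1,3) by (rule continuous_compact_support_integrable)
    have gm: "g \<in> borel_measurable borel" using g(1) by (rule borel_measurable_continuous_onI)
    have fm: "f \<in> borel_measurable lebesgue" using f by (simp add: Lp_def)
    obtain G where G: "0 < G" "\<And>x. norm (g x) \<le> G"
      using compact_support_bounded[OF g(1,3)] by metis
    obtain C1 where C1: "0 \<le> C1" "\<And>t y. 0 < t \<Longrightarrow> t \<le> 1 \<Longrightarrow> \<bar>appr \<alpha> g t y\<bar> \<le> C1 * (1 + norm y) powr (- n)"
      using appr_near[OF g(1,3) gi] unfolding nD by metis
    obtain C2 where C2: "0 \<le> C2" "\<And>t y. 1 \<le> t \<Longrightarrow> \<bar>appr \<alpha> g t y\<bar> \<le> C2 * (1 + norm y) powr (- n)"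
      "\<And>t y. 1 \<le> t \<Longrightarrow> \<bar>appr \<alpha> g t y\<bar> \<le> C2 * t powr (- n)"
      using appr_far[OF gi g(3)] unfolding nD by metis
    define C3 where "C3 = C1 + C2"
    have app: "\<bar>appr \<alpha> g t y\<bar> \<le> C3 * (1 + norm y) powr (- n)" if "0 < t" for t y
    proof (cases "t \<le> 1")
      case True
      have "C1 * (1 + norm y) powr (- n) \<le> C3 * (1 + norm y) powr (- n)"
        using C2(1) by (intro mult_right_mono) (auto simp: C3_def)
      then show ?thesis using C1(2)[OF that True, of y] by linarith
    next
      case False
      have "C2 * (1 + norm y) powr (- n) \<le> C3 * (1 + norm y) powr (- n)"
        using C1(1) by (intro mult_right_mono) (auto simp: C3_def)
      then show ?thesis using C2(2)[of t y] False by linarith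
    qed
    have n0: "0 < n" by (simp add: n_def)
    have "n * (1 - 1 / p) < n" using p n0 by (simp add: field_simps)
    then have dom0: "integrable lebesgue (\<lambda>x. f x * (1 + norm (x - x0)) powr (- n))"
      using Lp_weight_integrable[OF f p, of n x0] n0 by (simp add: n_def)
    have dom: "integrable lebesgue (\<lambda>x. C3 * \<bar>f x * (1 + norm (x - x0)) powr (- n)\<bar>)"
      using integrable_abs[OF dom0] by (rule integrable_mult_right)
    have meas: "(\<lambda>x. f x * appr \<alpha> g t (x - x0)) \<in> borel_measurable lebesgue" for t
    proof (rule borel_measurable_times[OF fm lebesgue_borelI])
      note [measurable] = appr_measurable[OF gm]
      show "(\<lambda>x. appr \<alpha> g t (x - x0)) \<in> borel_measurable borel" by measurable
    qed
    have bnd: "norm (f x * appr \<alpha> g t (x - x0)) \<le> C3 * \<bar>f x * (1 + norm (x - x0)) powr (- n)\<bar>" if "0 < t" for t x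
      using mult_left_mono[OF app[OF that, of "x - x0"], of "\<bar>f x\<bar>"] by (simp add: abs_mult ac_simps)
    have int: "integrable lebesgue (\<lambda>x. f x * appr \<alpha> g t (x - x0))" if "0 < t" for t
      by (rule Bochner_Integration.integrable_bound[OF dom meas])
        (use order_trans[OF bnd[OF that] abs_ge_self] in auto)
    have key: "m * ((\<integral>x. f x * appr \<alpha> g ((1 / 2) ^ k) (x - x0) \<partial>lebesgue) -
        (\<integral>x. f x * appr \<alpha> g (2 ^ k) (x - x0) \<partial>lebesgue)) \<le> C * V" for k
    proof -
      \<comment> \<open>Starting at \<epsilon> = 2^(-k), 2k doublings reach the scale 2^k.\<close>
      have "(1 / 2) ^ k * 2 ^ (2 * k) = (2::real) ^ k"
        by (simp add: power_mult power_divide power_mult_distrib[symmetric] field_simps)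
          (simp add: power2_eq_square power_mult_distrib[symmetric])
      then obtain \<phi> where \<phi>: "\<phi> \<in> Cc_infinity" "\<And>x. norm (\<phi> x) \<le> C"
        "\<And>x. fdiv \<alpha> \<phi> x = appr \<alpha> g ((1 / 2) ^ k) x - appr \<alpha> g (2 ^ k) x"
        using C(2)[where g=g and \<rho>=\<rho> and \<epsilon>="(1 / 2) ^ k" and N="2 * k"] gi g(2,3) by auto
      have \<phi>C: "(\<lambda>x. \<phi> (x - x0)) \<in> Cc_infinity"
        using Cc_infinity_affine[OF \<phi>(1), of 1 "- x0"] by simp
      have "m * (\<integral>x. f x * fdiv \<alpha> (\<lambda>x. \<phi> (x - x0)) x \<partial>lebesgue) \<le> C * V"
        unfolding m_def by (rule variation_test[OF V \<phi>C]) (use \<phi> C in auto)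
      also have "(\<integral>x. f x * fdiv \<alpha> (\<lambda>x. \<phi> (x - x0)) x \<partial>lebesgue) =
          (\<integral>x. f x * appr \<alpha> g ((1 / 2) ^ k) (x - x0) \<partial>lebesgue) - (\<integral>x. f x * appr \<alpha> g (2 ^ k) (x - x0) \<partial>lebesgue)"
        unfolding fdiv_translate[OF \<alpha>] \<phi>(3) right_diff_distrib
        by (rule Bochner_Integration.integral_diff) (auto intro: int)
      finally show ?thesis .
    qed
    have lim1: "(\<lambda>k. \<integral>x. f x * appr \<alpha> g ((1 / 2) ^ k) (x - x0) \<partial>lebesgue) \<longlonglongrightarrow> (\<integral>x. f x * (g (x - x0) * \<kappa>) \<partial>lebesgue)"
    proof (rule integral_dominated_convergence[OF _ meas dom])
      have "(\<lambda>x. g (x - x0) * \<kappa>) \<in> borel_measurable borel" using gm by measurable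
      then show "(\<lambda>x. f x * (g (x - x0) * \<kappa>)) \<in> borel_measurable lebesgue"
        by (intro borel_measurable_times[OF fm lebesgue_borelI])
      show "AE x in lebesgue. (\<lambda>k. f x * appr \<alpha> g ((1 / 2) ^ k) (x - x0)) \<longlonglongrightarrow> f x * (g (x - x0) * \<kappa>)"
        using appr_tendsto[OF g(1), of G] G(2) unfolding \<kappa>_def by (intro AE_I2 tendsto_mult tendsto_const) simp
      show "AE x in lebesgue. norm (f x * appr \<alpha> g ((1 / 2) ^ k) (x - x0)) \<le> C3 * \<bar>f x * (1 + norm (x - x0)) powr (- n)\<bar>" for k
        by (intro AE_I2 bnd) simp
    qed
    have lim2: "(\<lambda>k. \<integral>x. f x * appr \<alpha> g (2 ^ k) (x - x0) \<partial>lebesgue) \<longlonglongrightarrow> (\<integral>x. 0 \<partial>(lebesgue :: (real^'n) measure))"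
    proof (rule integral_dominated_convergence[OF _ meas dom])
      show "AE x in lebesgue. (\<lambda>k. f x * appr \<alpha> g (2 ^ k) (x - x0)) \<longlonglongrightarrow> 0"
      proof (rule AE_I2)
        fix x
        have "(\<lambda>k. appr \<alpha> g (2 ^ k) (x - x0)) \<longlonglongrightarrow> 0"
        proof (rule Lim_null_comparison)
          show "\<forall>\<^sub>F k in sequentially. norm (appr \<alpha> g (2 ^ k) (x - x0)) \<le> C2 * (1 / 2) ^ k"
          proof (intro always_eventually allI)
            fix k
            have "norm (appr \<alpha> g (2 ^ k) (x - x0)) \<le> C2 * (2 ^ k) powr (- n)" using C2(3)[of "2 ^ k" "x - x0"] by simp
            also have "\<dots> \<le> C2 * (2 ^ k) powr (- 1)"
              using C2(1) dim by (intro mult_left_mono powr_mono) (auto simp: n_def)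
            also have "(2 ^ k) powr (- 1) = (1 / 2 :: real) ^ k" by (subst powr_minus) (simp add: power_one_over inverse_eq_divide)
            finally show "norm (appr \<alpha> g (2 ^ k) (x - x0)) \<le> C2 * (1 / 2) ^ k" .
          qed
          show "(\<lambda>k. C2 * (1 / 2) ^ k) \<longlonglongrightarrow> 0" by (intro tendsto_mult_right_zero LIMSEQ_power_zero) simp
        qed
        then show "(\<lambda>k. f x * appr \<alpha> g (2 ^ k) (x - x0)) \<longlonglongrightarrow> 0" by (rule tendsto_mult_right_zero)
      qed
      show "AE x in lebesgue. norm (f x * appr \<alpha> g (2 ^ k) (x - x0)) \<le> C3 * \<bar>f x * (1 + norm (x - x0)) powr (- n)\<bar>" for k
        by (intro AE_I2 bnd) simp
    qed simp
    have "(\<lambda>k. m * ((\<integral>x. f x * appr \<alpha> g ((1 / 2) ^ k) (x - x0) \<partial>lebesgue) -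
        (\<integral>x. f x * appr \<alpha> g (2 ^ k) (x - x0) \<partial>lebesgue))) \<longlonglongrightarrow>
        m * ((\<integral>x. f x * (g (x - x0) * \<kappa>) \<partial>lebesgue) - (\<integral>x. 0 \<partial>(lebesgue :: (real^'n) measure)))"
      by (intro tendsto_mult tendsto_diff tendsto_const lim1 lim2)
    then have "m * ((\<integral>x. f x * (g (x - x0) * \<kappa>) \<partial>lebesgue) - (\<integral>x. 0 \<partial>(lebesgue :: (real^'n) measure))) \<le> C * V"
      by (rule LIMSEQ_le_const2) (use key in blast)
    then have "m * (\<integral>x. f x * (g (x - x0) * \<kappa>) \<partial>lebesgue) \<le> C * V" by simp
    moreover have "(\<integral>x. f x * (g (x - x0) * \<kappa>) \<partial>lebesgue) = (\<integral>x. f x * g (x - x0) \<partial>lebesgue) * \<kappa>"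
      by (simp add: mult.assoc[symmetric])
    ultimately show "m * \<kappa> / C * (\<integral>x. f x * g (x - x0) \<partial>lebesgue) \<le> V"
      using C(1) by (simp add: field_simps)
  qed
qed

text \<open>The optimal choice g = sgn(f) w is not continuous. It is approached almost everywhere by
  continuous functions below the same weight, and dominated convergence carries the dual bound
  over.\<close>

lemma weighted_bound:
  assumes dim: "2 \<le> CARD('n)"
  obtains c where "0 < c" "\<And>(f :: real^'n \<Rightarrow> real) p V w \<rho> x0. \<lbrakk>f \<in> Lp p; 1 \<le> p; frac_variation \<alpha> f \<le> ereal V;
    continuous_on UNIV w; \<And>x. 0 \<le> w x; \<And>x. w x \<le> norm x powr (- \<alpha>); \<And>x. \<rho> < norm x \<Longrightarrow> w x = 0\<rbrakk> \<Longrightarrow>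
    c * (\<integral>x. \<bar>f x\<bar> * w (x - x0) \<partial>lebesgue) \<le> V \<and> integrable lebesgue (\<lambda>x. \<bar>f x\<bar> * w (x - x0))"
proof -
  obtain c where c: "0 < c" "\<And>(f :: real^'n \<Rightarrow> real) p V g \<rho> x0. \<lbrakk>f \<in> Lp p; 1 \<le> p; frac_variation \<alpha> f \<le> ereal V;
    continuous_on UNIV g; \<And>x. \<bar>g x\<bar> \<le> norm x powr (- \<alpha>); \<And>x. \<rho> < norm x \<Longrightarrow> g x = 0\<rbrakk> \<Longrightarrow>
    c * (\<integral>x. f x * g (x - x0) \<partial>lebesgue) \<le> V"
    using dual_bound[OF dim] by blast
  show ?thesis
  proof (rule that[OF c(1)])
    fix f w :: "real^'n \<Rightarrow> real" and p V \<rho> and x0 :: "real^'n"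
    assume f: "f \<in> Lp p" and p: "1 \<le> p" and V: "frac_variation \<alpha> f \<le> ereal V"
      and w: "continuous_on UNIV w" "\<And>x. 0 \<le> w x" "\<And>x. w x \<le> norm x powr (- \<alpha>)" "\<And>x. \<rho> < norm x \<Longrightarrow> w x = 0"
    have fm: "f \<in> borel_measurable lebesgue" using f by (simp add: Lp_def)
    have [measurable]: "w \<in> borel_measurable borel" using w(1) by (rule borel_measurable_continuous_onI)
    have "(\<lambda>x. w (x - x0)) \<in> borel_measurable borel" by measurable
    then have wm: "(\<lambda>x. w (x - x0)) \<in> borel_measurable lebesgue" by (rule lebesgue_borelI)
    obtain G where G: "0 < G" "\<And>x. norm (w x) \<le> G"
      using compact_support_bounded[OF w(1,4)] by metis
    define n where "n = real CARD('n)"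
    have n0: "0 < n" by (simp add: n_def)
    define R where "R = 1 + \<bar>\<rho>\<bar>"
    have "w x \<le> G * R powr n * (1 + norm x) powr (- n)" for x
    proof (cases "norm x \<le> \<rho>")
      case True
      have "(1 + norm x) powr n \<le> R powr n" using True n0 by (intro powr_mono2) (auto simp: R_def)
      moreover have "0 < 1 + norm x" by (simp add: add_pos_nonneg)
      ultimately have "1 \<le> R powr n * (1 + norm x) powr (- n)" by (simp add: powr_minus field_simps)
      from mult_left_mono[OF this, of G] have "G \<le> G * R powr n * (1 + norm x) powr (- n)"
        using G(1) by (simp add: mult.assoc)
      moreover have "w x \<le> G" using G(2)[of x] abs_ge_self[of "w x"] by simp
      ultimately show ?thesis by linarith
    next
      case False
      then show ?thesis using w(4)[of x] G(1) by simp
    qed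
    note w_dec = this
    have "n * (1 - 1 / p) < n" using p n0 by (simp add: field_simps)
    then have dom0: "integrable lebesgue (\<lambda>x. f x * (1 + norm (x - x0)) powr (- n))"
      using Lp_weight_integrable[OF f p, of n x0] n0 by (simp add: n_def)
    have fwi: "integrable lebesgue (\<lambda>x. \<bar>f x\<bar> * w (x - x0))"
    proof (rule Bochner_Integration.integrable_bound)
      show "integrable lebesgue (\<lambda>x. G * R powr n * (f x * (1 + norm (x - x0)) powr (- n)))"
        using dom0 by (rule integrable_mult_right)
      show "(\<lambda>x. \<bar>f x\<bar> * w (x - x0)) \<in> borel_measurable lebesgue"
        using borel_measurable_abs[OF fm] wm by (rule borel_measurable_times)
      show "AE x in lebesgue. norm (\<bar>f x\<bar> * w (x - x0)) \<le> norm (G * R powr n * (f x * (1 + norm (x - x0)) powr (- n)))"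
      proof (rule AE_I2)
        fix x
        show "norm (\<bar>f x\<bar> * w (x - x0)) \<le> norm (G * R powr n * (f x * (1 + norm (x - x0)) powr (- n)))"
          using mult_left_mono[OF w_dec[of "x - x0"], of "\<bar>f x\<bar>"] w(2)[of "x - x0"] G(1) by (simp add: abs_mult ac_simps)
      qed
    qed
    \<comment> \<open>Measurability in this form yields continuous functions converging to the sign
      off a negligible set. The sign is shifted by x0 because g is later evaluated at x -
      x0.\<close>
    have "(\<lambda>x. sgn (f (x + x0))) \<in> borel_measurable lebesgue"
    proof -
      have t: "(\<lambda>x. x + x0) \<in> lebesgue \<rightarrow>\<^sub>M lebesgue"
        using lebesgue_affine_measurable[of "\<lambda>_. 1" x0] by (simp add: euclidean_representation add.commute)
      show ?thesis by (rule measurable_compose[OF measurable_compose[OF t fm] borel_measurable_sgn])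
    qed
    then have "(\<lambda>x. sgn (f (x + x0))) measurable_on UNIV"
      by (simp add: measurable_on_iff_borel_measurable lebesgue_on_UNIV_eq)
    then obtain N h where N: "negligible N" and h: "\<And>i. continuous_on UNIV (h i)"
      "\<And>x. x \<notin> N \<Longrightarrow> (\<lambda>i. h i x) \<longlonglongrightarrow> sgn (f (x + x0))"
      unfolding measurable_on_def by auto
    \<comment> \<open>Clipping to [-1, 1] keeps |g| below w and does not affect the limit, which is
      a sign.\<close>
    define g where "g = (\<lambda>i x. max (- 1) (min 1 (h i x)) * w x)"
    have g1: "\<bar>max (- 1) (min 1 (h i x))\<bar> \<le> 1" for i x by auto
    have gw: "\<bar>g i x\<bar> \<le> w x" for i x
      unfolding g_def abs_mult using mult_right_mono[OF g1, of "\<bar>w x\<bar>"] w(2)[of x] by simp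
    have gc: "continuous_on UNIV (g i)" for i
      unfolding g_def by (intro continuous_intros h w)
    have le: "c * (\<integral>x. f x * g i (x - x0) \<partial>lebesgue) \<le> V" for i
    proof (rule c(2)[OF f p V gc])
      show "\<bar>g i x\<bar> \<le> norm x powr (- \<alpha>)" for x using gw[of i x] w(3)[of x] by linarith
      show "g i x = 0" if "\<rho> < norm x" for x using w(4)[OF that] by (simp add: g_def)
    qed
    have "(\<lambda>i. \<integral>x. f x * g i (x - x0) \<partial>lebesgue) \<longlonglongrightarrow> (\<integral>x. \<bar>f x\<bar> * w (x - x0) \<partial>lebesgue)"
    proof (rule integral_dominated_convergence[OF _ _ fwi])
      show "(\<lambda>x. \<bar>f x\<bar> * w (x - x0)) \<in> borel_measurable lebesgue"
        using borel_measurable_abs[OF fm] wm by (rule borel_measurable_times)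
      show "(\<lambda>x. f x * g i (x - x0)) \<in> borel_measurable lebesgue" for i
      proof (rule borel_measurable_times[OF fm lebesgue_borelI])
        have [measurable]: "g i \<in> borel_measurable borel" using gc by (rule borel_measurable_continuous_onI)
        show "(\<lambda>x. g i (x - x0)) \<in> borel_measurable borel" by measurable
      qed
      show "AE x in lebesgue. norm (f x * g i (x - x0)) \<le> \<bar>f x\<bar> * w (x - x0)" for i
        using gw by (auto simp: abs_mult intro!: mult_left_mono)
      have "negligible ((\<lambda>x. x0 + x) ` N)" using N by (simp add: negligible_translation)
      then have "AE x in lebesgue. x \<notin> (\<lambda>x. x0 + x) ` N"
        by (simp add: negligible_iff_null_sets AE_not_in)
      then show "AE x in lebesgue. (\<lambda>i. f x * g i (x - x0)) \<longlonglongrightarrow> \<bar>f x\<bar> * w (x - x0)"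
      proof eventually_elim
        fix x assume "x \<notin> (\<lambda>x. x0 + x) ` N"
        then have "x - x0 \<notin> N" using image_eqI[of x "\<lambda>x. x0 + x" "x - x0" N] by auto
        then have "(\<lambda>i. h i (x - x0)) \<longlonglongrightarrow> sgn (f x)" using h(2)[of "x - x0"] by simp
        then have "(\<lambda>i. max (- 1) (min 1 (h i (x - x0)))) \<longlonglongrightarrow> max (- 1) (min 1 (sgn (f x)))"
          by (intro tendsto_max tendsto_min tendsto_const)
        also have "max (- 1) (min 1 (sgn (f x))) = sgn (f x)" by (simp add: sgn_if)
        finally have "(\<lambda>i. f x * (max (- 1) (min 1 (h i (x - x0))) * w (x - x0))) \<longlonglongrightarrow> f x * (sgn (f x) * w (x - x0))"
          by (intro tendsto_mult tendsto_const)
        then show "(\<lambda>i. f x * g i (x - x0)) \<longlonglongrightarrow> \<bar>f x\<bar> * w (x - x0)"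
          by (simp add: g_def mult.assoc[symmetric] mult_sgn_abs abs_sgn[symmetric])
      qed
    qed
    then have "(\<lambda>i. c * (\<integral>x. f x * g i (x - x0) \<partial>lebesgue)) \<longlonglongrightarrow> c * (\<integral>x. \<bar>f x\<bar> * w (x - x0) \<partial>lebesgue)"
      by (intro tendsto_mult tendsto_const)
    then have "c * (\<integral>x. \<bar>f x\<bar> * w (x - x0) \<partial>lebesgue) \<le> V"
      by (rule LIMSEQ_le_const2) (use le in blast)
    then show "c * (\<integral>x. \<bar>f x\<bar> * w (x - x0) \<partial>lebesgue) \<le> V \<and> integrable lebesgue (\<lambda>x. \<bar>f x\<bar> * w (x - x0))"
      using fwi by auto
  qed
qed

text \<open>Compactly supported continuous weights below |x|^(-\<alpha>) converge to it off the
  origin; Fatou's lemma then bounds the singular integral and proves its finiteness.\<close>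

lemma hardy_higher_dim:
  assumes dim: "2 \<le> CARD('n)"
  obtains c where "0 < c" "\<And>(f :: real^'n \<Rightarrow> real) p V x0. \<lbrakk>f \<in> Lp p; 1 \<le> p; frac_variation \<alpha> f \<le> ereal V\<rbrakk> \<Longrightarrow>
    (\<integral>\<^sup>+x. ennreal (\<bar>f x\<bar> / norm (x - x0) powr \<alpha>) \<partial>lebesgue) \<le> ennreal (V / c)"
proof -
  obtain c where c: "0 < c" "\<And>(f :: real^'n \<Rightarrow> real) p V w \<rho> x0. \<lbrakk>f \<in> Lp p; 1 \<le> p; frac_variation \<alpha> f \<le> ereal V;
    continuous_on UNIV w; \<And>x. 0 \<le> w x; \<And>x. w x \<le> norm x powr (- \<alpha>); \<And>x. \<rho> < norm x \<Longrightarrow> w x = 0\<rbrakk> \<Longrightarrow>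
    c * (\<integral>x. \<bar>f x\<bar> * w (x - x0) \<partial>lebesgue) \<le> V \<and> integrable lebesgue (\<lambda>x. \<bar>f x\<bar> * w (x - x0))"
    using weighted_bound[OF dim] by blast
  show ?thesis
  proof (rule that[OF c(1)])
    fix f :: "real^'n \<Rightarrow> real" and p V and x0 :: "real^'n"
    assume f: "f \<in> Lp p" and p: "1 \<le> p" and V: "frac_variation \<alpha> f \<le> ereal V"
    have fm: "f \<in> borel_measurable lebesgue" using f by (simp add: Lp_def)
    \<comment> \<open>The first factor caps the singularity and the last cuts off at infinity. The
      middle one forces the value 0 at the origin, since the required upper bound
      \<open>norm x powr (- \<alpha>)\<close> is 0 there.\<close>
    define w where "w = (\<lambda>k. \<lambda>x::real^'n. max (norm x) (1 / real (Suc k)) powr (- \<alpha>) *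
        (min 1 (real (Suc k) * norm x) * max 0 (min 1 (real (Suc k) - norm x))))"
    have w0: "0 \<le> w k x" for k x by (simp add: w_def)
    have wle: "w k x \<le> norm x powr (- \<alpha>)" for k x
    proof (cases "x = 0")
      case False
      have "max (norm x) (1 / real (Suc k)) powr (- \<alpha>) \<le> norm x powr (- \<alpha>)"
        using False \<alpha> by (intro powr_mono2') auto
      moreover have "min 1 (real (Suc k) * norm x) * max 0 (min 1 (real (Suc k) - norm x)) \<le> 1"
        by (intro mult_le_one) auto
      ultimately have "w k x \<le> norm x powr (- \<alpha>) * 1" unfolding w_def by (intro mult_mono) auto
      then show ?thesis by simp
    qed (simp add: w_def)
    have wc: "continuous_on UNIV (w k)" for k
    proof -
      have "max (norm x) (1 / real (Suc k)) \<noteq> 0" for x :: "real^'n"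
      proof -
        have "0 < 1 / real (Suc k)" by simp
        then show ?thesis by (metis max.cobounded2 not_less)
      qed
      then show ?thesis unfolding w_def by (intro continuous_intros) auto
    qed
    have ws: "w k x = 0" if "real (Suc k) < norm x" for k x using that by (simp add: w_def)
    have wlim: "(\<lambda>k. w k x) \<longlonglongrightarrow> norm x powr (- \<alpha>)" if x: "x \<noteq> 0" for x
    proof -
      obtain k0 where k0: "max (norm x + 1) (1 / norm x) < real k0" using reals_Archimedean2 by blast
      have "w k x = norm x powr (- \<alpha>)" if "k0 \<le> k" for k
      proof -
        have k: "norm x + 1 < real (Suc k)" "1 / norm x < real (Suc k)" using k0 that by auto
        have "1 < real (Suc k) * norm x" using k(2) x by (simp add: divide_less_eq)
        moreover have "1 / real (Suc k) \<le> norm x" using calculation by (simp add: divide_le_eq mult.commute)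
        ultimately show ?thesis using k(1) by (simp add: w_def max_def min_def)
      qed
      then show ?thesis
        by (intro tendsto_eventually) (auto simp: eventually_sequentially)
    qed
    have wb: "(\<integral>\<^sup>+x. ennreal (\<bar>f x\<bar> * w k (x - x0)) \<partial>lebesgue) \<le> ennreal (V / c)" for k
    proof -
      have b: "c * (\<integral>x. \<bar>f x\<bar> * w k (x - x0) \<partial>lebesgue) \<le> V" and i: "integrable lebesgue (\<lambda>x. \<bar>f x\<bar> * w k (x - x0))"
        using c(2)[OF f p V wc w0 wle ws] by auto
      have "(\<integral>\<^sup>+x. ennreal (\<bar>f x\<bar> * w k (x - x0)) \<partial>lebesgue) = ennreal (\<integral>x. \<bar>f x\<bar> * w k (x - x0) \<partial>lebesgue)"
        by (rule nn_integral_eq_integral[OF i]) (simp add: w0)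
      also have "\<dots> \<le> ennreal (V / c)" using b c(1) by (intro ennreal_leI) (simp add: field_simps)
      finally show ?thesis .
    qed
    have "(\<integral>\<^sup>+x. ennreal (\<bar>f x\<bar> / norm (x - x0) powr \<alpha>) \<partial>lebesgue) \<le>
        (\<integral>\<^sup>+x. liminf (\<lambda>k. ennreal (\<bar>f x\<bar> * w k (x - x0))) \<partial>lebesgue)"
    proof (rule nn_integral_mono)
      fix x
      have "(\<lambda>k. \<bar>f x\<bar> * w k (x - x0)) \<longlonglongrightarrow> \<bar>f x\<bar> / norm (x - x0) powr \<alpha>" if "x \<noteq> x0"
        using tendsto_mult[OF tendsto_const wlim, of "x - x0" "\<bar>f x\<bar>"] that by (simp add: powr_minus divide_inverse)
      then have "liminf (\<lambda>k. ennreal (\<bar>f x\<bar> * w k (x - x0))) = ennreal (\<bar>f x\<bar> / norm (x - x0) powr \<alpha>)" if "x \<noteq> x0"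
        using that by (intro lim_imp_Liminf tendsto_ennrealI) auto
      then show "ennreal (\<bar>f x\<bar> / norm (x - x0) powr \<alpha>) \<le> liminf (\<lambda>k. ennreal (\<bar>f x\<bar> * w k (x - x0)))"
        \<comment> \<open>At x = x0 the left side is a division by \<open>0 powr \<alpha>\<close>,
          hence 0.\<close>
        by (cases "x = x0") auto
    qed
    also have "\<dots> \<le> liminf (\<lambda>k. \<integral>\<^sup>+x. ennreal (\<bar>f x\<bar> * w k (x - x0)) \<partial>lebesgue)"
    proof (rule nn_integral_liminf)
      fix k
      have [measurable]: "w k \<in> borel_measurable borel" using wc by (rule borel_measurable_continuous_onI)
      have "(\<lambda>x. w k (x - x0)) \<in> borel_measurable borel" by measurable
      then have "(\<lambda>x. \<bar>f x\<bar> * w k (x - x0)) \<in> borel_measurable lebesgue"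
        by (intro borel_measurable_times borel_measurable_abs fm lebesgue_borelI)
      then show "(\<lambda>x. ennreal (\<bar>f x\<bar> * w k (x - x0))) \<in> borel_measurable lebesgue" by simp
    qed
    also have "\<dots> \<le> ennreal (V / c)"
      by (intro Liminf_le) (auto simp: wb)
    finally show "(\<integral>\<^sup>+x. ennreal (\<bar>f x\<bar> / norm (x - x0) powr \<alpha>) \<partial>lebesgue) \<le> ennreal (V / c)" .
  qed
qed

end

subsection \<open>Dimension one\<close>

text \<open>One-dimensionality is expressed by a singleton basis; the coordinate along e transports
  integrals to the real line, where explicit powers can be integrated.\<close>

lemma lborel_dim1:
  fixes e :: "'a::euclidean_space"
  assumes e: "Basis = {e}"
  shows "lborel = distr lborel borel (\<lambda>t::real. t *\<^sub>R e)"
proof (rule lborel_eqI)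
  fix l u :: 'a assume lu: "\<And>b. b \<in> Basis \<Longrightarrow> l \<bullet> b \<le> u \<bullet> b"
  have ee: "e \<bullet> e = 1" by (rule inner_same_Basis) (simp add: e)
  have "(\<lambda>t. t *\<^sub>R e) -` box l u = {l \<bullet> e<..<u \<bullet> e}" by (auto simp: box_def e ee)
  then show "emeasure (distr lborel borel (\<lambda>t. t *\<^sub>R e)) (box l u) = (\<Prod>b\<in>Basis. (u - l) \<bullet> b)"
    using lu by (simp add: emeasure_distr e inner_diff_left)
qed simp

lemma nn_integral_dim1:
  fixes e :: "'a::euclidean_space"
  assumes e: "Basis = {e}" and "F \<in> borel_measurable borel"
  shows "(\<integral>\<^sup>+x. F x \<partial>lborel) = (\<integral>\<^sup>+(t::real). F (t *\<^sub>R e) \<partial>lborel)"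
  using assms(2) by (subst lborel_dim1[OF e]) (simp add: nn_integral_distr)

lemma nn_integral_powr_tail:
  assumes "0 < \<alpha>" "0 < a"
  shows "(\<integral>\<^sup>+t. ennreal (t powr (- 1 - \<alpha>)) * indicator {a..} t \<partial>lborel) = ennreal (a powr (- \<alpha>) / \<alpha>)"
proof -
  have "((\<lambda>t. t powr (- 1 - \<alpha>)) has_integral - (a powr (- 1 - \<alpha> + 1)) / (- 1 - \<alpha> + 1)) {a..}"
    using assms by (intro has_integral_powr_to_inf) auto
  then have "((\<lambda>t. t powr (- 1 - \<alpha>)) has_integral a powr (- \<alpha>) / \<alpha>) {a..}" using assms by simp
  from nn_integral_has_integral_lebesgue'[OF _ this] show ?thesis by simp
qed

lemma nn_integral_powr_head:
  assumes "\<alpha> < 1"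
  shows "(\<integral>\<^sup>+t. ennreal (t powr (- \<alpha>)) * indicator {0..1} t \<partial>lborel) = ennreal (1 / (1 - \<alpha>))"
proof -
  have "((\<lambda>t. t powr (- \<alpha>)) has_integral 1 powr (- \<alpha> + 1) / (- \<alpha> + 1)) {0..1}"
    using assms by (intro has_integral_powr_from_0) auto
  then have "((\<lambda>t. t powr (- \<alpha>)) has_integral 1 / (1 - \<alpha>)) {0..1}" by (simp add: add.commute)
  from nn_integral_has_integral_lebesgue'[OF _ this] show ?thesis by simp
qed

lemma nn_integral_reflect:
  fixes f :: "real \<Rightarrow> ennreal"
  assumes "f \<in> borel_measurable borel"
  shows "(\<integral>\<^sup>+t. f (- t) \<partial>lborel) = (\<integral>\<^sup>+t. f t \<partial>lborel)"
  using nn_integral_affine[OF assms, of "-1" 0] by simp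

text \<open>For q = 1/2 the field is a smooth version of z/|z|, the sign in dimension one. The exact
  bound 1 is needed, as any larger bound would spoil the sharp constant.\<close>

lemma norm_sker_half_le: "norm (sker (1 / 2) z) \<le> 1"
proof -
  have "norm z = ((norm z)\<^sup>2) powr (1 / 2)" by (simp add: powr_half_sqrt)
  also have "\<dots> \<le> smod z powr (1 / 2)" by (intro powr_mono2 smod_ge) auto
  finally have "smod z powr (- (1 / 2)) * norm z \<le> smod z powr (- (1 / 2)) * smod z powr (1 / 2)"
    by (intro mult_left_mono) auto
  also have "\<dots> = 1" using smod_pos[of z] by (simp add: powr_add[symmetric])
  finally show ?thesis by (simp add: sker_def)
qed

text \<open>Kernel and dilate are nonnegative multiples of the same vector z, both of norm at most
  1, so their difference has norm at most 1 and not merely 2.\<close>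

lemma bumpf_half_le:
  assumes "0 < t"
  shows "norm (bumpf (1 / 2) t z) \<le> 1"
proof -
  define a b where "a = smod z powr (- (1 / 2))" and "b = smod (z /\<^sub>R t) powr (- (1 / 2)) / t"
  have ab: "0 \<le> a" "0 \<le> b" using assms by (auto simp: a_def b_def)
  have a: "sker (1 / 2) z = a *\<^sub>R z" and b: "sker (1 / 2) (z /\<^sub>R t) = b *\<^sub>R z"
    by (simp_all only: sker_def a_def b_def divide_inverse scaleR_scaleR)
  have "a * norm z \<le> 1" "b * norm z \<le> 1"
    using norm_sker_half_le[of z] norm_sker_half_le[of "z /\<^sub>R t"] ab unfolding a b by auto
  moreover have "0 \<le> a * norm z" "0 \<le> b * norm z" using ab by auto
  moreover have "norm (bumpf (1 / 2) t z) = \<bar>a * norm z - b * norm z\<bar>"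
    using assms unfolding bumpf_def a b scaleR_scaleR scaleR_diff_left[symmetric] by (simp add: abs_mult left_diff_distrib[symmetric])
  ultimately show ?thesis by linarith
qed

text \<open>In the coordinate s the field is s divided by the root of \<open>smod\<close>. Its
  square s^2/\<open>smod\<close> is increasing for s \<ge> 0: after cross-multiplication the terms
  s^2 t^2 cancel and only flat terms are compared. Oddness extends this to the line.\<close>

lemma sker_half_mono:
  fixes x z :: "'a::euclidean_space"
  assumes e: "Basis = {e::'a}"
  shows "0 \<le> z \<bullet> (sker (1 / 2) (x + z) - sker (1 / 2) x)"
proof -
  have ee: "e \<bullet> e = 1" by (rule inner_same_Basis) (simp add: e)
  have ne: "norm e = 1" by (simp add: norm_eq_sqrt_inner ee)
  define k where "k = (\<lambda>s::real. smod (s *\<^sub>R e) powr (- (1 / 2)) * s)"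
  have k_minus: "k (- s) = - k s" for s
    using smod_cong[of "(- s) *\<^sub>R e" "s *\<^sub>R e"] by (simp add: k_def)
  have k0: "0 \<le> k s" if "0 \<le> s" for s using that by (simp add: k_def)
  have pos: "k s \<le> k t" if "0 \<le> s" "s \<le> t" for s t
  proof (rule power2_le_imp_le[OF _ k0])
    have sq: "(k s)\<^sup>2 = s\<^sup>2 / smod (s *\<^sub>R e)" for s
    proof -
      have "(smod (s *\<^sub>R e) powr (- (1 / 2)))\<^sup>2 = smod (s *\<^sub>R e) powr (- 1)"
        unfolding power2_eq_square powr_add[symmetric] by simp
      also have "\<dots> = inverse (smod (s *\<^sub>R e))" using smod_pos[of "s *\<^sub>R e"] by (subst powr_minus) simp
      finally show ?thesis by (simp only: k_def power_mult_distrib divide_inverse mult.commute)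
    qed
    have st: "s\<^sup>2 \<le> t\<^sup>2" using that by (intro power_mono) auto
    have "s\<^sup>2 * flat 0 (1 - t\<^sup>2) \<le> t\<^sup>2 * flat 0 (1 - s\<^sup>2)"
      using st by (intro mult_mono flat0_mono flat_nonneg) auto
    then have "s\<^sup>2 * smod (t *\<^sub>R e) \<le> t\<^sup>2 * smod (s *\<^sub>R e)"
      by (simp add: smod_def ne distrib_left)
    then show "(k s)\<^sup>2 \<le> (k t)\<^sup>2"
      unfolding sq using smod_pos[of "s *\<^sub>R e"] smod_pos[of "t *\<^sub>R e"] by (simp add: field_simps)
    show "0 \<le> t" using that by simp
  qed
  have mono: "k s \<le> k t" if "s \<le> t" for s t
  proof -
    consider "0 \<le> s" | "s \<le> 0" "0 \<le> t" | "t \<le> 0" using that by linarith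
    then show ?thesis
    proof cases
      case 2 then show ?thesis using k0[of t] k0[of "- s"] k_minus[of s] by simp
    next
      case 3 then show ?thesis using pos[of "- t" "- s"] that k_minus[of s] k_minus[of t] by simp
    qed (use pos that in auto)
  qed
  have rep: "y = (y \<bullet> e) *\<^sub>R e" for y :: 'a using euclidean_representation[of y] by (simp add: e)
  have K: "sker (1 / 2) y = k (y \<bullet> e) *\<^sub>R e" for y :: 'a
    using rep[of y] by (simp add: sker_def k_def) (metis scaleR_scaleR)
  define s h where "s = x \<bullet> e" and "h = z \<bullet> e"
  have "z \<bullet> (sker (1 / 2) (x + z) - sker (1 / 2) x) = h * (k (s + h) - k s)"
    by (simp add: K s_def h_def inner_add_left scaleR_diff_left[symmetric])
  also have "0 \<le> \<dots>"
  proof (cases "0 \<le> h")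
    case True then show ?thesis using mono[of s "s + h"] by simp
  next
    case False then show ?thesis using mono[of "s + h" s] by (simp add: mult_nonpos_nonpos)
  qed
  finally show ?thesis .
qed

context
  fixes \<alpha> :: real
  assumes \<alpha>: "0 < \<alpha>" "\<alpha> < 1"
begin

text \<open>Monotonicity makes the integrand nonnegative, so keeping part of it is legitimate. The
  sign jump of 2, integrated against |t|^(-1-\<alpha>) over a half-line, produces the sharp factor
  2/\<alpha>; the upper bound provides domination.\<close>

lemma fdiv_half_bounds:
  assumes e: "Basis = {e::'a::euclidean_space}"
  shows "0 \<le> fdiv \<alpha> (sker (1 / 2)) (x::'a)"
    and "1 < norm x \<Longrightarrow> 2 / \<alpha> * (norm x + 1) powr (- \<alpha>) \<le> fdiv \<alpha> (sker (1 / 2)) x"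
    and "\<exists>C\<ge>0. \<forall>x::'a. fdiv \<alpha> (sker (1 / 2)) x \<le> C * (1 + norm x) powr (- \<alpha>)"
proof -
  have ee: "e \<bullet> e = 1" by (rule inner_same_Basis) (simp add: e)
  have ne: "norm e = 1" by (simp add: norm_eq_sqrt_inner ee)
  have dim: "DIM('a) = 1" by (simp add: e)
  obtain B where B: "blip B (sker (1 / 2) :: 'a \<Rightarrow> 'a)" using blip_sker[of "1 / 2"] by auto
  have [measurable]: "(sker (1 / 2) :: 'a \<Rightarrow> 'a) \<in> borel_measurable borel" by (rule blip_measurable[OF B])
  let ?m = "fdiv \<alpha> (sker (1 / 2)) :: 'a \<Rightarrow> real"
  let ?J = "\<lambda>x z. fker \<alpha> z * (z \<bullet> (sker (1 / 2) (x + z) - sker (1 / 2) x)) :: real"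
  have J0: "0 \<le> ?J x z" for x z :: 'a using sker_half_mono[OF e] by (intro mult_nonneg_nonneg) auto
  show m0: "0 \<le> ?m x" for x unfolding fdiv_def by (intro integral_nonneg_AE) (simp add: J0)
  have mnn: "ennreal (?m x) = (\<integral>\<^sup>+(t::real). ennreal (?J x (t *\<^sub>R e)) \<partial>lborel)" for x
  proof -
    have "ennreal (?m x) = (\<integral>\<^sup>+z. ennreal (?J x z) \<partial>lborel)"
      unfolding fdiv_def by (rule nn_integral_eq_integral[OF fdiv_integrable[OF \<alpha> B], symmetric]) (simp add: J0)
    also have "\<dots> = (\<integral>\<^sup>+(t::real). ennreal (?J x (t *\<^sub>R e)) \<partial>lborel)"
      by (rule nn_integral_dim1[OF e]) measurable
    finally show ?thesis .
  qed
  have rad: "?m x = ?m (norm x *\<^sub>R e)" for x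
    by (rule fdiv_sker_radial[OF \<alpha>]) (auto simp: ne)
  have Kout: "sker (1 / 2) (s *\<^sub>R e) = sgn s *\<^sub>R e" if "1 \<le> \<bar>s\<bar>" for s
    using that by (subst sker_outside) (auto simp: ne powr_minus sgn_if)
  have fk: "fker \<alpha> (t *\<^sub>R e) = \<bar>t\<bar> powr (- 2 - \<alpha>)" for t
    by (simp add: fker_def dim ne)
  have pw: "\<bar>t\<bar> powr (- 2 - \<alpha>) * \<bar>t\<bar> = \<bar>t\<bar> powr (- 1 - \<alpha>)" for t :: real
    using powr_mult_base[of "\<bar>t\<bar>" "- 2 - \<alpha>"] by (cases "t = 0") (auto simp: mult.commute)
  have tail: "(\<integral>\<^sup>+t. ennreal (2 * \<bar>t\<bar> powr (- 1 - \<alpha>)) * indicator {..- a} t \<partial>lborel) = ennreal (2 / \<alpha> * a powr (- \<alpha>))"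
    if a: "0 < a" for a
  proof -
    have "(\<integral>\<^sup>+t. ennreal (2 * \<bar>t\<bar> powr (- 1 - \<alpha>)) * indicator {..- a} t \<partial>lborel) =
        (\<integral>\<^sup>+t. ennreal (2 * \<bar>- t\<bar> powr (- 1 - \<alpha>)) * indicator {..- a} (- t) \<partial>lborel)"
      by (rule nn_integral_reflect[symmetric]) measurable
    also have "\<dots> = (\<integral>\<^sup>+t. ennreal 2 * (ennreal (t powr (- 1 - \<alpha>)) * indicator {a..} t) \<partial>lborel)"
      using a by (intro nn_integral_cong) (auto simp: indicator_def ennreal_mult)
    also have "\<dots> = ennreal 2 * ennreal (a powr (- \<alpha>) / \<alpha>)"
      by (subst nn_integral_cmult) (auto simp: nn_integral_powr_tail[OF \<alpha>(1) a])
    also have "\<dots> = ennreal (2 / \<alpha> * a powr (- \<alpha>))" by (subst ennreal_mult'[symmetric]) simp_all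
    finally show ?thesis .
  qed
  show "2 / \<alpha> * (norm x + 1) powr (- \<alpha>) \<le> ?m x" if x: "1 < norm x"
  proof -
    define s where "s = norm x"
    have s: "1 < s" using x by (simp add: s_def)
    \<comment> \<open>Only t \<le> -(s + 1) is kept: there s + t \<le> -1, where the smooth sign is
      exactly -1, while it is 1 at s.\<close>
    have "ennreal (2 / \<alpha> * (s + 1) powr (- \<alpha>)) =
        (\<integral>\<^sup>+t. ennreal (2 * \<bar>t\<bar> powr (- 1 - \<alpha>)) * indicator {..- (s + 1)} t \<partial>lborel)"
      using s by (intro tail[symmetric]) simp
    also have "\<dots> \<le> (\<integral>\<^sup>+(t::real). ennreal (?J (s *\<^sub>R e) (t *\<^sub>R e)) \<partial>lborel)"
    proof (rule nn_integral_mono)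
      fix t :: real
      show "ennreal (2 * \<bar>t\<bar> powr (- 1 - \<alpha>)) * indicator {..- (s + 1)} t \<le> ennreal (?J (s *\<^sub>R e) (t *\<^sub>R e))"
      proof (cases "t \<le> - (s + 1)")
        case True
        have "sker (1 / 2) (s *\<^sub>R e + t *\<^sub>R e) = - e"
          unfolding scaleR_left_distrib[symmetric] using True s by (subst Kout) auto
        moreover have "sker (1 / 2) (s *\<^sub>R e) = e" using s by (subst Kout) auto
        ultimately have "?J (s *\<^sub>R e) (t *\<^sub>R e) = \<bar>t\<bar> powr (- 2 - \<alpha>) * (2 * \<bar>t\<bar>)"
          using True s by (simp add: fk inner_diff_right ee)
        also have "\<dots> = 2 * \<bar>t\<bar> powr (- 1 - \<alpha>)" using pw[of t] by simp
        finally show ?thesis using True by simp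
      qed simp
    qed
    also have "\<dots> = ennreal (?m x)" unfolding rad[of x] s_def by (rule mnn[symmetric])
    finally show ?thesis using m0[of x] by (simp add: s_def)
  qed
  show "\<exists>C\<ge>0. \<forall>x::'a. ?m x \<le> C * (1 + norm x) powr (- \<alpha>)"
  proof -
    define D where "D = 2 * B * (\<integral>z. fmaj \<alpha> (z::'a) \<partial>lborel)"
    have D: "?m x \<le> D" for x using fdiv_bounded[OF \<alpha> B, of x] unfolding D_def by linarith
    have D0: "0 \<le> D" using m0[of 0] D[of 0] by linarith
    define C where "C = (D + 2 / \<alpha>) * 3 powr \<alpha>"
    have third: "((1 + s) / 3) powr (- \<alpha>) = 3 powr \<alpha> * (1 + s) powr (- \<alpha>)" if "0 \<le> s" for s :: real
      using that by (simp add: powr_divide powr_minus field_simps)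
    have "?m x \<le> C * (1 + norm x) powr (- \<alpha>)" for x
    proof -
      define s where "s = norm x"
      have s: "0 \<le> s" by (simp add: s_def)
      have "?m x \<le> (D + 2 / \<alpha>) * ((1 + s) / 3) powr (- \<alpha>)"
      \<comment> \<open>The threshold 2 is where s - 1 = (1 + s)/3: beyond it s - 1 dominates (1 +
        s)/3, and below it (1 + s)/3 is at most 1.\<close>
      proof (cases "s \<le> 2")
        case True
        have "1 powr (- \<alpha>) \<le> ((1 + s) / 3) powr (- \<alpha>)" using True s \<alpha> by (intro powr_mono2') auto
        then have "D * 1 \<le> (D + 2 / \<alpha>) * ((1 + s) / 3) powr (- \<alpha>)" using D0 \<alpha> by (intro mult_mono) auto
        then show ?thesis using D[of x] by linarith
      next
        case False
        have "ennreal (?m x) = (\<integral>\<^sup>+(t::real). ennreal (?J (s *\<^sub>R e) (t *\<^sub>R e)) \<partial>lborel)"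
          unfolding rad[of x] s_def by (rule mnn)
        also have "\<dots> \<le> (\<integral>\<^sup>+t. ennreal (2 * \<bar>t\<bar> powr (- 1 - \<alpha>)) * indicator {..- (s - 1)} t \<partial>lborel)"
        proof (rule nn_integral_mono)
          fix t :: real
          show "ennreal (?J (s *\<^sub>R e) (t *\<^sub>R e)) \<le> ennreal (2 * \<bar>t\<bar> powr (- 1 - \<alpha>)) * indicator {..- (s - 1)} t"
          proof (cases "t \<le> - (s - 1)")
            case True
            have "norm (sker (1 / 2) (s *\<^sub>R e + t *\<^sub>R e) - sker (1 / 2) (s *\<^sub>R e)) \<le> 2"
              using norm_triangle_ineq4[of "sker (1 / 2) (s *\<^sub>R e + t *\<^sub>R e)" "sker (1 / 2) (s *\<^sub>R e)"]
                norm_sker_half_le[of "s *\<^sub>R e + t *\<^sub>R e"] norm_sker_half_le[of "s *\<^sub>R e"] by linarith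
            then have "norm (t *\<^sub>R e) * norm (sker (1 / 2) (s *\<^sub>R e + t *\<^sub>R e) - sker (1 / 2) (s *\<^sub>R e)) \<le> \<bar>t\<bar> * 2"
              by (intro mult_mono) (auto simp: ne)
            then have "t *\<^sub>R e \<bullet> (sker (1 / 2) (s *\<^sub>R e + t *\<^sub>R e) - sker (1 / 2) (s *\<^sub>R e)) \<le> \<bar>t\<bar> * 2"
              using norm_cauchy_schwarz order_trans by blast
            then have "?J (s *\<^sub>R e) (t *\<^sub>R e) \<le> \<bar>t\<bar> powr (- 2 - \<alpha>) * (\<bar>t\<bar> * 2)"
              unfolding fk by (rule mult_left_mono) simp
            also have "\<dots> = 2 * \<bar>t\<bar> powr (- 1 - \<alpha>)" using pw[of t] by simp
            finally show ?thesis using True by (simp add: ennreal_leI)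
          next
            \<comment> \<open>Both points now lie beyond 1, where the smooth sign is constant, so
              the increment vanishes.\<close>
            case False
            have "sker (1 / 2) (s *\<^sub>R e + t *\<^sub>R e) = e"
              unfolding scaleR_left_distrib[symmetric] using False \<open>\<not> s \<le> 2\<close> by (subst Kout) auto
            moreover have "sker (1 / 2) (s *\<^sub>R e) = e" using \<open>\<not> s \<le> 2\<close> by (subst Kout) auto
            ultimately show ?thesis by simp
          qed
        qed
        also have "\<dots> = ennreal (2 / \<alpha> * (s - 1) powr (- \<alpha>))" using False by (intro tail) simp
        finally have "?m x \<le> 2 / \<alpha> * (s - 1) powr (- \<alpha>)" using \<alpha> by (simp add: ennreal_le_iff)
        also have "\<dots> \<le> (D + 2 / \<alpha>) * ((1 + s) / 3) powr (- \<alpha>)"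
          using False D0 \<alpha> by (intro mult_mono powr_mono2') auto
        finally show ?thesis .
      qed
      then show ?thesis unfolding third[OF s] by (simp add: C_def s_def mult.assoc)
    qed
    moreover have "0 \<le> C" using D0 \<alpha> by (simp add: C_def)
    ultimately show ?thesis by blast
  qed
qed

text \<open>The test field is the smooth sign at scale \<epsilon> minus the one at scale 2^j. First
  j grows and the far term disappears by dominated convergence, with weight (1 + |x -
  x0|)^(-\<alpha>); this is where p < 1/(1 - \<alpha>) enters. Then \<epsilon> shrinks, and the
  sharp lower bound passes to the limit by Fatou's lemma.\<close>

lemma hardy_one_dim:
  fixes f :: "real^'n \<Rightarrow> real"
  assumes dim: "CARD('n) = 1" and f: "f \<in> Lp p" and p: "1 \<le> p" "p < 1 / (1 - \<alpha>)"
    and f0: "AE x in lebesgue. 0 \<le> f x" and V: "frac_variation \<alpha> f \<le> ereal V"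
  shows "(\<integral>\<^sup>+x. ennreal (\<bar>f x\<bar> / norm (x - x0) powr \<alpha>) \<partial>lebesgue) \<le> ennreal (V / (2 * mu 1 \<alpha> / \<alpha>))"
proof -
  have D1: "DIM(real^'n) = 1" using dim by simp
  then obtain e :: "real^'n" where e: "Basis = {e}" by (metis card_1_singletonE)
  define \<mu> where "\<mu> = mu 1 \<alpha>"
  have \<mu>: "0 < \<mu>" unfolding \<mu>_def using \<alpha> by (rule mu_pos)
  have fm: "f \<in> borel_measurable lebesgue" using f by (simp add: Lp_def)
  define m where "m = (fdiv \<alpha> (sker (1 / 2)) :: real^'n \<Rightarrow> real)"
  note bounds = fdiv_half_bounds[OF e, folded m_def]
  obtain C where C: "0 \<le> C" "\<And>x. m x \<le> C * (1 + norm x) powr (- \<alpha>)" using bounds(3) by blast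
  obtain B where B: "blip B (sker (1 / 2) :: real^'n \<Rightarrow> real^'n)" using blip_sker[of "1 / 2"] by auto
  have mm[measurable]: "m \<in> borel_measurable borel" unfolding m_def by (rule fdiv_measurable[OF \<alpha> B])
  \<comment> \<open>By the dilation rule, \<open>M t\<close> is the divergence of the smooth sign at
    scale t, centred at x0.\<close>
  define M where "M = (\<lambda>t x. t powr (- \<alpha>) * m ((x - x0) /\<^sub>R t))"
  have M0: "0 \<le> M t x" for t x unfolding M_def using bounds(1) by simp
  have Mb: "M t x \<le> C * (t + norm (x - x0)) powr (- \<alpha>)" if t: "0 < t" for t x
  proof -
    have "M t x \<le> t powr (- \<alpha>) * (C * (1 + norm ((x - x0) /\<^sub>R t)) powr (- \<alpha>))"
      unfolding M_def by (intro mult_left_mono C) simp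
    also have "\<dots> = C * (t * (1 + norm ((x - x0) /\<^sub>R t))) powr (- \<alpha>)"
      using t by (subst powr_mult) (auto simp: add_nonneg_nonneg)
    also have "t * (1 + norm ((x - x0) /\<^sub>R t)) = t + norm (x - x0)" using t by (simp add: distrib_left)
    finally show ?thesis .
  qed
  have Mm: "M t \<in> borel_measurable lebesgue" for t
    unfolding M_def by (rule lebesgue_borelI) measurable
  have fMm: "(\<lambda>x. f x * M t x) \<in> borel_measurable lebesgue" for t using fm Mm by (rule borel_measurable_times)
  have "1 - 1 / p < \<alpha>"
  proof -
    have "p * (1 - \<alpha>) < 1" using p \<alpha> by (simp add: field_simps)
    then show ?thesis using p by (simp add: field_simps)
  qed
  then have dom0: "integrable lebesgue (\<lambda>x. f x * (1 + norm (x - x0)) powr (- \<alpha>))"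
    using Lp_weight_integrable[OF f p(1), of \<alpha> x0] \<alpha> dim by simp
  have dom: "integrable lebesgue (\<lambda>x. c * \<bar>f x * (1 + norm (x - x0)) powr (- \<alpha>)\<bar>)" for c
    using integrable_abs[OF dom0] by (rule integrable_mult_right)
  have bnd1: "norm (f x * M t x) \<le> C * \<bar>f x * (1 + norm (x - x0)) powr (- \<alpha>)\<bar>" if t: "1 \<le> t" for t x
  proof -
    have "(t + norm (x - x0)) powr (- \<alpha>) \<le> (1 + norm (x - x0)) powr (- \<alpha>)"
      using t \<alpha> by (intro powr_mono2') (auto simp: add_pos_nonneg)
    from mult_left_mono[OF this C(1)] have "M t x \<le> C * (1 + norm (x - x0)) powr (- \<alpha>)" using Mb[of t x] t by linarith
    from mult_left_mono[OF this, of "\<bar>f x\<bar>"] show ?thesis using M0[of t x] by (simp add: abs_mult ac_simps)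
  qed
  have bnd2: "norm (f x * M t x) \<le> (C * t powr (- \<alpha>)) * \<bar>f x * (1 + norm (x - x0)) powr (- \<alpha>)\<bar>" if t: "0 < t" "t \<le> 1" for t x
  proof -
    have "t * (1 + norm (x - x0)) \<le> t + norm (x - x0)"
      using t mult_right_mono[of t 1 "norm (x - x0)"] by (simp add: distrib_left)
    then have "(t + norm (x - x0)) powr (- \<alpha>) \<le> (t * (1 + norm (x - x0))) powr (- \<alpha>)"
      using t \<alpha> by (intro powr_mono2') (auto simp: add_pos_nonneg)
    also have "\<dots> = t powr (- \<alpha>) * (1 + norm (x - x0)) powr (- \<alpha>)" using t by (subst powr_mult) (auto simp: add_nonneg_nonneg)
    finally have "C * (t + norm (x - x0)) powr (- \<alpha>) \<le> C * (t powr (- \<alpha>) * (1 + norm (x - x0)) powr (- \<alpha>))" using C(1) by (rule mult_left_mono)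
    then have "M t x \<le> C * (t powr (- \<alpha>) * (1 + norm (x - x0)) powr (- \<alpha>))" using Mb[OF t(1), of x] by linarith
    from mult_left_mono[OF this, of "\<bar>f x\<bar>"] show ?thesis using M0[of t x] by (simp add: abs_mult ac_simps)
  qed
  have int1: "integrable lebesgue (\<lambda>x. f x * M t x)" if "1 \<le> t" for t
    by (rule Bochner_Integration.integrable_bound[OF dom fMm]) (use order_trans[OF bnd1[OF that] abs_ge_self] in auto)
  have int2: "integrable lebesgue (\<lambda>x. f x * M t x)" if "0 < t" "t \<le> 1" for t
    by (rule Bochner_Integration.integrable_bound[OF dom fMm]) (use order_trans[OF bnd2[OF that] abs_ge_self] in auto)
  have key: "\<mu> * ((\<integral>x. f x * M \<epsilon> x \<partial>lebesgue) - (\<integral>x. f x * M (2 ^ j) x \<partial>lebesgue)) \<le> V" if \<epsilon>: "0 < \<epsilon>" "\<epsilon> \<le> 1" for \<epsilon> j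
  proof -
    \<comment> \<open>The ratio of the two scales: dilating the difference field of ratio t by
      \<epsilon> puts its ends at \<epsilon> and 2^j.\<close>
    define t where "t = 2 ^ j / \<epsilon>"
    have t: "1 \<le> t"
    proof -
      have "\<epsilon> \<le> 2 ^ j" using \<epsilon> one_le_power[of "2::real" j] by linarith
      then show ?thesis using \<epsilon> by (simp add: t_def)
    qed
    define b where "b = (bumpf (1 / 2) t :: real^'n \<Rightarrow> real^'n)"
    have bC: "b \<in> Cc_infinity" unfolding b_def using t by (intro bumpf_Cc_infinity) simp
    have bb: "blip (2 * B) b" unfolding b_def using t by (intro blip_bumpf[OF B]) auto
    define \<phi> where "\<phi> = (\<lambda>x. b ((x - x0) /\<^sub>R \<epsilon>))"
    have \<phi>C: "\<phi> \<in> Cc_infinity"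
      using Cc_infinity_affine[OF bC, of "inverse \<epsilon>" "- (x0 /\<^sub>R \<epsilon>)"] \<epsilon> by (simp add: \<phi>_def scaleR_diff_right)
    have \<phi>1: "norm (\<phi> x) \<le> 1" for x unfolding \<phi>_def b_def using t by (intro bumpf_half_le) simp
    have fb: "fdiv \<alpha> b y = m y - t powr (- \<alpha>) * m (y /\<^sub>R t)" for y
    proof -
      \<comment> \<open>For q = 1/2 the normalizing power \<open>t powr (1 - 2 * q)\<close> is
        1.\<close>
      have "b = (\<lambda>z. sker (1 / 2) z - sker (1 / 2) (z /\<^sub>R t))" using t by (auto simp: b_def bumpf_def)
      then show ?thesis
        using fdiv_diff[OF \<alpha> B blip_dilate[OF B t], of y] fdiv_dilate[OF \<alpha> B, of t y] t by (simp add: m_def)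
    qed
    have "fdiv \<alpha> \<phi> x = M \<epsilon> x - M (2 ^ j) x" for x
    proof -
      have "fdiv \<alpha> \<phi> x = fdiv \<alpha> (\<lambda>x. b (x /\<^sub>R \<epsilon>)) (x - x0)"
        unfolding \<phi>_def by (rule fdiv_translate[OF \<alpha>, of "\<lambda>x. b (x /\<^sub>R \<epsilon>)"])
      also have "\<dots> = \<epsilon> powr (- \<alpha>) * (m ((x - x0) /\<^sub>R \<epsilon>) - t powr (- \<alpha>) * m (((x - x0) /\<^sub>R \<epsilon>) /\<^sub>R t))"
        by (simp add: fdiv_dilate[OF \<alpha> bb \<epsilon>(1)] fb)
      also have "((x - x0) /\<^sub>R \<epsilon>) /\<^sub>R t = (x - x0) /\<^sub>R 2 ^ j"
        using \<epsilon> by (simp add: t_def inverse_eq_divide)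
      also have "\<epsilon> powr (- \<alpha>) * (m ((x - x0) /\<^sub>R \<epsilon>) - t powr (- \<alpha>) * m ((x - x0) /\<^sub>R 2 ^ j)) =
          M \<epsilon> x - (\<epsilon> * t) powr (- \<alpha>) * m ((x - x0) /\<^sub>R 2 ^ j)"
        using \<epsilon> t by (simp add: M_def right_diff_distrib powr_mult)
      also have "\<epsilon> * t = 2 ^ j" using \<epsilon> by (simp add: t_def)
      finally show ?thesis by (simp add: M_def)
    qed
    moreover have "\<mu> * (\<integral>x. f x * fdiv \<alpha> \<phi> x \<partial>lebesgue) \<le> 1 * V"
      using variation_test[OF V \<phi>C \<phi>1] dim by (simp add: \<mu>_def)
    moreover have "(\<integral>x. f x * (M \<epsilon> x - M (2 ^ j) x) \<partial>lebesgue) =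
        (\<integral>x. f x * M \<epsilon> x \<partial>lebesgue) - (\<integral>x. f x * M (2 ^ j) x \<partial>lebesgue)"
      unfolding right_diff_distrib by (rule Bochner_Integration.integral_diff) (auto intro: int1 int2 \<epsilon>)
    ultimately show ?thesis by simp
  qed
  have lim: "(\<lambda>j. \<integral>x. f x * M (2 ^ j) x \<partial>lebesgue) \<longlonglongrightarrow> (\<integral>x. 0 \<partial>(lebesgue :: (real^'n) measure))"
  proof (rule integral_dominated_convergence[OF _ fMm dom])
    show "AE x in lebesgue. (\<lambda>j. f x * M (2 ^ j) x) \<longlonglongrightarrow> 0"
    proof (rule AE_I2)
      fix x
      have "(\<lambda>j. M (2 ^ j) x) \<longlonglongrightarrow> 0"
      proof (rule Lim_null_comparison)
        show "\<forall>\<^sub>F j in sequentially. norm (M (2 ^ j) x) \<le> C * (2 powr (- \<alpha>)) ^ j"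
        proof (intro always_eventually allI)
          fix j
          have "norm (M (2 ^ j) x) \<le> C * (2 ^ j + norm (x - x0)) powr (- \<alpha>)" using Mb[of "2 ^ j" x] M0[of "2 ^ j" x] by simp
          also have "\<dots> \<le> C * (2 ^ j) powr (- \<alpha>)" using C(1) \<alpha> by (intro mult_left_mono powr_mono2') auto
          also have "(2 ^ j) powr (- \<alpha>) = (2 powr (- \<alpha>)) ^ j" by (simp add: power_powr)
          finally show "norm (M (2 ^ j) x) \<le> C * (2 powr (- \<alpha>)) ^ j" .
        qed
        have "2 powr (- \<alpha>) < (1::real)" using \<alpha> powr_less_mono[of "- \<alpha>" 0 2] by simp
        then show "(\<lambda>j. C * (2 powr (- \<alpha>)) ^ j) \<longlonglongrightarrow> 0" by (intro tendsto_mult_right_zero LIMSEQ_power_zero) simp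
      qed
      then show "(\<lambda>j. f x * M (2 ^ j) x) \<longlonglongrightarrow> 0" by (rule tendsto_mult_right_zero)
    qed
    show "AE x in lebesgue. norm (f x * M (2 ^ j) x) \<le> C * \<bar>f x * (1 + norm (x - x0)) powr (- \<alpha>)\<bar>" for j
      by (intro AE_I2 bnd1) simp
  qed simp
  have one: "\<mu> * (\<integral>x. f x * M \<epsilon> x \<partial>lebesgue) \<le> V" if \<epsilon>: "0 < \<epsilon>" "\<epsilon> \<le> 1" for \<epsilon>
  proof -
    have "(\<lambda>j. \<mu> * ((\<integral>x. f x * M \<epsilon> x \<partial>lebesgue) - (\<integral>x. f x * M (2 ^ j) x \<partial>lebesgue))) \<longlonglongrightarrow>
        \<mu> * ((\<integral>x. f x * M \<epsilon> x \<partial>lebesgue) - (\<integral>x. 0 \<partial>(lebesgue :: (real^'n) measure)))"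
      by (intro tendsto_mult tendsto_diff tendsto_const lim)
    then have "\<mu> * ((\<integral>x. f x * M \<epsilon> x \<partial>lebesgue) - (\<integral>x. 0 \<partial>(lebesgue :: (real^'n) measure))) \<le> V"
      by (rule LIMSEQ_le_const2) (use key[OF \<epsilon>] in blast)
    then show ?thesis by simp
  qed
  \<comment> \<open>The sharp lower bound for the divergence, rescaled to \<epsilon> = 2^(-k). It
    holds only at distance more than \<epsilon> from x0; nearer, nonnegativity is enough.\<close>
  define v where "v = (\<lambda>k x. if (1 / 2) ^ k < norm (x - x0) then 2 / \<alpha> * (norm (x - x0) + (1 / 2) ^ k) powr (- \<alpha>) else 0)"
  have vM: "v k x \<le> M ((1 / 2) ^ k) x" for k x
  proof (cases "(1 / 2) ^ k < norm (x - x0)")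
    case True
    define \<epsilon> :: real where "\<epsilon> = (1 / 2) ^ k"
    have \<epsilon>: "0 < \<epsilon>" by (simp add: \<epsilon>_def)
    have nx: "norm ((x - x0) /\<^sub>R \<epsilon>) = norm (x - x0) / \<epsilon>" using \<epsilon> by (simp add: divide_inverse mult.commute)
    have "1 < norm ((x - x0) /\<^sub>R \<epsilon>)" unfolding nx using True \<epsilon> by (simp add: \<epsilon>_def)
    then have "2 / \<alpha> * (norm ((x - x0) /\<^sub>R \<epsilon>) + 1) powr (- \<alpha>) \<le> m ((x - x0) /\<^sub>R \<epsilon>)" by (rule bounds(2))
    then have "\<epsilon> powr (- \<alpha>) * (2 / \<alpha> * (norm ((x - x0) /\<^sub>R \<epsilon>) + 1) powr (- \<alpha>)) \<le> M \<epsilon> x"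
      unfolding M_def by (rule mult_left_mono) simp
    also have "\<epsilon> powr (- \<alpha>) * (2 / \<alpha> * (norm ((x - x0) /\<^sub>R \<epsilon>) + 1) powr (- \<alpha>)) =
        2 / \<alpha> * (\<epsilon> * (norm ((x - x0) /\<^sub>R \<epsilon>) + 1)) powr (- \<alpha>)"
      using \<epsilon> by (subst powr_mult) (auto simp: add_nonneg_nonneg)
    also have "\<epsilon> * (norm ((x - x0) /\<^sub>R \<epsilon>) + 1) = norm (x - x0) + \<epsilon>" unfolding nx using \<epsilon> by (simp add: distrib_left)
    finally show ?thesis using True by (simp add: v_def \<epsilon>_def)
  qed (simp add: v_def M0)
  have v0: "0 \<le> v k x" for k x using \<alpha> by (simp add: v_def)
  have vlim: "(\<lambda>k. v k x) \<longlonglongrightarrow> 2 / \<alpha> * norm (x - x0) powr (- \<alpha>)" if x: "x \<noteq> x0" for x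
  proof -
    have n0: "0 < norm (x - x0)" using x by simp
    have half: "(\<lambda>k. (1 / 2 :: real) ^ k) \<longlonglongrightarrow> 0" by (rule LIMSEQ_power_zero) simp
    have "(\<lambda>k. 2 / \<alpha> * (norm (x - x0) + (1 / 2) ^ k) powr (- \<alpha>)) \<longlonglongrightarrow> 2 / \<alpha> * (norm (x - x0) + 0) powr (- \<alpha>)"
      using n0 by (intro tendsto_intros half) auto
    moreover have "\<forall>\<^sub>F k in sequentially. 2 / \<alpha> * (norm (x - x0) + (1 / 2) ^ k) powr (- \<alpha>) = v k x"
      using order_tendstoD(2)[OF half n0] by eventually_elim (simp add: v_def)
    ultimately show ?thesis by (simp add: tendsto_cong)
  qed
  have vm: "v k \<in> borel_measurable borel" for k unfolding v_def by measurable
  have fv: "(\<integral>\<^sup>+x. ennreal (\<bar>f x\<bar> * v k x) \<partial>lebesgue) \<le> ennreal (V / \<mu>)" for k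
  proof -
    \<comment> \<open>Nonnegativity of f is essential here: a lower bound for the divergence may be
      multiplied by f only if f = |f|.\<close>
    have "(\<integral>\<^sup>+x. ennreal (\<bar>f x\<bar> * v k x) \<partial>lebesgue) \<le> (\<integral>\<^sup>+x. ennreal (f x * M ((1 / 2) ^ k) x) \<partial>lebesgue)"
    proof (rule nn_integral_mono_AE)
      show "AE x in lebesgue. ennreal (\<bar>f x\<bar> * v k x) \<le> ennreal (f x * M ((1 / 2) ^ k) x)"
        using f0 by eventually_elim (auto intro!: ennreal_leI mult_left_mono vM)
    qed
    also have "\<dots> = ennreal (\<integral>x. f x * M ((1 / 2) ^ k) x \<partial>lebesgue)"
    proof (rule nn_integral_eq_integral)
      show "integrable lebesgue (\<lambda>x. f x * M ((1 / 2) ^ k) x)" by (rule int2) (auto simp: power_le_one)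
      show "AE x in lebesgue. 0 \<le> f x * M ((1 / 2) ^ k) x" using f0 by eventually_elim (simp add: M0)
    qed
    also have "\<dots> \<le> ennreal (V / \<mu>)"
      using one[of "(1 / 2) ^ k"] \<mu> by (intro ennreal_leI) (simp add: power_le_one field_simps)
    finally show ?thesis .
  qed
  have "(\<integral>\<^sup>+x. ennreal (2 / \<alpha>) * ennreal (\<bar>f x\<bar> / norm (x - x0) powr \<alpha>) \<partial>lebesgue) \<le>
      (\<integral>\<^sup>+x. liminf (\<lambda>k. ennreal (\<bar>f x\<bar> * v k x)) \<partial>lebesgue)"
  proof (rule nn_integral_mono)
    fix x
    have eq: "ennreal (2 / \<alpha>) * ennreal (\<bar>f x\<bar> / norm (x - x0) powr \<alpha>) = ennreal (\<bar>f x\<bar> * (2 / \<alpha> * norm (x - x0) powr (- \<alpha>)))"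
      using \<alpha> by (subst ennreal_mult[symmetric]) (auto simp: powr_minus divide_inverse ac_simps)
    have "liminf (\<lambda>k. ennreal (\<bar>f x\<bar> * v k x)) = ennreal (\<bar>f x\<bar> * (2 / \<alpha> * norm (x - x0) powr (- \<alpha>)))" if "x \<noteq> x0"
      using vlim[OF that] by (intro lim_imp_Liminf tendsto_ennrealI tendsto_mult tendsto_const) auto
    then show "ennreal (2 / \<alpha>) * ennreal (\<bar>f x\<bar> / norm (x - x0) powr \<alpha>) \<le> liminf (\<lambda>k. ennreal (\<bar>f x\<bar> * v k x))"
      unfolding eq by (cases "x = x0") auto
  qed
  also have "\<dots> \<le> liminf (\<lambda>k. \<integral>\<^sup>+x. ennreal (\<bar>f x\<bar> * v k x) \<partial>lebesgue)"
  proof (rule nn_integral_liminf)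
    fix k
    have "(\<lambda>x. \<bar>f x\<bar> * v k x) \<in> borel_measurable lebesgue"
      by (intro borel_measurable_times borel_measurable_abs fm lebesgue_borelI vm)
    then show "(\<lambda>x. ennreal (\<bar>f x\<bar> * v k x)) \<in> borel_measurable lebesgue" by simp
  qed
  also have "\<dots> \<le> ennreal (V / \<mu>)" by (intro Liminf_le) (auto simp: fv)
  also have "(\<integral>\<^sup>+x. ennreal (2 / \<alpha>) * ennreal (\<bar>f x\<bar> / norm (x - x0) powr \<alpha>) \<partial>lebesgue) =
      ennreal (2 / \<alpha>) * (\<integral>\<^sup>+x. ennreal (\<bar>f x\<bar> / norm (x - x0) powr \<alpha>) \<partial>lebesgue)"
  proof (rule nn_integral_cmult)
    have "(\<lambda>x::real^'n. norm (x - x0) powr \<alpha>) \<in> borel_measurable borel" by measurable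
    then have "(\<lambda>x. \<bar>f x\<bar> / norm (x - x0) powr \<alpha>) \<in> borel_measurable lebesgue"
      by (intro borel_measurable_divide borel_measurable_abs fm lebesgue_borelI)
    then show "(\<lambda>x. ennreal (\<bar>f x\<bar> / norm (x - x0) powr \<alpha>)) \<in> borel_measurable lebesgue" by simp
  qed
  finally have fin: "ennreal (2 / \<alpha>) * (\<integral>\<^sup>+x. ennreal (\<bar>f x\<bar> / norm (x - x0) powr \<alpha>) \<partial>lebesgue) \<le> ennreal (V / \<mu>)" .
  have "(\<integral>\<^sup>+x. ennreal (\<bar>f x\<bar> / norm (x - x0) powr \<alpha>) \<partial>lebesgue) =
      ennreal (\<alpha> / 2) * (ennreal (2 / \<alpha>) * (\<integral>\<^sup>+x. ennreal (\<bar>f x\<bar> / norm (x - x0) powr \<alpha>) \<partial>lebesgue))"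
    using \<alpha> by (simp add: mult.assoc[symmetric] ennreal_mult[symmetric])
  also have "\<dots> \<le> ennreal (\<alpha> / 2) * ennreal (V / \<mu>)" using fin by (rule mult_left_mono) simp
  also have "\<dots> = ennreal (V / (2 * mu 1 \<alpha> / \<alpha>))"
    using \<alpha> by (subst ennreal_mult'[symmetric]) (auto simp: \<mu>_def field_simps)
  finally show ?thesis .
qed

text \<open>On each half-line the majorant is t^(-\<alpha>) up to 1 and t^(-1-\<alpha>) beyond,
  giving 1/(1 - \<alpha>) + 1/\<alpha> = 1/(\<alpha> (1 - \<alpha>)). The comparison function counts
  t = 1 twice, on a null set.\<close>

lemma fmaj_integral_dim1:
  assumes e: "Basis = {e::'a::euclidean_space}"
  shows "(\<integral>z. fmaj \<alpha> (z::'a) \<partial>lborel) \<le> 2 / (\<alpha> * (1 - \<alpha>))"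
proof -
  have ee: "e \<bullet> e = 1" by (rule inner_same_Basis) (simp add: e)
  have ne: "norm e = 1" by (simp add: norm_eq_sqrt_inner ee)
  have dim: "DIM('a) = 1" by (simp add: e)
  define u where "u = (\<lambda>t. ennreal (t powr (- \<alpha>)) * indicator {0..1} t + ennreal (t powr (- 1 - \<alpha>)) * indicator {1..} t)"
  have um[measurable]: "u \<in> borel_measurable borel" unfolding u_def by measurable
  have U: "(\<integral>\<^sup>+t. u t \<partial>lborel) = ennreal (1 / (1 - \<alpha>) + 1 / \<alpha>)"
    unfolding u_def using \<alpha>
    by (subst nn_integral_add) (auto simp: nn_integral_powr_head nn_integral_powr_tail[of _ 1] ennreal_plus[symmetric] simp del: ennreal_plus)
  have F: "fmaj \<alpha> (t *\<^sub>R e) = min 1 \<bar>t\<bar> * \<bar>t\<bar> powr (- 1 - \<alpha>)" for t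
    unfolding fmaj_def norm_mult_fker by (simp add: dim ne)
  have pos: "ennreal (fmaj \<alpha> (t *\<^sub>R e)) \<le> u t" if "0 < t" for t
  proof (cases "t \<le> 1")
    case True
    have "t * t powr (- 1 - \<alpha>) = t powr (- \<alpha>)" using powr_mult_base[of t "- 1 - \<alpha>"] that by simp
    then show ?thesis using True that by (simp add: F u_def)
  qed (use that in \<open>simp add: F u_def\<close>)
  have "ennreal (\<integral>z. fmaj \<alpha> (z::'a) \<partial>lborel) = (\<integral>\<^sup>+z. ennreal (fmaj \<alpha> (z::'a)) \<partial>lborel)"
    by (rule nn_integral_eq_integral[symmetric]) (auto intro: fmaj_integrable \<alpha>)
  also have "\<dots> = (\<integral>\<^sup>+t. ennreal (fmaj \<alpha> (t *\<^sub>R e)) \<partial>lborel)"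
    by (rule nn_integral_dim1[OF e]) measurable
  also have "\<dots> \<le> (\<integral>\<^sup>+t. u t + u (- t) \<partial>lborel)"
  proof (rule nn_integral_mono)
    fix t :: real
    consider "0 < t" | "t < 0" | "t = 0" by linarith
    then show "ennreal (fmaj \<alpha> (t *\<^sub>R e)) \<le> u t + u (- t)"
    proof cases
      case 1 then show ?thesis using pos[of t] by (simp add: add_increasing2)
    next
      case 2 then show ?thesis using pos[of "- t"] F[of t] F[of "- t"] by (simp add: add_increasing)
    qed (use F[of 0] in simp)
  qed
  also have "\<dots> = ennreal (1 / (1 - \<alpha>) + 1 / \<alpha>) + ennreal (1 / (1 - \<alpha>) + 1 / \<alpha>)"
    by (subst nn_integral_add) (auto simp: U nn_integral_reflect[OF um])
  also have "\<dots> = ennreal (2 / (\<alpha> * (1 - \<alpha>)))"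
    using \<alpha> by (subst ennreal_plus[symmetric]) (auto simp: field_simps)
  finally show ?thesis using \<alpha> by (subst (asm) ennreal_le_iff) auto
qed

text \<open>Equality is attained by the indicator of the unit interval: pairing the increments in the
  directions \<open>z\<close> and \<open>- z\<close> gives the sharp bound for its variation.\<close>

lemma variation_unit_ball:
  assumes dim: "CARD('n) = 1"
  shows "frac_variation \<alpha> (indicator (cball (0::real^'n) 1)) \<le> ereal (4 * mu 1 \<alpha> / (\<alpha> * (1 - \<alpha>)))"
proof -
  have D1: "DIM(real^'n) = 1" using dim by simp
  then obtain e :: "real^'n" where e: "Basis = {e}" by (metis card_1_singletonE)
  have ee: "e \<bullet> e = 1" by (rule inner_same_Basis) (simp add: e)
  have rep: "y = (y \<bullet> e) *\<^sub>R e" for y :: "real^'n" using euclidean_representation[of y] by (simp add: e)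
  have nrm: "norm y = \<bar>y \<bullet> e\<bar>" for y :: "real^'n"
  proof -
    have "norm e = 1" by (simp add: norm_eq_sqrt_inner ee)
    then show ?thesis by (subst rep) simp
  qed
  have ball: "(\<integral>x. indicator (cball (a::real^'n) r) x \<partial>lborel) = 2 * r" if "0 \<le> r" for a r
    using that content_cball[of r a] dim by (simp add: unit_ball_vol_1)
  let ?f = "indicator (cball (0::real^'n) 1) :: real^'n \<Rightarrow> real"
  have diff: "(\<integral>x. \<bar>?f (x - z) - ?f (x + z)\<bar> \<partial>lborel) \<le> 4 * min 1 (norm z)"
    and diff_int: "integrable lborel (\<lambda>x. \<bar>?f (x - z) - ?f (x + z)\<bar>)" for z
  proof -
    have s1: "?f (x - z) = indicator (cball z 1) x" for x by (simp add: indicator_def dist_norm norm_minus_commute)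
    have s2: "?f (x + z) = indicator (cball (- z) 1) x" for x
      by (simp add: indicator_def dist_norm) (metis add.commute diff_minus_eq_add minus_diff_eq norm_minus_cancel)
    show int: "integrable lborel (\<lambda>x. \<bar>?f (x - z) - ?f (x + z)\<bar>)" unfolding s1 s2 by simp
    have "(\<integral>x. \<bar>?f (x - z) - ?f (x + z)\<bar> \<partial>lborel) \<le> (\<integral>x. indicator (cball z 1) x + indicator (cball (- z) 1) x \<partial>lborel)"
    proof (rule integral_mono[OF int])
      show "integrable lborel (\<lambda>x. indicator (cball z 1) x + indicator (cball (- z) 1) x :: real)"
        by (rule Bochner_Integration.integrable_add) simp_all
      show "\<bar>?f (x - z) - ?f (x + z)\<bar> \<le> indicator (cball z 1) x + indicator (cball (- z) 1) x" for x
        unfolding s1 s2 by (simp add: indicator_def)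
    qed
    also have "\<dots> = 4" by (simp add: ball[of 1, simplified] del: integral_indicator)
    finally have b1: "(\<integral>x. \<bar>?f (x - z) - ?f (x + z)\<bar> \<partial>lborel) \<le> 4" .
    \<comment> \<open>For small shifts, the translates by z and -z can differ only within |z| of an
      endpoint e or -e of the interval: two intervals of length 2|z|.\<close>
    have "(\<integral>x. \<bar>?f (x - z) - ?f (x + z)\<bar> \<partial>lborel) \<le>
        (\<integral>x. indicator (cball e (norm z)) x + indicator (cball (- e) (norm z)) x \<partial>lborel)"
    proof (intro integral_mono int)
      show "integrable lborel (\<lambda>x. indicator (cball e (norm z)) x + indicator (cball (- e) (norm z)) x :: real)" by simp
      fix x
      show "\<bar>?f (x - z) - ?f (x + z)\<bar> \<le> indicator (cball e (norm z)) x + indicator (cball (- e) (norm z)) x"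
        by (auto simp: indicator_def dist_norm nrm inner_diff_left inner_add_left inner_minus_left ee)
    qed
    also have "\<dots> = 2 * norm z + 2 * norm z"
      using ball[of "norm z" e] ball[of "norm z" "- e"] by simp
    finally show "(\<integral>x. \<bar>?f (x - z) - ?f (x + z)\<bar> \<partial>lborel) \<le> 4 * min 1 (norm z)" using b1 by (simp add: min_def)
  qed
  show ?thesis
    unfolding frac_variation_def
  proof (rule SUP_least)
    fix \<phi> :: "real^'n \<Rightarrow> real^'n"
    assume "\<phi> \<in> {\<phi> \<in> Cc_infinity. Linfinity_norm \<phi> \<le> 1}"
    then have \<phi>: "\<phi> \<in> Cc_infinity" "Linfinity_norm \<phi> \<le> 1" by auto
    obtain B where B: "blip B \<phi>" using Cc_infinity_blip[OF \<phi>(1)] by blast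
    obtain r where r: "\<And>x. r < norm x \<Longrightarrow> \<phi> x = 0" using \<phi>(1) by (auto simp: Cc_infinity_iff)
    have [measurable]: "\<phi> \<in> borel_measurable borel" by (rule blip_measurable[OF B])
    have "AE x in lebesgue. ereal (norm (\<phi> x)) \<le> 1"
      using esssup_AE[of "\<lambda>x. ereal (norm (\<phi> x))" lebesgue]
      by eventually_elim (rule order_trans[OF _ \<phi>(2)[unfolded Linfinity_norm_def]])
    then have \<phi>1: "AE x in lborel. norm (\<phi> x) \<le> 1"
      by (subst (asm) AE_completion_iff) auto
    define Q where "Q = (\<lambda>z. \<integral>x. (?f (x - z) - ?f x) * (z \<bullet> \<phi> x) \<partial>lborel)"
    have fi: "integrable lborel (\<lambda>x. ?f (x - z) * (z' \<bullet> \<phi> x))" for z z'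
    proof (rule Bochner_Integration.integrable_bound)
      have s1: "?f (x - z) = indicator (cball z 1) x" for x by (simp add: indicator_def dist_norm norm_minus_commute)
      show "integrable lborel (\<lambda>x. (norm z' * B) * ?f (x - z))" unfolding s1 by simp
      show "AE x in lborel. norm (?f (x - z) * (z' \<bullet> \<phi> x)) \<le> norm ((norm z' * B) * ?f (x - z))"
      proof (rule AE_I2)
        fix x
        have "\<bar>z' \<bullet> \<phi> x\<bar> \<le> norm z' * B"
          by (rule order_trans[OF Cauchy_Schwarz_ineq2 mult_left_mono[OF blip_norm[OF B]]]) simp
        then show "norm (?f (x - z) * (z' \<bullet> \<phi> x)) \<le> norm ((norm z' * B) * ?f (x - z))"
          by (auto simp: indicator_def)
      qed
    qed measurable
    have P: "(\<integral>x. ?f x * fdiv \<alpha> \<phi> x \<partial>lborel) = (\<integral>z. fker \<alpha> z * Q z \<partial>lborel)"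
      and Qi: "integrable lborel (\<lambda>z. fker \<alpha> z * Q z)"
      unfolding Q_def
      by (rule fdiv_pairing(3)[where C=1 and r=r, OF \<alpha> B], use r in \<open>auto simp: indicator_def\<close>)
        (rule fdiv_pairing(2)[where C=1 and r=r, OF \<alpha> B], use r in \<open>auto simp: indicator_def\<close>)
    have Qi': "integrable lborel (\<lambda>z. fker \<alpha> z * Q (- z))"
      and Qe: "(\<integral>z. fker \<alpha> z * Q (- z) \<partial>lborel) = (\<integral>z. fker \<alpha> z * Q z \<partial>lborel)"
      using lborel_integral_affine[OF borel_measurable_integrable[OF Qi, simplified], of "-1" 0] Qi by simp_all
    \<comment> \<open>Adding the values at z and -z cancels the unshifted indicator and leaves the
      difference of two opposite translates. The symmetrization doubles the left side, so 4 times
      the integral of \<open>fmaj\<close> is halved at the end.\<close>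
    have "2 * (\<integral>z. fker \<alpha> z * Q z \<partial>lborel) = (\<integral>z. fker \<alpha> z * (Q z + Q (- z)) \<partial>lborel)"
      using Qi Qi' Qe by (simp add: distrib_left)
    also have "\<dots> \<le> (\<integral>z. 4 * fmaj \<alpha> (z::real^'n) \<partial>lborel)"
    proof (rule integral_mono)
      show "integrable lborel (\<lambda>z. fker \<alpha> z * (Q z + Q (- z)))" using Qi Qi' by (simp add: distrib_left)
      show "integrable lborel (\<lambda>z. 4 * fmaj \<alpha> (z::real^'n))" by (intro integrable_mult_right fmaj_integrable \<alpha>)
      fix z
      have "Q z + Q (- z) = (\<integral>x. (?f (x - z) - ?f (x + z)) * (z \<bullet> \<phi> x) \<partial>lborel)"
        unfolding Q_def using fi[of z z] fi[of 0 z] fi[of "- z" z] by (simp add: left_diff_distrib)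
      also have "\<dots> \<le> (\<integral>x. norm z * \<bar>?f (x - z) - ?f (x + z)\<bar> \<partial>lborel)"
      proof (rule integral_mono_AE)
        show "integrable lborel (\<lambda>x. (?f (x - z) - ?f (x + z)) * (z \<bullet> \<phi> x))"
          using fi[of z z] fi[of "- z" z] by (simp add: left_diff_distrib)
        show "integrable lborel (\<lambda>x. norm z * \<bar>?f (x - z) - ?f (x + z)\<bar>)" using diff_int by (rule integrable_mult_right)
        show "AE x in lborel. (?f (x - z) - ?f (x + z)) * (z \<bullet> \<phi> x) \<le> norm z * \<bar>?f (x - z) - ?f (x + z)\<bar>"
          using \<phi>1
        proof eventually_elim
          fix x assume "norm (\<phi> x) \<le> 1"
          then have "\<bar>z \<bullet> \<phi> x\<bar> \<le> norm z"
            using order_trans[OF Cauchy_Schwarz_ineq2 mult_left_mono[of "norm (\<phi> x)" 1 "norm z"]] by simp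
          then have "\<bar>?f (x - z) - ?f (x + z)\<bar> * \<bar>z \<bullet> \<phi> x\<bar> \<le> \<bar>?f (x - z) - ?f (x + z)\<bar> * norm z"
            by (intro mult_left_mono) auto
          then show "(?f (x - z) - ?f (x + z)) * (z \<bullet> \<phi> x) \<le> norm z * \<bar>?f (x - z) - ?f (x + z)\<bar>"
            unfolding abs_mult[symmetric] by (simp only: mult.commute[of "norm z"])
        qed
      qed
      also have "\<dots> = norm z * (\<integral>x. \<bar>?f (x - z) - ?f (x + z)\<bar> \<partial>lborel)" by simp
      also have "\<dots> \<le> norm z * (4 * min 1 (norm z))" by (intro mult_left_mono diff) simp
      finally have "Q z + Q (- z) \<le> norm z * (4 * min 1 (norm z))" .
      then have "fker \<alpha> z * (Q z + Q (- z)) \<le> fker \<alpha> z * (norm z * (4 * min 1 (norm z)))" by (intro mult_left_mono) simp_all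
      then show "fker \<alpha> z * (Q z + Q (- z)) \<le> 4 * fmaj \<alpha> z" by (simp add: fmaj_def ac_simps)
    qed
    also have "\<dots> \<le> 4 * (2 / (\<alpha> * (1 - \<alpha>)))" using fmaj_integral_dim1[OF e] by simp
    finally have I: "(\<integral>x. ?f x * fdiv \<alpha> \<phi> x \<partial>lborel) \<le> 4 / (\<alpha> * (1 - \<alpha>))" unfolding P by simp
    have "(\<integral>x. ?f x * frac_div \<alpha> \<phi> x \<partial>lebesgue) = (\<integral>x. mu 1 \<alpha> * (?f x * fdiv \<alpha> \<phi> x) \<partial>lebesgue)"
      using dim by (intro Bochner_Integration.integral_cong) (auto simp: frac_div_eq)
    also have "\<dots> = mu 1 \<alpha> * (\<integral>x. ?f x * fdiv \<alpha> \<phi> x \<partial>lebesgue)" by simp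
    also have "(\<integral>x. ?f x * fdiv \<alpha> \<phi> x \<partial>lebesgue) = (\<integral>x. ?f x * fdiv \<alpha> \<phi> x \<partial>lborel)"
    proof (rule integral_completion)
      note [measurable] = fdiv_measurable[OF \<alpha> B]
      show "(\<lambda>x. ?f x * fdiv \<alpha> \<phi> x) \<in> borel_measurable lborel" by measurable
    qed
    also have "mu 1 \<alpha> * \<dots> \<le> mu 1 \<alpha> * (4 / (\<alpha> * (1 - \<alpha>)))"
      using I mu_pos[OF \<alpha>, of 1] by (intro mult_left_mono) auto
    finally show "ereal (\<integral>x. ?f x * frac_div \<alpha> \<phi> x \<partial>lebesgue) \<le> ereal (4 * mu 1 \<alpha> / (\<alpha> * (1 - \<alpha>)))"
      by (simp add: mult.commute)
  qed
qed

text \<open>The integral of |t|^(-\<alpha>) over [-1, 1]. The variation bound 4 \<mu>/(\<alpha> (1 -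
  \<alpha>)) divided by 2/(1 - \<alpha>) is 2 \<mu>/\<alpha>, so no larger constant is
  admissible.\<close>

lemma hardy_integral_unit_ball:
  assumes dim: "CARD('n) = 1"
  shows "ennreal (2 / (1 - \<alpha>)) \<le> (\<integral>\<^sup>+x. ennreal (\<bar>indicator (cball (0::real^'n) 1) x\<bar> / norm (x - 0) powr \<alpha>) \<partial>lebesgue)"
proof -
  have D1: "DIM(real^'n) = 1" using dim by simp
  then obtain e :: "real^'n" where e: "Basis = {e}" by (metis card_1_singletonE)
  have ee: "e \<bullet> e = 1" by (rule inner_same_Basis) (simp add: e)
  have ne: "norm e = 1" by (simp add: norm_eq_sqrt_inner ee)
  define u where "u = (\<lambda>t::real. ennreal (t powr (- \<alpha>)) * indicator {0..1} t)"
  have um[measurable]: "u \<in> borel_measurable borel" unfolding u_def by measurable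
  have U: "(\<integral>\<^sup>+t. u t \<partial>lborel) = ennreal (1 / (1 - \<alpha>))"
    unfolding u_def using \<alpha>(2) by (rule nn_integral_powr_head)
  have "ennreal (2 / (1 - \<alpha>)) = ennreal (1 / (1 - \<alpha>)) + ennreal (1 / (1 - \<alpha>))"
    using \<alpha> by (subst ennreal_plus[symmetric]) auto
  also have "\<dots> = (\<integral>\<^sup>+t. u t + u (- t) \<partial>lborel)"
    by (subst nn_integral_add) (auto simp: U nn_integral_reflect[OF um])
  also have "\<dots> \<le> (\<integral>\<^sup>+(t::real). ennreal (\<bar>indicator (cball (0::real^'n) 1) (t *\<^sub>R e)\<bar> / norm (t *\<^sub>R e) powr \<alpha>) \<partial>lborel)"
    by (intro nn_integral_mono) (auto simp: u_def indicator_def ne powr_minus divide_inverse)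
  also have "\<dots> = (\<integral>\<^sup>+x. ennreal (\<bar>indicator (cball (0::real^'n) 1) x\<bar> / norm x powr \<alpha>) \<partial>lborel)"
    by (rule nn_integral_dim1[OF e, symmetric]) measurable
  finally show ?thesis by (simp add: nn_integral_completion)
qed

end

subsection \<open>The fractional Hardy inequality\<close>

text \<open>The zero field is admissible. With finiteness this makes the variation a nonnegative
  real, so estimates may use a real V.\<close>

lemma frac_variation_nonneg: "0 \<le> frac_variation \<alpha> f"
proof -
  have z: "(\<lambda>_. 0) \<in> Cc_infinity" by (rule Cc_infinityI[where r=0]) (auto intro: class_C_const)
  have "Linfinity_norm (\<lambda>_::real^'a. 0 :: real^'a) \<le> 1" by (rule Linfinity_norm_le_1) auto
  then have "ereal (\<integral>x. f x * frac_div \<alpha> (\<lambda>_. 0) x \<partial>lebesgue) \<le> frac_variation \<alpha> f"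
    unfolding frac_variation_def using z by (intro SUP_upper) simp
  then show ?thesis by (simp add: frac_div_def zero_ereal_def)
qed

text \<open>Moves the extended-real product with c to a bound V / c for the nonnegative integral,
  the form in which Fatou's lemma delivers the estimates.\<close>

lemma frac_Hardy_constI:
  assumes c: "0 < c" and h: "\<And>p (f :: real^'n \<Rightarrow> real) V x0. \<lbrakk>1 \<le> p; p < real CARD('n) / (1 - \<alpha>); f \<in> Lp p;
    CARD('n) = 1 \<Longrightarrow> (AE x in lebesgue. 0 \<le> f x); frac_variation \<alpha> f \<le> ereal V\<rbrakk> \<Longrightarrow>
    (\<integral>\<^sup>+x. ennreal (\<bar>f x\<bar> / norm (x - x0) powr \<alpha>) \<partial>lebesgue) \<le> ennreal (V / c)"
  shows "frac_Hardy_const TYPE('n) \<alpha> c"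
  unfolding frac_Hardy_const_def
proof (intro allI impI ballI)
  fix p and f :: "real^'n \<Rightarrow> real" and x0
  assume p: "1 \<le> p \<and> p < real CARD('n) / (1 - \<alpha>)" and f: "f \<in> BV_frac \<alpha> p"
    and f0: "CARD('n) = 1 \<longrightarrow> (AE x in lebesgue. 0 \<le> f x)"
  have fin: "frac_variation \<alpha> f < \<infinity>" and fLp: "f \<in> Lp p" using f by (auto simp: BV_frac_def)
  then obtain V where V: "frac_variation \<alpha> f = ereal V" "0 \<le> V"
    using frac_variation_nonneg[of \<alpha> f] by (cases "frac_variation \<alpha> f") auto
  let ?I = "\<integral>\<^sup>+x. ennreal (\<bar>f x\<bar> / norm (x - x0) powr \<alpha>) \<partial>lebesgue"
  have "?I \<le> ennreal (V / c)" using h[of p f V x0] p fLp f0 V by auto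
  then have "enn2ereal ?I \<le> ereal (V / c)"
    using V(2) c less_eq_ennreal.rep_eq[of ?I "ennreal (V / c)"] by simp
  then have "ereal c * enn2ereal ?I \<le> ereal c * ereal (V / c)" using c by (intro ereal_mult_left_mono) auto
  also have "\<dots> = frac_variation \<alpha> f" using c V by simp
  finally show "ereal c * enn2ereal ?I \<le> frac_variation \<alpha> f" .
qed

theorem theorem1p2:
  fixes \<alpha> :: real
  assumes "0 < \<alpha>" and "\<alpha> < 1"
  shows "(\<exists>c>0. frac_Hardy_const TYPE('n::finite) \<alpha> c) \<and>
         (CARD('n) = 1 \<longrightarrow>
            2 * mu 1 \<alpha> / \<alpha> > 0 \<and>
            frac_Hardy_const TYPE('n) \<alpha> (2 * mu 1 \<alpha> / \<alpha>) \<and>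
            (\<forall>c. frac_Hardy_const TYPE('n) \<alpha> c \<longrightarrow> c \<le> 2 * mu 1 \<alpha> / \<alpha>))"
proof -
  have pos: "0 < 2 * mu 1 \<alpha> / \<alpha>" using assms mu_pos[of \<alpha> 1] by simp
  have one: "frac_Hardy_const TYPE('n) \<alpha> (2 * mu 1 \<alpha> / \<alpha>)" if "CARD('n) = 1"
    using that by (intro frac_Hardy_constI pos hardy_one_dim assms) auto
  have opt: "c \<le> 2 * mu 1 \<alpha> / \<alpha>" if dim: "CARD('n) = 1" and c: "frac_Hardy_const TYPE('n) \<alpha> c" for c
  proof (cases "c \<le> 0")
    case False
    \<comment> \<open>The extremal function is tested with p = 1, admissible since 1 < 1/(1 -
      \<alpha>), and with x0 at the centre of the interval.\<close>
    let ?f = "indicator (cball (0::real^'n) 1) :: real^'n \<Rightarrow> real"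
    let ?I = "\<integral>\<^sup>+x. ennreal (\<bar>?f x\<bar> / norm (x - 0) powr \<alpha>) \<partial>lebesgue"
    have V: "frac_variation \<alpha> ?f \<le> ereal (4 * mu 1 \<alpha> / (\<alpha> * (1 - \<alpha>)))"
      using assms dim by (rule variation_unit_ball)
    have "?f \<in> Lp 1"
    proof -
      have "(\<lambda>x. \<bar>?f x\<bar> powr 1) = ?f" by (auto simp: indicator_def)
      moreover have "integrable lebesgue ?f" by (subst integrable_completion) auto
      moreover have "?f \<in> borel_measurable lebesgue" by (rule lebesgue_borelI) measurable
      ultimately show ?thesis by (simp add: Lp_def)
    qed
    then have "?f \<in> BV_frac \<alpha> 1" using V by (auto simp: BV_frac_def intro: order_le_less_trans)
    moreover have "1 < real CARD('n) / (1 - \<alpha>)" using assms dim by simp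
    ultimately have "ereal c * enn2ereal ?I \<le> frac_variation \<alpha> ?f"
      using c[unfolded frac_Hardy_const_def, rule_format, of 1 ?f 0] by auto
    also note V
    finally have le: "ereal c * enn2ereal ?I \<le> ereal (4 * mu 1 \<alpha> / (\<alpha> * (1 - \<alpha>)))" .
    have "ereal (2 / (1 - \<alpha>)) = enn2ereal (ennreal (2 / (1 - \<alpha>)))" using assms by simp
    also have "\<dots> \<le> enn2ereal ?I"
      using hardy_integral_unit_ball[OF assms dim] by (simp only: less_eq_ennreal.rep_eq)
    finally have "ereal c * ereal (2 / (1 - \<alpha>)) \<le> ereal c * enn2ereal ?I"
      using False by (intro ereal_mult_left_mono) auto
    also note le
    finally have "c * (2 / (1 - \<alpha>)) \<le> 4 * mu 1 \<alpha> / (\<alpha> * (1 - \<alpha>))" by simp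
    moreover have "c * (2 / (1 - \<alpha>)) = (2 * \<alpha> * c) / (\<alpha> * (1 - \<alpha>))" using assms by simp
    moreover have "0 < \<alpha> * (1 - \<alpha>)" using assms by simp
    ultimately have "2 * \<alpha> * c \<le> 4 * mu 1 \<alpha>" by (simp only: divide_le_cancel)
    then show ?thesis using assms by (simp add: field_simps)
  qed (use pos in linarith)
  have "\<exists>c>0. frac_Hardy_const TYPE('n) \<alpha> c"
  proof (cases "CARD('n) = 1")
    case True
    with pos one show ?thesis by blast
  next
    case False
    then have dim: "2 \<le> CARD('n)" using zero_less_card_finite[where 'a='n] by linarith
    obtain c where c: "0 < c" "\<And>(f :: real^'n \<Rightarrow> real) p V x0. \<lbrakk>f \<in> Lp p; 1 \<le> p; frac_variation \<alpha> f \<le> ereal V\<rbrakk> \<Longrightarrow>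
      (\<integral>\<^sup>+x. ennreal (\<bar>f x\<bar> / norm (x - x0) powr \<alpha>) \<partial>lebesgue) \<le> ennreal (V / c)"
      using hardy_higher_dim[OF assms dim] by blast
    then show ?thesis by (intro exI[of _ c] conjI frac_Hardy_constI) auto
  qed
  with pos one opt show ?thesis by blast
qed

end
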